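(* Let $(X,\alpha)$ and $(Y,\beta)$ be Cantor minimal systems. The following are equivalent. (1) There is a unital order homomorphism $\rho$ from $K^0(Y,\beta)$ to $K^0(X,\alpha)$. (2) There exist a continuous map $F:X\to Y$ and a minimal homeomorphism $\gamma\in[\alpha]$ such that the integer valued cocycle $n:X\to\mathbb{Z}$ associated with $\gamma$ (defined by $\gamma(x)=\alpha^{n(x)}(x)$) has at most one point of discontinuity and $\beta F=F\gamma$. (3) There exists a continuous map $F:X\to Y$ such that $\{g\circ F:g\in B_\beta\}\subset B_\alpha$. (4) There exists a sequence of homeomorphisms $\sigma_n:X\to Y$ such that $\sigma_n\alpha\sigma_n^{-1}\to\beta$ in $\operatorname{Homeo}(Y)$ and $\lim_{n\to\infty}[f\circ\sigma_n]_\alpha$ exists in $K^0(X,\alpha)$ (with the discrete topology, i.e. the sequence is eventually constant) for every $f\in C(Y,\mathbb{Z})$.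
   Context: A Cantor minimal system $(X,\alpha)$ consists of a Cantor set $X$ and a homeomorphism $\alpha$ of $X$ with no nontrivial closed invariant subsets. $\operatorname{Homeo}(Y)$ carries the topology of uniform convergence: $\gamma_n\to\gamma$ iff $\sup_{y}d(\gamma_n(y),\gamma(y))\to0$ for a compatible metric $d$. $B_\alpha=\{f-f\circ\alpha^{-1}: f\in C(X,\mathbb{Z})\}$, $K^0(X,\alpha)=C(X,\mathbb{Z})/B_\alpha$ with class of $f$ written $[f]_\alpha$; it is an ordered group with positive cone the classes of nonnegative functions and order unit $[1_X]_\alpha$. A unital order homomorphism is a group homomorphism mapping the positive cone into the positive cone and the order unit to the order unit. The full group $[\alpha]$ is the group of homeomorphisms $\gamma$ of $X$ such that $\gamma(x)$ lies in the $\alpha$-orbit of $x$ for every $x\in X$. *)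

theory Defs
  imports "HOL-Analysis.Analysis" "HOL-Algebra.Group"
begin

definition cantor_set :: "'a::metric_space set \<Rightarrow> bool" where
  "cantor_set X \<longleftrightarrow> X \<noteq> {} \<and> compact X \<and> (\<forall>x\<in>X. x islimpt X)
     \<and> (\<forall>x\<in>X. connected_component_set X x = {x})"

definition is_homeo :: "'a::topological_space set \<Rightarrow> ('a \<Rightarrow> 'a) \<Rightarrow> bool" where
  "is_homeo X h \<longleftrightarrow> (\<exists>g. homeomorphism X X h g)"

definition minimal_on :: "'a::topological_space set \<Rightarrow> ('a \<Rightarrow> 'a) \<Rightarrow> bool" where
  "minimal_on X h \<longleftrightarrow> (\<forall>A. A \<subseteq> X \<longrightarrow> closedin (top_of_set X) A \<longrightarrow> h ` A = A
       \<longrightarrow> A = {} \<or> A = X)"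

definition cantor_minimal_system :: "'a::metric_space set \<Rightarrow> ('a \<Rightarrow> 'a) \<Rightarrow> bool" where
  "cantor_minimal_system X h \<longleftrightarrow> cantor_set X \<and> is_homeo X h \<and> minimal_on X h"

definition hpow :: "'a set \<Rightarrow> ('a \<Rightarrow> 'a) \<Rightarrow> int \<Rightarrow> 'a \<Rightarrow> 'a" where
  "hpow X h n = (if 0 \<le> n then h ^^ nat n else inv_into X h ^^ nat (- n))"

definition cont_int :: "'a::topological_space set \<Rightarrow> ('a \<Rightarrow> int) \<Rightarrow> bool" where
  "cont_int X f \<longleftrightarrow> continuous_on X (\<lambda>x. real_of_int (f x))"

definition cob :: "'a::topological_space set \<Rightarrow> ('a \<Rightarrow> 'a) \<Rightarrow> ('a \<Rightarrow> int) \<Rightarrow> bool" where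
  "cob X h g \<longleftrightarrow> (\<exists>f. cont_int X f \<and> (\<forall>x\<in>X. g x = f x - f (hpow X h (-1) x)))"

definition k0_class :: "'a::topological_space set \<Rightarrow> ('a \<Rightarrow> 'a) \<Rightarrow> ('a \<Rightarrow> int) \<Rightarrow> ('a \<Rightarrow> int) set" where
  "k0_class X h f = {g. cont_int X g \<and> cob X h (\<lambda>x. g x - f x)}"

definition k0 :: "'a::topological_space set \<Rightarrow> ('a \<Rightarrow> 'a) \<Rightarrow> ('a \<Rightarrow> int) set monoid" where
  "k0 X h = \<lparr> carrier = {k0_class X h f | f. cont_int X f},
              mult = (\<lambda>A B. {(\<lambda>x. f x + g x) | f g. f \<in> A \<and> g \<in> B}),
              one = k0_class X h (\<lambda>x. 0) \<rparr>"

definition k0_pos :: "'a::topological_space set \<Rightarrow> ('a \<Rightarrow> 'a) \<Rightarrow> ('a \<Rightarrow> int) set set" where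
  "k0_pos X h = {k0_class X h f | f. cont_int X f \<and> (\<forall>x\<in>X. 0 \<le> f x)}"

definition k0_unit :: "'a::topological_space set \<Rightarrow> ('a \<Rightarrow> 'a) \<Rightarrow> ('a \<Rightarrow> int) set" where
  "k0_unit X h = k0_class X h (\<lambda>x. 1)"

definition unital_order_hom ::
  "('b::topological_space set) \<Rightarrow> ('b \<Rightarrow> 'b) \<Rightarrow> ('a::topological_space set) \<Rightarrow> ('a \<Rightarrow> 'a)
    \<Rightarrow> (('b \<Rightarrow> int) set \<Rightarrow> ('a \<Rightarrow> int) set) \<Rightarrow> bool" where
  "unital_order_hom Y k X h \<rho> \<longleftrightarrow> \<rho> \<in> hom (k0 Y k) (k0 X h)
      \<and> \<rho> ` k0_pos Y k \<subseteq> k0_pos X h \<and> \<rho> (k0_unit Y k) = k0_unit X h"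

definition full_group :: "'a::topological_space set \<Rightarrow> ('a \<Rightarrow> 'a) \<Rightarrow> ('a \<Rightarrow> 'a) set" where
  "full_group X h = {g. is_homeo X g \<and> (\<forall>x\<in>X. \<exists>n::int. g x = hpow X h n x)}"

definition orbit_cocycle :: "'a set \<Rightarrow> ('a \<Rightarrow> 'a) \<Rightarrow> ('a \<Rightarrow> 'a) \<Rightarrow> 'a \<Rightarrow> int" where
  "orbit_cocycle X h g x = (THE n. g x = hpow X h n x)"

end

theory Submission
  imports Defs
begin

text \<open>
  Over a clopen base \<open>B\<close> the space \<open>X\<close> splits into columns (orbit segments between consecutive visits
  to \<open>B\<close>). A function is a coboundary iff its column sums vanish over some sufficiently small base;
  hence order and equality in $K^0$ become statements about integers, column by column. In
  particular a class between \<open>0\<close> and $[1_A]$ is realised by a clopen subset of \<open>A\<close>, and clopen sets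
  of equal class are matched by a map that is locally a power of \<open>\<alpha>\<close>.

  (1) implies (4): every column of \<open>X\<close> can be tiled by towers of a fine Kakutani--Rokhlin partition
  of \<open>Y\<close> so that the classes prescribed by \<open>\<rho>\<close> come out; any homeomorphism respecting this labelling
  conjugates \<open>\<alpha>\<close> to a map close to \<open>\<beta>\<close>.

  (1) implies (2): labellings \<open>\<kappa>\<close> of \<open>X\<close> by atoms of ever finer Kakutani--Rokhlin partitions of \<open>Y\<close>,
  with bases shrinking to \<open>y0\<close>, are built together with maps \<open>\<gamma>\<close> that are locally powers of \<open>\<alpha>\<close> and
  follow \<open>\<beta>\<close> below the roof. The base and the roof of the labelling shrink to points \<open>q\<close> and
  \<open>p = \<alpha>\<inverse> q\<close>, so the limit of the \<open>\<gamma>\<close> extends by \<open>p \<mapsto> q\<close> and its cocycle is discontinuous at most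
  at \<open>p\<close>; letting the orbit of \<open>q\<close> visit a prescribed open set at every stage makes it minimal.
\<close>

section \<open>Locally constant functions\<close>

text \<open>The implications closed are (1) => (2) => (3) => (1) and (1) <=> (4). Condition (1)
  enters only through the locale \<open>k0_map\<close>: a homomorphism becomes a map
  \<open>r\<close> of functions that respects sums, order and unit up to coboundaries. As
  \<open>r\<close> prescribes classes and not sets, every clopen set that a construction wants must
  be found with the right class. Where one might compare invariant measures,
  \<open>small_class\<close> uses bounded return times: boundedly many translates of one set cover,
  as many translates of another are disjoint, and the common factor cancels because column sums are
  integers. In (1) => (2) the base must shrink to \<open>q\<close>, the roof to \<open>p\<close>,
  and orbits must visit open sets, all by relabelling within the classes given by \<open>r\<close>;
  the one lemma \<open>step\<close> does each of these, for a time \<open>i\<close> that is zero,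
  negative or positive. Meanwhile \<open>y0\<close> has to stay in the label of \<open>q\<close> and
  its predecessor in the label of \<open>p\<close>, so every refinement honours two prescribed
  points. Continuity is phrased as local constancy with arbitrary values, so that words, atoms and
  exponents are treated alike.\<close>

definition locally_const :: "'a::topological_space set \<Rightarrow> ('a \<Rightarrow> 'c) \<Rightarrow> bool" where
  "locally_const X f \<longleftrightarrow> (\<forall>x\<in>X. \<forall>\<^sub>F y in inf (nhds x) (principal X). f y = f x)"

abbreviation clopen_on :: "'a::topological_space set \<Rightarrow> 'a set \<Rightarrow> bool" where
  "clopen_on X A \<equiv> locally_const X (\<lambda>x. x \<in> A)"

lemma locally_constI:
  "(\<And>x. x \<in> X \<Longrightarrow> \<forall>\<^sub>F y in inf (nhds x) (principal X). f y = f x) \<Longrightarrow> locally_const X f"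
  by (simp add: locally_const_def)

lemma locally_constD:
  "locally_const X f \<Longrightarrow> x \<in> X \<Longrightarrow> \<forall>\<^sub>F y in inf (nhds x) (principal X). f y = f x"
  by (simp add: locally_const_def)

lemma eventually_nhds_principal:
  "eventually P (inf (nhds x) (principal X)) \<longleftrightarrow> (\<exists>U. open U \<and> x \<in> U \<and> (\<forall>y\<in>U \<inter> X. P y))"
  by (auto simp: eventually_inf_principal eventually_nhds)

lemma eventually_in_principal: "\<forall>\<^sub>F y in inf (nhds x) (principal X). y \<in> X"
  by (simp add: eventually_inf_principal)

lemma locally_const_const [simp, intro]: "locally_const X (\<lambda>x. c)"
  by (simp add: locally_const_def)

lemma locally_const_comp: "locally_const X f \<Longrightarrow> locally_const X (\<lambda>x. h (f x))"
  unfolding locally_const_def by (auto elim!: eventually_mono ballE)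

lemma locally_const_comp2:
  assumes "locally_const X f" "locally_const X g"
  shows "locally_const X (\<lambda>x. h (f x) (g x))"
proof (rule locally_constI)
  fix x assume "x \<in> X"
  with assms have "\<forall>\<^sub>F y in inf (nhds x) (principal X). f y = f x"
    "\<forall>\<^sub>F y in inf (nhds x) (principal X). g y = g x" by (auto dest: locally_constD)
  then show "\<forall>\<^sub>F y in inf (nhds x) (principal X). h (f y) (g y) = h (f x) (g x)"
    by eventually_elim simp
qed

lemma locally_const_cong:
  assumes "locally_const X f" "\<And>x. x \<in> X \<Longrightarrow> f x = g x"
  shows "locally_const X g"
proof (rule locally_constI)
  fix x assume "x \<in> X"
  with assms have "\<forall>\<^sub>F y in inf (nhds x) (principal X). f y = f x" by (auto dest: locally_constD)
  then show "\<forall>\<^sub>F y in inf (nhds x) (principal X). g y = g x"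
    using eventually_in_principal by eventually_elim (use assms \<open>x \<in> X\<close> in auto)
qed

text \<open>Near \<open>x\<close> the index \<open>f\<close> has a single value, so only one member
  of the family matters there. This covers maps with a locally constant exponent, such as
  \<open>f (T (k x) x)\<close>.\<close>

lemma locally_const_select:
  assumes "locally_const X f" "\<And>v. locally_const X (g v)"
  shows "locally_const X (\<lambda>x. g (f x) x)"
proof (rule locally_constI)
  fix x assume "x \<in> X"
  with assms have "\<forall>\<^sub>F y in inf (nhds x) (principal X). f y = f x"
    "\<forall>\<^sub>F y in inf (nhds x) (principal X). g (f x) y = g (f x) x" by (auto dest: locally_constD)
  then show "\<forall>\<^sub>F y in inf (nhds x) (principal X). g (f y) y = g (f x) x"
    by eventually_elim simp
qed

lemma locally_const_if:
  assumes "locally_const X P" "locally_const X f" "locally_const X g"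
  shows "locally_const X (\<lambda>x. if P x then f x else g x)"
proof -
  have "locally_const X (\<lambda>x. (if P x then f else g) x)"
    by (rule locally_const_select[OF assms(1), of "\<lambda>b. if b then f else g"]) (simp add: assms)
  then show ?thesis by (rule locally_const_cong) simp
qed

lemma locally_const_restrict:
  assumes "finite I" "\<And>i. i \<in> I \<Longrightarrow> locally_const X (f i)"
  shows "locally_const X (\<lambda>x. restrict (\<lambda>i. f i x) I)"
proof (rule locally_constI)
  fix x assume "x \<in> X"
  with assms have "\<forall>\<^sub>F y in inf (nhds x) (principal X). \<forall>i\<in>I. f i y = f i x"
    by (auto simp: eventually_ball_finite_distrib dest: locally_constD)
  then show "\<forall>\<^sub>F y in inf (nhds x) (principal X). restrict (\<lambda>i. f i y) I = restrict (\<lambda>i. f i x) I"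
    by eventually_elim (auto simp: restrict_def)
qed

lemma locally_const_upto:
  assumes "\<And>i. locally_const X (f i)"
  shows "locally_const X (\<lambda>x. h (map (\<lambda>i. f i x) [0..<n]))"
proof -
  have "locally_const X (\<lambda>x. map (\<lambda>i. f i x) [0..<n])"
    by (induction n) (auto intro: locally_const_comp2[where h="\<lambda>a b. a @ [b]"] assms)
  then show ?thesis by (rule locally_const_comp)
qed

lemma locally_const_sum:
  assumes "\<And>i. i \<in> I \<Longrightarrow> locally_const X (f i)"
  shows "locally_const X (\<lambda>x. \<Sum>i\<in>I. f i x)"
  using assms
proof (induction I rule: infinite_finite_induct)
  case (insert i I)
  then have "locally_const X (\<lambda>x. f i x + (\<Sum>i\<in>I. f i x))" by (intro locally_const_comp2[where h="(+)"]) auto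
  then show ?case using insert by simp
qed auto

text \<open>The least index at \<open>x\<close> is decided by the finitely many predicates up to
  that index, and these are simultaneously constant near \<open>x\<close>. Ages and return times are
  such least indices.\<close>

lemma locally_const_Least:
  fixes Q :: "nat \<Rightarrow> 'a::topological_space \<Rightarrow> bool"
  assumes "\<And>n. locally_const X (Q n)" "\<And>x. x \<in> X \<Longrightarrow> \<exists>n. Q n x"
  shows "locally_const X (\<lambda>x. LEAST n. Q n x)"
proof (rule locally_constI)
  fix x assume x: "x \<in> X"
  define N where "N = (LEAST n. Q n x)"
  have N: "Q N x" unfolding N_def using assms(2)[OF x] by (rule LeastI_ex)
  have "\<forall>\<^sub>F y in inf (nhds x) (principal X). \<forall>n\<in>{..N}. Q n y = Q n x"
    using assms(1) x by (auto simp: eventually_ball_finite_distrib dest: locally_constD)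
  then show "\<forall>\<^sub>F y in inf (nhds x) (principal X). (LEAST n. Q n y) = (LEAST n. Q n x)"
  proof eventually_elim
    case (elim y)
    have "(LEAST n. Q n y) = N"
    proof (rule Least_equality)
      show "Q N y" using elim N by auto
      show "N \<le> m" if "Q m y" for m
      proof (rule ccontr)
        assume "\<not> N \<le> m"
        then have "Q m x" using elim that by auto
        then show False using not_less_Least[of m "\<lambda>n. Q n x"] \<open>\<not> N \<le> m\<close> N_def by auto
      qed
    qed
    then show ?case by (simp add: N_def)
  qed
qed

lemma filterlim_nhds_principal:
  assumes "continuous_on X t" "t ` X \<subseteq> Z" "x \<in> X"
  shows "filterlim t (inf (nhds (t x)) (principal Z)) (inf (nhds x) (principal X))"
proof -
  have "(t \<longlongrightarrow> t x) (inf (nhds x) (principal X))"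
  proof (rule topological_tendstoI)
    fix S assume "open S" "t x \<in> S"
    then obtain A where "open A" "x \<in> A" "\<forall>y\<in>X. y \<in> A \<longrightarrow> t y \<in> S"
      using assms(1,3) unfolding continuous_on_topological by meson
    then show "\<forall>\<^sub>F y in inf (nhds x) (principal X). t y \<in> S"
      unfolding eventually_nhds_principal by (intro exI[of _ A]) auto
  qed
  moreover have "filterlim t (principal Z) (inf (nhds x) (principal X))"
    using assms(2) unfolding filterlim_principal eventually_inf_principal by (intro always_eventually) auto
  ultimately show ?thesis by (simp add: filterlim_inf)
qed

lemma locally_const_compose:
  assumes "locally_const Z f" "continuous_on X t" "t ` X \<subseteq> Z"
  shows "locally_const X (\<lambda>x. f (t x))"
proof (rule locally_constI)
  fix x assume x: "x \<in> X"
  then have "\<forall>\<^sub>F z in inf (nhds (t x)) (principal Z). f z = f (t x)"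
    using assms by (auto dest: locally_constD)
  then show "\<forall>\<^sub>F y in inf (nhds x) (principal X). f (t y) = f (t x)"
    using filterlim_nhds_principal[OF assms(2,3) x] unfolding filterlim_iff by blast
qed

lemma locally_const_imp_continuous_on:
  fixes f :: "'a::topological_space \<Rightarrow> 'b::topological_space"
  assumes "locally_const X f"
  shows "continuous_on X f"
proof (unfold continuous_on_topological, intro ballI allI impI)
  fix x B assume "x \<in> X" "open B" "f x \<in> B"
  moreover obtain U where "open U" "x \<in> U" "\<forall>y\<in>U \<inter> X. f y = f x"
    using locally_constD[OF assms \<open>x \<in> X\<close>] unfolding eventually_nhds_principal by blast
  ultimately show "\<exists>A. open A \<and> x \<in> A \<and> (\<forall>y\<in>X. y \<in> A \<longrightarrow> f y \<in> B)"
    by (metis IntI)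
qed

text \<open>Two integers at distance less than 1 are equal, which turns continuity into local
  constancy.\<close>

lemma cont_int_iff: "cont_int X f \<longleftrightarrow> locally_const X f"
proof
  assume "locally_const X f"
  then show "cont_int X f" unfolding cont_int_def
    by (rule locally_const_imp_continuous_on[OF locally_const_comp])
next
  assume c: "cont_int X f"
  show "locally_const X f"
  proof (rule locally_constI)
    fix x assume x: "x \<in> X"
    have "open {r::real. \<bar>r - real_of_int (f x)\<bar> < 1}"
      by (intro open_Collect_less continuous_intros)
    then obtain A where "open A" "x \<in> A" "\<forall>y\<in>X. y \<in> A \<longrightarrow> real_of_int (f y) \<in> {r. \<bar>r - real_of_int (f x)\<bar> < 1}"
      using c x unfolding cont_int_def continuous_on_topological
      by (metis (mono_tags, lifting) abs_zero diff_self mem_Collect_eq zero_less_one)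
    then have "\<forall>y\<in>A \<inter> X. f y = f x" by (auto simp flip: of_int_diff)
    then show "\<forall>\<^sub>F y in inf (nhds x) (principal X). f y = f x"
      unfolding eventually_nhds_principal using \<open>open A\<close> \<open>x \<in> A\<close> by blast
  qed
qed

lemma locally_const_openin:
  assumes "locally_const X f"
  shows "openin (top_of_set X) {x\<in>X. Q (f x)}"
proof (subst openin_subopen, safe)
  fix x assume x: "x \<in> X" "Q (f x)"
  then obtain U where "open U" "x \<in> U" and U: "\<forall>y\<in>U \<inter> X. f y = f x"
    using assms unfolding locally_const_def eventually_nhds_principal by blast
  have "X \<inter> U \<subseteq> {x \<in> X. Q (f x)}"
  proof
    fix y assume y: "y \<in> X \<inter> U"
    with U have "f y = f x" by blast
    then show "y \<in> {x \<in> X. Q (f x)}" using y x by simp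
  qed
  then show "\<exists>T. openin (top_of_set X) T \<and> x \<in> T \<and> T \<subseteq> {x \<in> X. Q (f x)}"
    using x \<open>open U\<close> \<open>x \<in> U\<close> by (metis IntI openin_open_Int)
qed

lemma locally_const_closedin:
  assumes "locally_const X f"
  shows "closedin (top_of_set X) {x\<in>X. Q (f x)}"
proof -
  have "X - {x\<in>X. Q (f x)} = {x\<in>X. \<not> Q (f x)}" by auto
  then show ?thesis using locally_const_openin[OF assms, of "\<lambda>v. \<not> Q v"]
    by (simp add: closedin_def)
qed

lemma locally_const_compact:
  assumes "compact X" "locally_const X f"
  shows "compact {x\<in>X. Q (f x)}"
  by (rule closedin_compact[OF assms(1) locally_const_closedin[OF assms(2)]])

lemma clopen_onI:
  assumes "openin (top_of_set X) A" "closedin (top_of_set X) A"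
  shows "clopen_on X A"
proof (rule locally_constI)
  fix x assume x: "x \<in> X"
  obtain U V where U: "open U" "A = X \<inter> U" and V: "closed V" "A = X \<inter> V"
    using assms by (auto simp: openin_open closedin_closed)
  show "\<forall>\<^sub>F y in inf (nhds x) (principal X). (y \<in> A) = (x \<in> A)"
    unfolding eventually_nhds_principal
    by (rule exI[of _ "if x \<in> A then U else - V"]) (use U V x in auto)
qed

lemma locally_const_finite_image:
  assumes "compact X" "locally_const X f"
  shows "finite (f ` X)"
proof -
  have "\<forall>x\<in>X. \<exists>U. open U \<and> x \<in> U \<and> (\<forall>y\<in>U \<inter> X. f y = f x)"
    using assms(2) unfolding locally_const_def eventually_nhds_principal .
  then obtain U where U: "\<And>x. x \<in> X \<Longrightarrow> open (U x) \<and> x \<in> U x \<and> (\<forall>y\<in>U x \<inter> X. f y = f x)" by metis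
  then obtain D where "D \<subseteq> X" "finite D" "X \<subseteq> (\<Union>x\<in>D. U x)"
    using compactE_image[OF assms(1), of X U] by (metis UN_iff subsetI)
  have "f ` X \<subseteq> f ` D"
  proof
    fix v assume "v \<in> f ` X"
    then obtain x d where "v = f x" "x \<in> X" "d \<in> D" "x \<in> U d" using \<open>X \<subseteq> (\<Union>x\<in>D. U x)\<close> by blast
    then show "v \<in> f ` D" using U[of d] \<open>D \<subseteq> X\<close> by (metis IntI imageI subsetD)
  qed
  then show ?thesis using \<open>finite D\<close> finite_surj by blast
qed

lemma locally_const_small_sets:
  fixes X :: "'a::metric_space set"
  assumes "compact X" "locally_const X f"
  shows "\<exists>e>0. \<forall>x\<in>X. \<forall>y\<in>X. dist x y < e \<longrightarrow> f x = f y"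
proof -
  have "\<forall>x\<in>X. \<exists>U. open U \<and> x \<in> U \<and> (\<forall>y\<in>U \<inter> X. f y = f x)"
    using assms(2) unfolding locally_const_def eventually_nhds_principal .
  then obtain U where U: "\<And>x. x \<in> X \<Longrightarrow> open (U x) \<and> x \<in> U x \<and> (\<forall>y\<in>U x \<inter> X. f y = f x)" by metis
  have "X \<subseteq> \<Union> (U ` X)" "\<And>G. G \<in> U ` X \<Longrightarrow> open G" using U by auto
  then obtain e where "e > 0" and e: "\<And>x. x \<in> X \<Longrightarrow> \<exists>G\<in>U ` X. ball x e \<subseteq> G"
    using Heine_Borel_lemma[OF assms(1)] by metis
  show ?thesis
  proof (intro exI[of _ e] conjI ballI impI \<open>e > 0\<close>)
    fix x y assume xy: "x \<in> X" "y \<in> X" "dist x y < e"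
    obtain z where z: "z \<in> X" "ball x e \<subseteq> U z" using e xy by blast
    then have "x \<in> U z" "y \<in> U z" using xy \<open>e > 0\<close> by auto
    then show "f x = f y" using U[OF z(1)] xy by (metis IntI)
  qed
qed

section \<open>Cantor sets\<close>

text \<open>Total disconnectedness is given through connected components; in a compact Hausdorff
  space a component is separated by a clopen set from any closed set disjoint from it, here from
  \<open>X - U\<close>.\<close>

lemma cantor_set_clopen_nbhd:
  assumes "cantor_set X" "x \<in> X" "open U" "x \<in> U"
  obtains S where "clopen_on X S" "x \<in> S" "S \<subseteq> X" "S \<subseteq> U"
proof -
  let ?T = "top_of_set X"
  have comp: "compact X" and conn: "connected_component_set X x = {x}"
    using assms by (auto simp: cantor_set_def)
  have eq: "connected_component_of_set ?T x = {x}"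
  proof -
    have "connected_component_of ?T x y \<longleftrightarrow> connected_component X x y" for y
      unfolding connected_component_of_def connected_component_def connectedin_subtopology
        connectedin_iff_connected by blast
    then show ?thesis using conn by (simp add: set_eq_iff)
  qed
  have C: "{x} \<in> connected_components_of ?T"
    unfolding connected_components_of_def by (rule image_eqI[of _ _ x]) (simp_all add: eq assms(2))
  have "closedin ?T (X - U)" using assms(3) unfolding closedin_closed by (intro exI[of _ "- U"]) auto
  then have "separated_between ?T {x} (X - U)"
    using C comp assms by (intro separated_between_compact_connected_component)
      (auto simp: compact_space_subtopology compact_imp_locally_compact_space Hausdorff_space_subtopology
        compactin_subtopology disjnt_def)
  then obtain S where "openin ?T S" "closedin ?T S" "x \<in> S" "X - U \<subseteq> X - S"
    unfolding separated_between by auto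
  then show ?thesis using that[of S] clopen_onI[of X S] openin_imp_subset by blast
qed

lemma cantor_set_infinite_open:
  assumes "cantor_set X" "x \<in> X" "open U" "x \<in> U"
  shows "infinite (X \<inter> U)"
proof -
  have "x islimpt (X \<inter> U)" using assms by (metis Int_commute cantor_set_def islimpt_Int_eventually eventually_at_topological)
  then show ?thesis using islimpt_finite by blast
qed

lemma clopen_infinite:
  assumes "cantor_set X" "clopen_on X A" "x \<in> A" "x \<in> X"
  shows "infinite (A \<inter> X)"
proof -
  obtain U where "open U" "x \<in> U" "\<forall>y\<in>U \<inter> X. y \<in> A"
    using assms locally_constD[OF assms(2,4)] unfolding eventually_nhds_principal by auto
  then show ?thesis using cantor_set_infinite_open[OF assms(1,4), of U]
    by (metis Int_commute finite_subset le_infI2 subsetI IntI inf_le1 IntE)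
qed

text \<open>The pieces of a finite clopen cover may overlap; labelling a point by the first piece
  that contains it removes the overlaps.\<close>

lemma cantor_set_fine_partition:
  assumes "cantor_set X" "e > 0"
  shows "\<exists>l :: 'a::metric_space \<Rightarrow> nat. locally_const X l \<and> (\<forall>x\<in>X. \<forall>y\<in>X. l x = l y \<longrightarrow> dist x y < e)"
proof -
  have comp: "compact X" using assms by (auto simp: cantor_set_def)
  have "\<exists>S. clopen_on X S \<and> x \<in> S \<and> S \<subseteq> X \<and> S \<subseteq> ball x (e/2)" if "x \<in> X" for x
    using cantor_set_clopen_nbhd[OF assms(1) that, of "ball x (e/2)"] assms(2) by (metis centre_in_ball half_gt_zero open_ball)
  then obtain S where S: "\<And>x. x \<in> X \<Longrightarrow> clopen_on X (S x) \<and> x \<in> S x \<and> S x \<subseteq> X \<and> S x \<subseteq> ball x (e/2)" by metis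
  have "\<forall>x\<in>X. \<exists>V. open V \<and> x \<in> V \<and> V \<inter> X \<subseteq> S x"
    using S unfolding locally_const_def eventually_nhds_principal by (metis Int_iff subsetI)
  then obtain V where V: "\<And>x. x \<in> X \<Longrightarrow> open (V x) \<and> x \<in> V x \<and> V x \<inter> X \<subseteq> S x" by metis
  then obtain D where D: "D \<subseteq> X" "finite D" "X \<subseteq> (\<Union>x\<in>D. V x)"
    using compactE_image[OF comp, of X V] by (metis UN_iff subsetI)
  obtain xs where xs: "set xs = D" using finite_list[OF D(2)] by blast
  define Q where "Q = (\<lambda>n x. n < length xs \<and> x \<in> S (xs!n))"
  define l where "l = (\<lambda>x. LEAST n. Q n x)"
  have ex: "\<exists>n. Q n x" if xX: "x \<in> X" for x
  proof -
    obtain d where "d \<in> D" "x \<in> V d" using D xX by blast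
    then have "x \<in> S d" using V D(1) that by blast
    then show ?thesis unfolding Q_def using \<open>d \<in> D\<close> xs by (metis in_set_conv_nth)
  qed
  have "locally_const X (Q n)" for n
  proof (cases "n < length xs")
    case True
    then have "xs!n \<in> X" using xs D(1) nth_mem by blast
    then show ?thesis using S True by (auto simp: Q_def)
  qed (simp add: Q_def)
  then have "locally_const X l" unfolding l_def by (intro locally_const_Least ex)
  moreover have "dist x y < e" if "x \<in> X" "y \<in> X" "l x = l y" for x y
  proof -
    have "Q (l x) x" "Q (l y) y" unfolding l_def using LeastI_ex[OF ex] that by auto
    then have "l x < length xs" "x \<in> S (xs!l x)" "y \<in> S (xs!l x)" using that by (auto simp: Q_def)
    moreover then have "xs ! l x \<in> X" using xs D(1) nth_mem by blast
    ultimately have "dist (xs!l x) x < e/2" "dist (xs!l x) y < e/2" using S by (auto simp: subset_iff)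
    then show ?thesis using dist_triangle_half_r by blast
  qed
  ultimately show ?thesis by blast
qed

section \<open>Integer iterates\<close>

lemma hpow_0 [simp]: "hpow X h 0 x = x"
  by (simp add: hpow_def)

lemma hpow_in:
  assumes "bij_betw h X X" "x \<in> X"
  shows "hpow X h n x \<in> X"
proof -
  have "(h ^^ k) x \<in> X" "(inv_into X h ^^ k) x \<in> X" for k
    using assms by (induction k) (auto simp: bij_betw_def intro: inv_into_into)
  then show ?thesis by (simp add: hpow_def)
qed

lemma hpow_succ:
  assumes "bij_betw h X X" "x \<in> X"
  shows "hpow X h (n + 1) x = h (hpow X h n x)"
proof (cases "0 \<le> n")
  case True
  then show ?thesis by (simp add: hpow_def nat_add_distrib)
next
  case False
  then obtain k where k: "nat (- n) = Suc k" by (cases "nat (- n)") auto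
  have "(inv_into X h ^^ k) x \<in> X"
    using assms by (induction k) (auto simp: bij_betw_def intro: inv_into_into)
  then have "h (inv_into X h ((inv_into X h ^^ k) x)) = (inv_into X h ^^ k) x"
    using assms(1) by (auto simp: bij_betw_def f_inv_into_f)
  moreover have "nat (- (n + 1)) = k" "n + 1 \<le> 0" "n + 1 = 0 \<Longrightarrow> k = 0" using k by auto
  ultimately show ?thesis using False k by (cases "n + 1 = 0") (auto simp: hpow_def)
qed

lemma hpow_pred:
  assumes "bij_betw h X X" "x \<in> X"
  shows "hpow X h (n - 1) x = inv_into X h (hpow X h n x)"
  using hpow_succ[OF assms, of "n - 1"] hpow_in[OF assms, of "n - 1"] assms(1)
  by (simp add: bij_betw_def)

lemma hpow_add:
  assumes "bij_betw h X X" "x \<in> X"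
  shows "hpow X h (m + n) x = hpow X h m (hpow X h n x)"
proof (induction m rule: int_induct[where k=0])
  case (step1 i)
  then show ?case
    using hpow_succ[OF assms, of "i + n"] hpow_succ[OF assms(1) hpow_in[OF assms], of i n]
    by (simp add: algebra_simps)
next
  case (step2 i)
  then show ?case
    using hpow_pred[OF assms, of "i + n"] hpow_pred[OF assms(1) hpow_in[OF assms], of i n]
    by (simp add: algebra_simps)
qed simp

locale cantor_minimal =
  fixes X :: "'a::metric_space set" and \<alpha> :: "'a \<Rightarrow> 'a"
  assumes system: "cantor_minimal_system X \<alpha>"
begin

abbreviation T :: "int \<Rightarrow> 'a \<Rightarrow> 'a" where "T \<equiv> hpow X \<alpha>"

lemma cantor: "cantor_set X" and minimal: "minimal_on X \<alpha>"
  and compact_X: "compact X" and nonempty: "X \<noteq> {}"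
  using system by (auto simp: cantor_minimal_system_def cantor_set_def)

lemma bij: "bij_betw \<alpha> X X"
  and continuous_\<alpha>: "continuous_on X \<alpha>"
  and continuous_inv: "continuous_on X (inv_into X \<alpha>)"
proof -
  obtain g where g: "homeomorphism X X \<alpha> g"
    using system by (auto simp: cantor_minimal_system_def is_homeo_def)
  then show b: "bij_betw \<alpha> X X" and "continuous_on X \<alpha>"
    by (auto simp: homeomorphism_def bij_betw_def intro!: inj_on_inverseI)
  have "inv_into X \<alpha> x = g x" if "x \<in> X" for x
    using g b that by (metis bij_betw_inv_into_left homeomorphism_def image_eqI)
  then show "continuous_on X (inv_into X \<alpha>)"
    using g by (metis continuous_on_cong homeomorphism_def)
qed

lemmas T_in [simp] = hpow_in[OF bij]
lemmas T_succ = hpow_succ[OF bij]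
lemmas T_add = hpow_add[OF bij]

lemma T_1: "x \<in> X \<Longrightarrow> T 1 x = \<alpha> x"
  using T_succ[of x 0] by simp

lemma \<alpha>_in [simp]: "x \<in> X \<Longrightarrow> \<alpha> x \<in> X"
  using T_in[of x 1] T_1 by simp

lemma T_minus [simp]: "x \<in> X \<Longrightarrow> T (- n) (T n x) = x" "x \<in> X \<Longrightarrow> T n (T (- n) x) = x"
  using T_add[of x "- n" n] T_add[of x n "- n"] by auto

lemma T_\<alpha>: "x \<in> X \<Longrightarrow> T n (\<alpha> x) = T (n + 1) x"
  using T_add[of x n 1] T_1 by simp

lemma continuous_T: "continuous_on X (T n)"
proof (induction n rule: int_induct[where k=0])
  case base
  show ?case by (rule continuous_on_eq[OF continuous_on_id]) simp
next
  case (step1 i)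
  have "continuous_on X (\<alpha> \<circ> T i)"
    using step1 continuous_\<alpha> by (intro continuous_on_compose) (auto elim: continuous_on_subset)
  then show ?case by (rule continuous_on_eq) (simp add: T_succ)
next
  case (step2 i)
  have "continuous_on X (inv_into X \<alpha> \<circ> T i)"
    using step2 continuous_inv by (intro continuous_on_compose) (auto elim: continuous_on_subset)
  then show ?case by (rule continuous_on_eq) (simp add: hpow_pred[OF bij])
qed

lemma locally_const_T: "locally_const X f \<Longrightarrow> locally_const X (\<lambda>x. f (T n x))"
  by (rule locally_const_compose[OF _ continuous_T]) auto

lemma locally_const_T_select:
  "locally_const X k \<Longrightarrow> locally_const X f \<Longrightarrow> locally_const X (\<lambda>x. f (T (k x) x))"
  by (rule locally_const_select[where g="\<lambda>n x. f (T n x)"]) (auto intro: locally_const_T)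

text \<open>The points whose orbit meets \<open>E\<close> form a nonempty open invariant set, so
  minimality makes it all of \<open>X\<close>. Compactness bounds the absolute value of the hitting
  times by \<open>N\<close>, and starting at \<open>T N x\<close> moves the window to times
  \<open>0\<close> to \<open>2 * N\<close>.\<close>

lemma hits_bounded:
  assumes "clopen_on X E" "x0 \<in> E" "x0 \<in> X"
  shows "\<exists>M::nat. \<forall>x\<in>X. \<exists>i\<le>M. T (int i) x \<in> E"
proof -
  define W where "W = {x\<in>X. \<exists>n. T n x \<in> E}"
  have op: "openin (top_of_set X) {x\<in>X. T n x \<in> E}" for n
    using locally_const_openin[OF locally_const_T[OF assms(1), of n], of "\<lambda>b. b"] .
  then have "openin (top_of_set X) (\<Union>n. {x\<in>X. T n x \<in> E})" by blast
  moreover have W': "W = (\<Union>n. {x\<in>X. T n x \<in> E})" by (auto simp: W_def)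
  ultimately have "closedin (top_of_set X) (X - W)" by auto
  moreover have "\<alpha> ` (X - W) = X - W"
  proof (intro equalityI subsetI)
    fix y assume "y \<in> \<alpha> ` (X - W)"
    then obtain x where x: "y = \<alpha> x" "x \<in> X" "x \<notin> W" by auto
    then have "T n y \<notin> E" for n using T_\<alpha>[of x n] by (auto simp: W_def)
    then show "y \<in> X - W" using x by (auto simp: W_def)
  next
    fix y assume y: "y \<in> X - W"
    let ?x = "T (-1) y"
    have "\<alpha> ?x = y" using y T_1[of ?x] T_minus(2)[of y 1] by simp
    moreover have "T n ?x \<notin> E" for n using y T_add[of y n "-1"] by (metis (mono_tags, lifting) DiffE W_def mem_Collect_eq)
    ultimately show "y \<in> \<alpha> ` (X - W)" using y by (intro image_eqI[of _ _ ?x]) (auto simp: W_def)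
  qed
  moreover have "x0 \<in> W" using assms by (auto simp: W_def intro!: exI[of _ 0])
  ultimately have "X - W = {}" using minimal assms(3) unfolding minimal_on_def by blast
  then have cover: "X \<subseteq> (\<Union>n. {x\<in>X. T n x \<in> E})" using W' by auto
  have "\<forall>n. \<exists>U. open U \<and> {x\<in>X. T n x \<in> E} = X \<inter> U" using op by (simp add: openin_open)
  then obtain U where U: "\<And>n. open (U n)" "\<And>n. {x\<in>X. T n x \<in> E} = X \<inter> U n" by metis
  have "X \<subseteq> (\<Union>n. U n)" using cover U by blast
  then obtain D where D: "finite D" "X \<subseteq> (\<Union>n\<in>D. U n)"
    using compactE_image[OF compact_X, of UNIV U] U(1) by metis
  define N where "N = Max (insert 0 ((\<lambda>n. nat \<bar>n\<bar>) ` D))"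
  have N: "\<bar>n\<bar> \<le> int N" if "n \<in> D" for n
  proof -
    have "nat \<bar>n\<bar> \<le> N" unfolding N_def using that D(1) by (intro Max_ge) auto
    then show ?thesis by simp
  qed
  show ?thesis
  proof (rule exI[of _ "2 * N"], rule ballI)
    fix x assume x: "x \<in> X"
    then have "T (int N) x \<in> (\<Union>n\<in>D. U n)" using D(2) T_in[OF x, of "int N"] by blast
    then obtain n where n: "n \<in> D" "T (int N) x \<in> U n" by auto
    then have "T (int N) x \<in> {x\<in>X. T n x \<in> E}" unfolding U(2) using T_in[OF x, of "int N"] by blast
    then have "T n (T (int N) x) \<in> E" by blast
    then have "T (n + int N) x \<in> E" using T_add[OF x, of n "int N"] by simp
    moreover have "0 \<le> n + int N" "n + int N \<le> 2 * int N" using N[OF n(1)] by auto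
    ultimately show "\<exists>i\<le>2 * N. T (int i) x \<in> E" by (intro exI[of _ "nat (n + int N)"]) auto
  qed
qed

lemma hits_forward: "clopen_on X E \<Longrightarrow> x0 \<in> E \<Longrightarrow> x0 \<in> X \<Longrightarrow> x \<in> X \<Longrightarrow> \<exists>i::nat. T (int i) x \<in> E"
  using hits_bounded by blast

text \<open>The uniform bound is what matters: from the point \<open>M\<close> steps back, a forward
  hit occurs at the latest at \<open>x\<close> itself.\<close>

lemma hits_backward:
  assumes "clopen_on X E" "x0 \<in> E" "x0 \<in> X" "x \<in> X"
  shows "\<exists>i::nat. T (- int i) x \<in> E"
proof -
  obtain M where M: "\<forall>x\<in>X. \<exists>i\<le>M. T (int i) x \<in> E" using hits_bounded assms by blast
  then obtain i where i: "i \<le> M" "T (int i) (T (- int M) x) \<in> E" using assms(4) by (meson T_in)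
  then have "T (- int (M - i)) x \<in> E" using T_add[OF assms(4), of "int i" "- int M"] by (simp add: of_nat_diff)
  then show ?thesis by blast
qed

lemma X_infinite: "infinite X"
  using cantor_set_infinite_open[OF cantor, of _ UNIV] nonempty by auto

text \<open>A periodic orbit is finite, hence closed, and invariant; by minimality it would be all
  of the infinite set \<open>X\<close>.\<close>

lemma not_periodic:
  assumes "x \<in> X" "n > 0"
  shows "T (int n) x \<noteq> x"
proof
  assume per: "T (int n) x = x"
  define A where "A = (\<lambda>i. T (int i) x) ` {..<n}"
  have sub: "A \<subseteq> X" and fin: "finite A" using assms by (auto simp: A_def)
  have "\<alpha> ` A \<subseteq> A"
  proof
    fix y assume "y \<in> \<alpha> ` A"
    then obtain i where i: "i < n" "y = T (int (Suc i)) x"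
      using assms(1) T_succ by (auto simp: A_def add.commute[of 1])
    show "y \<in> A"
    proof (cases "Suc i = n")
      case True
      then show ?thesis using i per assms(2) unfolding A_def by (intro image_eqI[of _ _ 0]) auto
    next
      case False
      then show ?thesis using i unfolding A_def by (intro image_eqI[of _ _ "Suc i"]) auto
    qed
  qed
  then have "\<alpha> ` A = A" using fin sub bij
    by (meson bij_betw_def card_subset_eq card_image inj_on_subset finite_imageI)
  moreover have "closedin (top_of_set X) A"
    using fin sub by (auto simp: closedin_closed intro!: exI[of _ A] finite_imp_closed)
  moreover have "A \<noteq> {}" using assms by (auto simp: A_def)
  ultimately have "A = X" using minimal sub unfolding minimal_on_def by blast
  then show False using fin X_infinite by blast
qed

text \<open>Aperiodicity in the form that makes the cocycle of a full group element well
  defined.\<close>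

lemma T_inj:
  assumes "x \<in> X" "T m x = T n x"
  shows "m = n"
proof -
  have *: "k = 0" if "T k x = x" for k
  proof (rule ccontr)
    assume "k \<noteq> 0"
    have "T (- k) x = x" using T_minus(1)[OF assms(1), of k] that by simp
    then have "T (int (nat \<bar>k\<bar>)) x = x" using that by (simp add: abs_if)
    then show False using not_periodic[OF assms(1), of "nat \<bar>k\<bar>"] \<open>k \<noteq> 0\<close> by simp
  qed
  have "T (m - n) x = x"
    using T_add[OF assms(1), of "- n" m] T_minus(1)[OF assms(1), of n] assms(2) by simp
  then show ?thesis using * by force
qed

section \<open>Columns over a clopen base\<close>

definition age :: "'a set \<Rightarrow> 'a \<Rightarrow> nat" where
  "age B x = (LEAST j. T (- int j) x \<in> B)"

definition foot :: "'a set \<Rightarrow> 'a \<Rightarrow> 'a" where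
  "foot B x = T (- int (age B x)) x"

text \<open>The \<open>Suc\<close> in the search and the \<open>+ 1\<close> outside keep the return
  time positive: at a point of \<open>B\<close>, time 0 must not count.\<close>

definition ret :: "'a set \<Rightarrow> 'a \<Rightarrow> nat" where
  "ret B x = (LEAST j. T (int (Suc j)) x \<in> B) + 1"

definition colsum :: "'a set \<Rightarrow> ('a \<Rightarrow> int) \<Rightarrow> 'a \<Rightarrow> int" where
  "colsum B f b = (\<Sum>i<ret B b. f (T (int i) b))"

definition is_base :: "'a set \<Rightarrow> bool" where
  "is_base B \<longleftrightarrow> B \<subseteq> X \<and> B \<noteq> {} \<and> clopen_on X B"

context
  fixes B assumes B: "is_base B"
begin

lemma base_in: "b \<in> B \<Longrightarrow> b \<in> X" and base_clopen: "clopen_on X B"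
  using B by (auto simp: is_base_def)

lemma age_ex: "x \<in> X \<Longrightarrow> \<exists>j. T (- int j) x \<in> B"
  using B hits_backward[of B _ x] by (auto simp: is_base_def)

lemma ret_ex: "x \<in> X \<Longrightarrow> \<exists>j. T (int (Suc j)) x \<in> B"
  using B hits_forward[of B _ "\<alpha> x"] T_\<alpha>[of x] by (auto simp: is_base_def add.commute)

lemma foot_in: "x \<in> X \<Longrightarrow> foot B x \<in> B"
  unfolding foot_def age_def by (rule LeastI_ex) (rule age_ex)

lemma T_age_foot: "x \<in> X \<Longrightarrow> T (int (age B x)) (foot B x) = x"
  by (simp add: foot_def)

lemma ret_pos: "0 < ret B x"
  by (simp add: ret_def)

lemma T_ret_in: "x \<in> X \<Longrightarrow> T (int (ret B x)) x \<in> B"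
  unfolding ret_def using LeastI_ex[OF ret_ex] by simp

lemma not_in_before_ret:
  assumes "0 < i" "i < ret B x"
  shows "T (int i) x \<notin> B"
proof -
  obtain j where j: "i = Suc j" using assms(1) by (cases i) auto
  then have "j < (LEAST j. T (int (Suc j)) x \<in> B)" using assms(2) by (simp add: ret_def)
  then show ?thesis using not_less_Least j by blast
qed

lemma age_foot_level:
  assumes "b \<in> B" "i < ret B b"
  shows "age B (T (int i) b) = i" "foot B (T (int i) b) = b"
proof -
  have bX: "b \<in> X" using assms base_in by blast
  have eq: "T (- int j) (T (int i) b) = T (int i - int j) b" for j
    using T_add[OF bX, of "- int j" "int i"] by simp
  show *: "age B (T (int i) b) = i"
    unfolding age_def
  proof (rule Least_equality)
    show "T (- int i) (T (int i) b) \<in> B" using assms bX by simp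
    show "i \<le> j" if "T (- int j) (T (int i) b) \<in> B" for j
    proof (rule ccontr)
      assume "\<not> i \<le> j"
      then have "0 < i - j" "i - j < ret B b" using assms by auto
      moreover have "T (int (i - j)) b \<in> B" using that eq[of j] \<open>\<not> i \<le> j\<close> by (simp add: of_nat_diff)
      ultimately show False using not_in_before_ret by blast
    qed
  qed
  show "foot B (T (int i) b) = b" using * bX by (simp add: foot_def)
qed

lemma age_less_ret:
  assumes "x \<in> X"
  shows "age B x < ret B (foot B x)"
proof (rule ccontr)
  assume "\<not> age B x < ret B (foot B x)"
  let ?r = "ret B (foot B x)"
  have rX: "foot B x \<in> X" using foot_in[OF assms] base_in by blast
  have "T (int ?r) (foot B x) \<in> B" using T_ret_in[OF rX] .
  also have "T (int ?r) (foot B x) = T (- int (age B x - ?r)) x"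
    using T_add[OF assms, of "int ?r" "- int (age B x)"] \<open>\<not> age B x < ?r\<close>
    by (simp add: foot_def of_nat_diff algebra_simps)
  finally have "age B x \<le> age B x - ?r" unfolding age_def by (rule Least_le)
  then show False using ret_pos[of "foot B x"] \<open>\<not> age B x < ?r\<close> by linarith
qed

lemma age_base: "b \<in> B \<Longrightarrow> age B b = 0" "b \<in> B \<Longrightarrow> foot B b = b"
  using age_foot_level[of b 0] ret_pos by auto

lemma age_eq_0: "x \<in> X \<Longrightarrow> age B x = 0 \<longleftrightarrow> x \<in> B"
  using age_base foot_in[of x] by (auto simp: foot_def)

lemma base_succ_iff:
  assumes "x \<in> X"
  shows "\<alpha> x \<in> B \<longleftrightarrow> Suc (age B x) = ret B (foot B x)"
proof -
  have rB: "foot B x \<in> B" using foot_in[OF assms] .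
  have eq: "\<alpha> x = T (int (Suc (age B x))) (foot B x)"
    using T_succ[of "foot B x" "int (age B x)"] T_age_foot[OF assms] base_in[OF rB] by (simp add: add.commute)
  show ?thesis
    using age_less_ret[OF assms] not_in_before_ret[of "Suc (age B x)" "foot B x"] T_ret_in[OF base_in[OF rB]]
    unfolding eq by (cases "Suc (age B x) = ret B (foot B x)") auto
qed

lemma age_foot_succ:
  assumes "x \<in> X" "\<alpha> x \<notin> B"
  shows "age B (\<alpha> x) = Suc (age B x)" "foot B (\<alpha> x) = foot B x"
proof -
  have rB: "foot B x \<in> B" using foot_in[OF assms(1)] .
  have eq: "\<alpha> x = T (int (Suc (age B x))) (foot B x)"
    using T_succ[of "foot B x" "int (age B x)"] T_age_foot[OF assms(1)] base_in[OF rB] by (simp add: add.commute)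
  have "Suc (age B x) < ret B (foot B x)" 
    using base_succ_iff[OF assms(1)] assms(2) age_less_ret[OF assms(1)] by linarith
  then show "age B (\<alpha> x) = Suc (age B x)" "foot B (\<alpha> x) = foot B x"
    unfolding eq using age_foot_level[OF rB] by blast+
qed

lemma locally_const_age: "locally_const X (age B)"
  unfolding age_def by (intro locally_const_Least locally_const_T base_clopen age_ex)

lemma locally_const_ret: "locally_const X (ret B)"
  unfolding ret_def
  by (rule locally_const_comp[OF locally_const_Least[OF locally_const_T[OF base_clopen]], where h="\<lambda>n. n + 1"])
    (rule ret_ex)

lemma locally_const_foot: "locally_const X f \<Longrightarrow> locally_const X (\<lambda>x. f (foot B x))"
  unfolding foot_def by (rule locally_const_T_select[OF locally_const_comp[OF locally_const_age]])

lemma locally_const_colsum: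
  assumes "locally_const X f"
  shows "locally_const X (colsum B f)"
  unfolding colsum_def
  by (rule locally_const_select[OF locally_const_ret, where g="\<lambda>n b. \<Sum>i<n. f (T (int i) b)"])
    (intro locally_const_sum locally_const_T assms)

end

section \<open>Cohomologous functions and column sums\<close>

definition sim :: "('a \<Rightarrow> int) \<Rightarrow> ('a \<Rightarrow> int) \<Rightarrow> bool" where
  "sim f g \<longleftrightarrow> cob X \<alpha> (\<lambda>x. f x - g x)"

lemma cob_iff: "cob X \<alpha> f \<longleftrightarrow> (\<exists>u. locally_const X u \<and> (\<forall>x\<in>X. f x = u x - u (T (-1) x)))"
  by (simp add: cob_def cont_int_iff)

lemma sim_iff: "sim f g \<longleftrightarrow> (\<exists>u. locally_const X u \<and> (\<forall>x\<in>X. f x - g x = u x - u (T (-1) x)))"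
  by (simp add: sim_def cob_iff)

lemma simI: "locally_const X u \<Longrightarrow> (\<And>x. x \<in> X \<Longrightarrow> f x - g x = u x - u (T (-1) x)) \<Longrightarrow> sim f g"
  by (auto simp: sim_iff)

lemma sim_eq: "(\<And>x. x \<in> X \<Longrightarrow> f x = g x) \<Longrightarrow> sim f g"
  by (rule simI[of "\<lambda>_. 0"]) auto

lemma sim_refl [simp]: "sim f f"
  by (rule sim_eq) simp

lemma sim_sym: "sim f g \<Longrightarrow> sim g f"
proof -
  assume "sim f g"
  then obtain u where u: "locally_const X u" "\<forall>x\<in>X. f x - g x = u x - u (T (-1) x)" by (auto simp: sim_iff)
  show ?thesis
    by (rule simI[of "\<lambda>x. - u x"]) (use u in \<open>auto intro: locally_const_comp[where h=uminus] simp: algebra_simps\<close>)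
qed

lemma sim_add:
  assumes "sim f g" "sim f' g'"
  shows "sim (\<lambda>x. f x + f' x) (\<lambda>x. g x + g' x)"
proof -
  obtain u where u: "locally_const X u" "\<forall>x\<in>X. f x - g x = u x - u (T (-1) x)"
    using assms(1) by (auto simp: sim_iff)
  obtain v where v: "locally_const X v" "\<forall>x\<in>X. f' x - g' x = v x - v (T (-1) x)"
    using assms(2) by (auto simp: sim_iff)
  show ?thesis
    by (rule simI[of "\<lambda>x. u x + v x"])
      (use u v in \<open>auto intro: locally_const_comp2[where h="(+)"] simp: algebra_simps\<close>)
qed

lemma sim_mult:
  assumes "sim f g"
  shows "sim (\<lambda>x. c * f x) (\<lambda>x. c * g x)"
proof -
  obtain u where u: "locally_const X u" "\<forall>x\<in>X. f x - g x = u x - u (T (-1) x)"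
    using assms(1) by (auto simp: sim_iff)
  show ?thesis
    by (rule simI[of "\<lambda>x. c * u x"])
      (use u in \<open>auto intro: locally_const_comp[where h="(*) c"] simp flip: right_diff_distrib\<close>)
qed

lemma sim_uminus: "sim f g \<Longrightarrow> sim (\<lambda>x. - f x) (\<lambda>x. - g x)"
  using sim_mult[of f g "-1"] by simp

lemma sim_diff: "sim f g \<Longrightarrow> sim f' g' \<Longrightarrow> sim (\<lambda>x. f x - f' x) (\<lambda>x. g x - g' x)"
  using sim_add[OF _ sim_uminus, of f g f' g'] by simp

lemma sim_trans [trans]:
  assumes "sim f g" "sim g h"
  shows "sim f h"
  using sim_add[OF assms] by (simp add: sim_def add.commute)

lemma sim_sum:
  assumes "\<And>i. i \<in> I \<Longrightarrow> sim (f i) (g i)"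
  shows "sim (\<lambda>x. \<Sum>i\<in>I. f i x) (\<lambda>x. \<Sum>i\<in>I. g i x)"
  using assms
proof (induction I rule: infinite_finite_induct)
  case (insert i I)
  then have "sim (\<lambda>x. f i x + (\<Sum>i\<in>I. f i x)) (\<lambda>x. g i x + (\<Sum>i\<in>I. g i x))" by (intro sim_add) auto
  then show ?case using insert by simp
qed auto

lemma sim_shift_one:
  assumes "locally_const X f"
  shows "sim f (\<lambda>x. f (T 1 x))"
proof (rule simI[of "\<lambda>x. - f (T 1 x)"])
  show "locally_const X (\<lambda>x. - f (T 1 x))"
    by (rule locally_const_comp[where h=uminus]) (rule locally_const_T[OF assms])
  show "f x - f (T 1 x) = - f (T 1 x) - - f (T 1 (T (- 1) x))" if "x \<in> X" for x
    using T_minus(2)[OF that, of 1] by simp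
qed

lemma sim_shift:
  assumes "locally_const X f"
  shows "sim f (\<lambda>x. f (T n x))"
proof (induction n rule: int_induct[where k=0])
  case base
  show ?case by simp
next
  case (step1 i)
  have "sim (\<lambda>x. f (T i x)) (\<lambda>x. f (T i (T 1 x)))"
    using sim_shift_one[OF locally_const_T[OF assms]] .
  also have "sim \<dots> (\<lambda>x. f (T (i + 1) x))" by (rule sim_eq) (simp add: T_add)
  finally show ?case using step1 sim_trans by blast
next
  case (step2 i)
  have "sim (\<lambda>x. f (T (i - 1) x)) (\<lambda>x. f (T (i - 1) (T 1 x)))"
    using sim_shift_one[OF locally_const_T[OF assms]] .
  also have "sim \<dots> (\<lambda>x. f (T i x))" by (rule sim_eq) (simp add: T_add[symmetric])
  finally show ?case using step2 sim_trans sim_sym by blast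
qed

lemma is_base_level:
  assumes "locally_const X u" "x \<in> X"
  shows "is_base {z\<in>X. u z = u x}" "x \<in> {z\<in>X. u z = u x}"
proof -
  have "locally_const X (\<lambda>z. z \<in> {z\<in>X. u z = u x})"
    by (rule locally_const_cong[OF locally_const_comp[OF assms(1), where h="\<lambda>v. v = u x"]]) auto
  then show "is_base {z\<in>X. u z = u x}" "x \<in> {z\<in>X. u z = u x}"
    using assms(2) by (auto simp: is_base_def)
qed

text \<open>The witness of a coboundary makes all column sums vanish as soon as it is constant on the base.\<close>

lemma sim_colsum:
  assumes "sim f g"
  obtains u :: "'a \<Rightarrow> int" where "locally_const X u"
    "\<And>B. is_base B \<Longrightarrow> (\<forall>x\<in>B. \<forall>y\<in>B. u x = u y) \<Longrightarrow> \<forall>b\<in>B. colsum B f b = colsum B g b"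
proof -
  obtain u where u: "locally_const X u" "\<forall>x\<in>X. f x - g x = u x - u (T (-1) x)"
    using assms by (auto simp: sim_iff)
  show thesis
  proof
    \<comment> \<open>The column sum of \<open>f - g\<close> telescopes to a difference of values of
      \<open>u\<close> one step before two consecutive visits to \<open>B\<close>; hence the shift
      of the witness by one step.\<close>
    show "locally_const X (\<lambda>x. u (T (-1) x))" using locally_const_T[OF u(1)] .
    fix B assume B: "is_base B" and c: "\<forall>x\<in>B. \<forall>y\<in>B. u (T (-1) x) = u (T (-1) y)"
    show "\<forall>b\<in>B. colsum B f b = colsum B g b"
    proof
      fix b assume b: "b \<in> B"
      then have bX: "b \<in> X" using base_in[OF B] by blast
      have "(\<Sum>i<n. f (T (int i) b) - g (T (int i) b)) = u (T (-1) (T (int n) b)) - u (T (-1) b)" for n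
      proof (induction n)
        case (Suc n)
        have "T (-1) (T (int (Suc n)) b) = T (int n) b" using T_add[OF bX, of "-1" "int (Suc n)"] by simp
        moreover have "f (T (int n) b) - g (T (int n) b) = u (T (int n) b) - u (T (-1) (T (int n) b))"
          using u(2) bX by simp
        ultimately show ?case using Suc by simp
      qed simp
      from this[of "ret B b"] have "colsum B f b - colsum B g b = u (T (-1) (T (int (ret B b)) b)) - u (T (-1) b)"
        unfolding colsum_def sum_subtractf .
      moreover have "u (T (-1) (T (int (ret B b)) b)) = u (T (-1) b)" using c b T_ret_in[OF B bX] by blast
      ultimately have "colsum B f b - colsum B g b = 0" by simp
      then show "colsum B f b = colsum B g b" by simp
    qed
  qed
qed

text \<open>The transfer function is the sum of \<open>f - g\<close> over the levels strictly below
  \<open>x\<close> in its column. Equality of the column sums is what lets it restart at 0 when the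
  next column begins.\<close>

lemma sim_of_colsum:
  assumes B: "is_base B" and lc: "locally_const X f" "locally_const X g"
    and eq: "\<forall>b\<in>B. colsum B f b = colsum B g b"
  shows "sim f g"
proof -
  define h where "h = (\<lambda>x. f x - g x)"
  define S where "S = (\<lambda>n b. \<Sum>i<n. h (T (int i) b))"
  define v where "v = (\<lambda>x. S (age B x) (foot B x))"
  have lch: "locally_const X h" unfolding h_def by (rule locally_const_comp2[where h="(-)", OF lc])
  have lcS: "locally_const X (S n)" for n
    unfolding S_def by (intro locally_const_sum locally_const_T lch)
  have lcv: "locally_const X v"
    unfolding v_def
    by (rule locally_const_select[OF locally_const_age[OF B], where g="\<lambda>n x. S n (foot B x)"])
      (rule locally_const_foot[OF B lcS])
  have step: "v (\<alpha> x) = v x + h x" if x: "x \<in> X" for x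
  proof -
    let ?b = "foot B x" and ?n = "age B x"
    have "S (Suc ?n) ?b = v x + h x" unfolding S_def v_def using T_age_foot[OF B x] by simp
    moreover have "v (\<alpha> x) = S (Suc ?n) ?b"
    proof (cases "\<alpha> x \<in> B")
      case True
      then have "Suc ?n = ret B ?b" using base_succ_iff[OF B x] by blast
      moreover have "S (ret B ?b) ?b = 0"
        using eq foot_in[OF B x] by (simp add: S_def h_def colsum_def sum_subtractf)
      ultimately show ?thesis using age_base[OF B True] by (simp add: v_def) (simp add: S_def)
    next
      case False
      then show ?thesis using age_foot_succ[OF B x False] by (simp add: v_def)
    qed
    ultimately show ?thesis by simp
  qed
  show ?thesis
  proof (rule simI)
    \<comment> \<open>\<open>v\<close> grows by \<open>f - g\<close> from \<open>x\<close> to its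
      successor, whereas coboundaries are formed with the inverse; so \<open>v\<close> is shifted
      one step forward.\<close>
    show "locally_const X (\<lambda>x. v (T 1 x))" by (rule locally_const_T[OF lcv])
    show "f x - g x = v (T 1 x) - v (T 1 (T (- 1) x))" if "x \<in> X" for x
      using step[OF that] T_1[OF that] T_minus(2)[OF that, of 1] by (simp add: h_def)
  qed
qed

text \<open>Positivity of the class, not of the function: by \<open>k0_pos_iff\<close> it is
  membership in the positive cone.\<close>

definition posc :: "('a \<Rightarrow> int) \<Rightarrow> bool" where
  "posc f \<longleftrightarrow> (\<exists>g. locally_const X g \<and> (\<forall>x\<in>X. 0 \<le> g x) \<and> sim f g)"

lemma poscI: "locally_const X f \<Longrightarrow> (\<And>x. x \<in> X \<Longrightarrow> 0 \<le> f x) \<Longrightarrow> posc f"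
  unfolding posc_def by (intro exI[of _ f]) auto

lemma posc_sim: "posc f \<Longrightarrow> sim f g \<Longrightarrow> posc g"
  unfolding posc_def by (metis sim_trans sim_sym)

lemma posc_add:
  assumes "posc f" "posc g"
  shows "posc (\<lambda>x. f x + g x)"
proof -
  obtain f' where f: "locally_const X f'" "\<forall>x\<in>X. 0 \<le> f' x" "sim f f'" using assms by (auto simp: posc_def)
  obtain g' where g: "locally_const X g'" "\<forall>x\<in>X. 0 \<le> g' x" "sim g g'" using assms by (auto simp: posc_def)
  show ?thesis unfolding posc_def
    using f g locally_const_comp2[where h="(+)", OF f(1) g(1)] sim_add[OF f(3) g(3)]
    by (intro exI[of _ "\<lambda>x. f' x + g' x"]) auto
qed

lemma posc_colsum:
  assumes "posc f"
  obtains u :: "'a \<Rightarrow> int" where "locally_const X u"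
    "\<And>B. is_base B \<Longrightarrow> (\<forall>x\<in>B. \<forall>y\<in>B. u x = u y) \<Longrightarrow> \<forall>b\<in>B. 0 \<le> colsum B f b"
proof -
  obtain g where g: "\<forall>x\<in>X. 0 \<le> g x" "sim f g" using assms by (auto simp: posc_def)
  obtain u :: "'a \<Rightarrow> int" where u: "locally_const X u" 
    "\<And>B. is_base B \<Longrightarrow> (\<forall>x\<in>B. \<forall>y\<in>B. u x = u y) \<Longrightarrow> \<forall>b\<in>B. colsum B f b = colsum B g b"
    using sim_colsum[OF g(2)] by metis
  show thesis
  proof (rule that[OF u(1)])
    fix B assume B: "is_base B" "\<forall>x\<in>B. \<forall>y\<in>B. u x = u y"
    show "\<forall>b\<in>B. 0 \<le> colsum B f b"
    proof
      fix b assume b: "b \<in> B"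
      then have "b \<in> X" using base_in[OF B(1)] by blast
      then have "0 \<le> colsum B g b" unfolding colsum_def using g(1) by (intro sum_nonneg) auto
      then show "0 \<le> colsum B f b" using u(2)[OF B] b by simp
    qed
  qed
qed

text \<open>Loading the whole column sum on the base level gives a nonnegative function with the
  same column sums.\<close>

lemma posc_of_colsum:
  assumes B: "is_base B" and lc: "locally_const X f" and pos: "\<forall>b\<in>B. 0 \<le> colsum B f b"
  shows "posc f"
proof -
  define g where "g = (\<lambda>x. if x \<in> B then colsum B f x else 0)"
  have lcg: "locally_const X g"
    unfolding g_def by (intro locally_const_if base_clopen[OF B] locally_const_colsum[OF B lc]) auto
  have "colsum B g b = colsum B f b" if b: "b \<in> B" for b
  proof -
    obtain n where n: "ret B b = Suc n" using ret_pos[OF B, of b] gr0_implies_Suc by blast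
    have "g (T (int (Suc i)) b) = 0" if "i < n" for i
      using not_in_before_ret[OF B, of "Suc i" b] n that by (auto simp: g_def)
    then have "(\<Sum>i<n. g (T (int (Suc i)) b)) = 0" by (intro sum.neutral) auto
    then have "colsum B g b = g b"
      unfolding colsum_def n by (subst sum.lessThan_Suc_shift) simp
    then show ?thesis using b by (simp add: g_def)
  qed
  then have "sim f g" by (intro sim_of_colsum[OF B lc lcg]) auto
  moreover have "\<forall>x\<in>X. 0 \<le> g x" using pos by (auto simp: g_def)
  ultimately show ?thesis unfolding posc_def using lcg by blast
qed

text \<open>Column sums are integers, and an integer with a nonnegative positive multiple is
  nonnegative. So the ordered group is unperforated, which \<open>small_class\<close> uses to cancel
  a factor.\<close>

lemma posc_unperforated:
  assumes "posc (\<lambda>x. int n * f x)" "n > 0" "locally_const X f"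
  shows "posc f"
proof -
  obtain x where x: "x \<in> X" using nonempty by blast
  obtain u :: "'a \<Rightarrow> int" where u: "locally_const X u"
    "\<And>B. is_base B \<Longrightarrow> (\<forall>x\<in>B. \<forall>y\<in>B. u x = u y) \<Longrightarrow> \<forall>b\<in>B. 0 \<le> colsum B (\<lambda>x. int n * f x) b"
    using posc_colsum[OF assms(1)] by metis
  let ?B = "{z\<in>X. u z = u x}"
  have B: "is_base ?B" using is_base_level[OF u(1) x] by blast
  have "\<forall>b\<in>?B. 0 \<le> int n * colsum ?B f b"
    using u(2)[OF B] unfolding colsum_def sum_distrib_left by simp
  then have "\<forall>b\<in>?B. 0 \<le> colsum ?B f b" using assms(2) by (simp add: zero_le_mult_iff)
  then show ?thesis using posc_of_colsum[OF B assms(3)] by blast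
qed

text \<open>Over a small base through \<open>x\<close> the column sum vanishes. It is a sum of
  nonnegative terms whose bottom term is \<open>f x\<close>.\<close>

lemma sim_0_nonneg:
  assumes "locally_const X f" "\<forall>x\<in>X. 0 \<le> f x" "sim f (\<lambda>_. 0)" "x \<in> X"
  shows "f x = 0"
proof -
  obtain u :: "'a \<Rightarrow> int" where u: "locally_const X u"
    "\<And>B. is_base B \<Longrightarrow> (\<forall>x\<in>B. \<forall>y\<in>B. u x = u y) \<Longrightarrow> \<forall>b\<in>B. colsum B f b = colsum B (\<lambda>_. 0) b"
    using sim_colsum[OF assms(3)] by metis
  let ?B = "{z\<in>X. u z = u x}"
  have B: "is_base ?B" "x \<in> ?B" using is_base_level[OF u(1) assms(4)] by blast+
  have "colsum ?B f x = 0" using u(2)[OF B(1)] B(2) by (simp add: colsum_def)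
  moreover have "f (T (int 0) x) \<le> colsum ?B f x"
    unfolding colsum_def using assms ret_pos[OF B(1)] by (intro member_le_sum) auto
  ultimately show ?thesis using assms(2,4) by (simp add: order.antisym)
qed

text \<open>Otherwise some \<open>g + 1\<close> with \<open>g\<close> nonnegative would be a
  strictly positive coboundary. This is the contradiction behind \<open>r_faithful\<close>.\<close>

lemma not_posc_minus_one: "\<not> posc (\<lambda>_. -1)"
proof
  assume "posc (\<lambda>_. -1)"
  then obtain g where g: "locally_const X g" "\<forall>x\<in>X. 0 \<le> g x" "sim (\<lambda>_. -1) g" by (auto simp: posc_def)
  have "sim (\<lambda>x. g x + 1) (\<lambda>x. -1 + 1)" by (intro sim_add sim_sym[OF g(3)]) auto
  then have "sim (\<lambda>x. g x + 1) (\<lambda>x. 0)" by simp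
  moreover obtain x where x: "x \<in> X" using nonempty by blast
  ultimately have "g x + 1 = 0"
    using g by (intro sim_0_nonneg[of "\<lambda>x. g x + 1" x]) (auto intro: locally_const_comp[where h="\<lambda>v. v + 1"])
  then show False using g x by fastforce
qed

end

section \<open>Clopen sets of prescribed class\<close>

abbreviation ind :: "'a set \<Rightarrow> 'a \<Rightarrow> int" where
  "ind A \<equiv> \<lambda>x. of_bool (x \<in> A)"

lemma locally_const_ind: "clopen_on X A \<Longrightarrow> locally_const X (ind A)"
  by (rule locally_const_comp)

lemma clopen_on_Diff: "clopen_on X A \<Longrightarrow> clopen_on X C \<Longrightarrow> clopen_on X (A - C)"
  by (rule locally_const_cong[OF locally_const_comp2[where h="\<lambda>a c. a \<and> \<not> c"]]) auto

lemma clopen_on_level: "locally_const X f \<Longrightarrow> clopen_on X {x\<in>X. Q (f x)}"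
  by (rule locally_const_cong[OF locally_const_comp[where h=Q]]) auto

text \<open>Bookkeeping for a single column, with \<open>a i\<close> saying that level
  \<open>i\<close> lies in a given set. The rank of a level is the number of levels of the set below
  it; the next two lemmas make it an index.\<close>

lemma sum_first_hits:
  fixes a :: "nat \<Rightarrow> bool"
  shows "(\<Sum>i<h. of_bool (a i \<and> (\<Sum>j<i. of_bool (a j)) < s)) = (min s (\<Sum>i<h. of_bool (a i)) :: nat)"
  by (induction h) (auto simp: min_def)

lemma hit_of_rank:
  fixes a :: "nat \<Rightarrow> bool"
  assumes "n < (\<Sum>i<h. of_bool (a i) :: nat)"
  shows "\<exists>i<h. a i \<and> (\<Sum>j<i. of_bool (a j)) = n"
  using assms
proof (induction h)
  case (Suc h)
  show ?case
  proof (cases "n < (\<Sum>i<h. of_bool (a i) :: nat)")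
    case True
    then show ?thesis using Suc.IH less_Suc_eq by auto
  next
    case False
    with Suc.prems have "a h" "n = (\<Sum>i<h. of_bool (a i))" by (cases "a h"; simp)+
    then show ?thesis by auto
  qed
qed simp

lemma rank_inj:
  fixes a :: "nat \<Rightarrow> bool"
  assumes "a i" "a i'" "(\<Sum>j<i. of_bool (a j) :: nat) = (\<Sum>j<i'. of_bool (a j))"
  shows "i = i'"
proof -
  have *: "(\<Sum>j<m. of_bool (a j) :: nat) < (\<Sum>j<n. of_bool (a j))" if "m < n" "a m" for m n
  proof -
    have "(\<Sum>j<m. of_bool (a j) :: nat) < (\<Sum>j<Suc m. of_bool (a j))" using that by simp
    also have "\<dots> \<le> (\<Sum>j<n. of_bool (a j))" using that by (intro sum_mono2) auto
    finally show ?thesis .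
  qed
  show ?thesis using *[of i i'] *[of i' i] assms by (cases i i' rule: linorder_cases) auto
qed

context cantor_minimal begin

text \<open>A nonnegative representative \<open>g\<close> is positive somewhere, and the orbit of
  \<open>x\<close> gets there at some time \<open>t\<close>. A base around \<open>x\<close> that
  avoids the orbit at times 1 to \<open>t\<close> keeps this visit inside the column over
  \<open>x\<close>.\<close>

lemma posc_colsum_strict:
  assumes "posc f" "\<not> sim f (\<lambda>_. 0)" "x \<in> X"
  obtains u :: "'a \<Rightarrow> int \<times> bool" where "locally_const X u"
    "\<And>B. is_base B \<Longrightarrow> (\<forall>y\<in>B. \<forall>z\<in>B. u y = u z) \<Longrightarrow> x \<in> B \<Longrightarrow> 0 < colsum B f x"
proof -
  obtain g where g: "locally_const X g" "\<forall>x\<in>X. 0 \<le> g x" "sim f g" using assms(1) by (auto simp: posc_def)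
  obtain u :: "'a \<Rightarrow> int" where u: "locally_const X u" 
    "\<And>B. is_base B \<Longrightarrow> (\<forall>x\<in>B. \<forall>y\<in>B. u x = u y) \<Longrightarrow> \<forall>b\<in>B. colsum B f b = colsum B g b"
    using sim_colsum[OF g(3)] by metis
  obtain z where z: "z \<in> X" "g z \<noteq> 0"
    using assms(2) g(3) sim_trans sim_eq[of g "\<lambda>_. 0"] by blast
  have "clopen_on X {z\<in>X. g z \<noteq> 0}" using clopen_on_level[OF g(1), of "\<lambda>v. v \<noteq> 0"] .
  then obtain t where t: "T (int t) x \<in> {z\<in>X. g z \<noteq> 0}" using hits_forward[of _ z x] z assms(3) by blast
  define U where "U = - ((\<lambda>i. T (int i) x) ` {1..t})"
  have "open U" unfolding U_def by (intro open_Compl finite_imp_closed) simp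
  moreover have "x \<in> U" unfolding U_def
  proof (rule ComplI, safe)
    fix i assume "x = T (int i) x" "i \<in> {1..t}"
    then show False using not_periodic[OF assms(3), of i] by simp
  qed
  ultimately obtain S where S: "clopen_on X S" "x \<in> S" "S \<subseteq> X" "S \<subseteq> U"
    using cantor_set_clopen_nbhd[OF cantor assms(3)] by metis
  show thesis
  proof (rule that[of "\<lambda>z. (u z, z \<in> S)"])
    show "locally_const X (\<lambda>z. (u z, z \<in> S))" using locally_const_comp2[OF u(1) S(1)] .
    fix B assume B: "is_base B" "\<forall>y\<in>B. \<forall>z\<in>B. (u y, y \<in> S) = (u z, z \<in> S)" "x \<in> B"
    have "T (int i) x \<notin> B" if "0 < i" "i \<le> t" for i
    proof
      assume "T (int i) x \<in> B"
      then have "T (int i) x \<in> S" using B(2,3) S(2) by (metis prod.inject)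
      then show False using S(4) that by (auto simp: U_def)
    qed
    then have "t < ret B x" using T_ret_in[OF B(1) assms(3)] ret_pos[OF B(1), of x] by (meson not_less)
    then have "g (T (int t) x) \<le> colsum B g x"
      unfolding colsum_def using g(2) assms(3) by (intro member_le_sum) auto
    moreover have "0 < g (T (int t) x)" using g(2) t by (simp add: order.not_eq_order_implies_strict)
    moreover have "colsum B f x = colsum B g x" using u(2)[OF B(1)] B(2,3) by blast
    ultimately show "0 < colsum B f x" by simp
  qed
qed

text \<open>In every column, keep the first levels of \<^term>\<open>A\<close>, as many as the column sum of \<^term>\<open>f\<close>
  prescribes; taking the base around \<^term>\<open>x\<close> puts \<^term>\<open>x\<close> on the lowest level.\<close>

lemma clopen_subset_of_class:
  assumes A: "clopen_on X A" "A \<subseteq> X" and f: "locally_const X f" "posc f"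
    and le: "posc (\<lambda>x. of_bool (x \<in> A) - f x)" and x: "x \<in> X"
  obtains C where "clopen_on X C" "C \<subseteq> A" "sim (ind C) f" "x \<in> A \<Longrightarrow> \<not> sim f (\<lambda>_. 0) \<Longrightarrow> x \<in> C"
proof -
  obtain u1 :: "'a \<Rightarrow> int" where u1: "locally_const X u1" 
    "\<And>B. is_base B \<Longrightarrow> (\<forall>x\<in>B. \<forall>y\<in>B. u1 x = u1 y) \<Longrightarrow> \<forall>b\<in>B. 0 \<le> colsum B f b"
    by (rule posc_colsum[OF f(2)]) blast
  obtain u2 :: "'a \<Rightarrow> int" where u2: "locally_const X u2" 
    "\<And>B. is_base B \<Longrightarrow> (\<forall>x\<in>B. \<forall>y\<in>B. u2 x = u2 y) \<Longrightarrow> \<forall>b\<in>B. 0 \<le> colsum B (\<lambda>x. of_bool (x \<in> A) - f x) b"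
    by (rule posc_colsum[OF le]) blast
  \<comment> \<open>The strict estimate exists only for a nonzero class; for the zero class the
    claim is void and a constant witness serves.\<close>
  have "\<exists>u :: 'a \<Rightarrow> int \<times> bool. locally_const X u \<and>
    (\<forall>B. is_base B \<longrightarrow> (\<forall>y\<in>B. \<forall>z\<in>B. u y = u z) \<longrightarrow> x \<in> B \<longrightarrow> \<not> sim f (\<lambda>_. 0) \<longrightarrow> 0 < colsum B f x)"
  proof (cases "sim f (\<lambda>_. 0)")
    case True
    then show ?thesis by (intro exI[of _ "\<lambda>_. (0, True)"]) auto
  next
    case False
    show ?thesis by (rule posc_colsum_strict[OF f(2) False x]) blast
  qed
  then obtain u3 :: "'a \<Rightarrow> int \<times> bool" where u3: "locally_const X u3"
    "\<And>B. is_base B \<Longrightarrow> (\<forall>y\<in>B. \<forall>z\<in>B. u3 y = u3 z) \<Longrightarrow> x \<in> B \<Longrightarrow> \<not> sim f (\<lambda>_. 0) \<Longrightarrow> 0 < colsum B f x"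
    by blast
  \<comment> \<open>A fibre of the joint witness is a base on which every single witness is
    constant, so all column conditions hold over it at once.\<close>
  define u where "u = (\<lambda>z. (u1 z, u2 z, u3 z))"
  have lcu: "locally_const X u"
    unfolding u_def
    by (rule locally_const_comp2[OF u1(1) locally_const_comp2[OF u2(1) u3(1), where h=Pair], where h=Pair])
  define B where "B = {z\<in>X. u z = u x}"
  have B: "is_base B" "x \<in> B" unfolding B_def using is_base_level[OF lcu x] by auto
  have const: "\<forall>y\<in>B. \<forall>z\<in>B. u1 y = u1 z" "\<forall>y\<in>B. \<forall>z\<in>B. u2 y = u2 z" "\<forall>y\<in>B. \<forall>z\<in>B. u3 y = u3 z"
    by (auto simp: B_def u_def)
  define cnt where "cnt = (\<lambda>n b. \<Sum>j<n. of_bool (T (int j) b \<in> A) :: nat)"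
  define s where "s = (\<lambda>b. nat (colsum B f b))"
  define C where "C = {z\<in>X. z \<in> A \<and> cnt (age B z) (foot B z) < s (foot B z)}"
  have lccnt: "locally_const X (cnt n)" for n
    unfolding cnt_def by (intro locally_const_sum locally_const_comp[where h=of_bool] locally_const_T A)
  have lcs: "locally_const X s"
    unfolding s_def by (rule locally_const_comp[OF locally_const_colsum[OF B(1) f(1)]])
  have "locally_const X (\<lambda>z. cnt (age B z) (foot B z))"
    by (rule locally_const_select[OF locally_const_age[OF B(1)], where g="\<lambda>n z. cnt n (foot B z)"])
      (rule locally_const_foot[OF B(1) lccnt])
  then have "locally_const X (\<lambda>z. cnt (age B z) (foot B z) < s (foot B z))"
    by (rule locally_const_comp2[OF _ locally_const_foot[OF B(1) lcs]])
  then have "locally_const X (\<lambda>z. z \<in> A \<and> cnt (age B z) (foot B z) < s (foot B z))"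
    by (rule locally_const_comp2[OF A(1)])
  then have lcC: "clopen_on X C" by (rule locally_const_cong) (auto simp: C_def)
  have "colsum B (ind C) b = colsum B f b" if b: "b \<in> B" for b
  proof -
    have bX: "b \<in> X" using base_in[OF B(1) b] .
    have "0 \<le> colsum B f b" using u1(2)[OF B(1) const(1)] b by blast
    have "0 \<le> colsum B (\<lambda>x. of_bool (x \<in> A) - f x) b" using u2(2)[OF B(1) const(2)] b by blast
    then have "colsum B f b \<le> int (cnt (ret B b) b)"
      unfolding colsum_def cnt_def sum_subtractf by simp
    then have "s b \<le> cnt (ret B b) b" by (simp add: s_def)
    have "colsum B (ind C) b
      = (\<Sum>i<ret B b. of_bool (T (int i) b \<in> A \<and> cnt i b < s b))"
      unfolding colsum_def using bX age_foot_level[OF B(1) b] by (intro sum.cong) (auto simp: C_def)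
    also have "\<dots> = int (\<Sum>i<ret B b. of_bool (T (int i) b \<in> A \<and> cnt i b < s b))" by simp
    also have "(\<Sum>i<ret B b. of_bool (T (int i) b \<in> A \<and> cnt i b < s b)) = min (s b) (cnt (ret B b) b)"
      unfolding cnt_def by (rule sum_first_hits)
    also have "\<dots> = s b" using \<open>s b \<le> cnt (ret B b) b\<close> by simp
    finally show ?thesis using \<open>0 \<le> colsum B f b\<close> by (simp add: s_def)
  qed
  then have "sim (ind C) f" by (intro sim_of_colsum[OF B(1) locally_const_ind[OF lcC] f(1)]) auto
  moreover have "x \<in> C" if "x \<in> A" "\<not> sim f (\<lambda>_. 0)"
    using u3(2)[OF B(1) const(3) B(2) that(2)] that(1) x age_base[OF B(1) B(2)]
    by (simp add: C_def s_def cnt_def)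
  moreover have "C \<subseteq> A" by (auto simp: C_def)
  ultimately show thesis using that lcC by blast
qed

text \<open>Over a small base both sets have equally many levels in each column, so the levels of
  \<open>A\<close> can be sent to those of \<open>C\<close> in the order of their ranks.\<close>

lemma bij_of_equal_classes:
  assumes A: "clopen_on X A" "A \<subseteq> X" and C: "clopen_on X C" "C \<subseteq> X" and AC: "sim (ind A) (ind C)"
  obtains k where "locally_const X k" "bij_betw (\<lambda>x. T (k x) x) A C"
proof -
  obtain u :: "'a \<Rightarrow> int" where u: "locally_const X u" 
    "\<And>B. is_base B \<Longrightarrow> (\<forall>x\<in>B. \<forall>y\<in>B. u x = u y) \<Longrightarrow> \<forall>b\<in>B. colsum B (ind A) b = colsum B (ind C) b"
    using sim_colsum[OF AC] by metis
  obtain x where x: "x \<in> X" using nonempty by blast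
  define B where "B = {z\<in>X. u z = u x}"
  have B: "is_base B" unfolding B_def using is_base_level[OF u(1) x] by auto
  define cnt where "cnt = (\<lambda>A n b. \<Sum>j<n. of_bool (T (int j) b \<in> A) :: nat)"
  have total: "cnt A (ret B b) b = cnt C (ret B b) b" if "b \<in> B" for b
  proof -
    have "colsum B (ind A) b = colsum B (ind C) b" using u(2)[OF B] that by (simp add: B_def)
    moreover have "colsum B (ind D) b = int (cnt D (ret B b) b)" for D
      by (simp add: colsum_def cnt_def)
    ultimately show ?thesis by simp
  qed
  \<comment> \<open>The first disjunct is a default: it makes the least index exist at points
    outside \<open>A\<close> too, so that \<open>pos\<close> is locally constant on all of
    \<open>X\<close>. On \<open>A\<close> a genuine level below the return time is found
    first.\<close>
  define Q where "Q = (\<lambda>i z. ret B (foot B z) \<le> i \<or>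
     (T (int i) (foot B z) \<in> C \<and> cnt C i (foot B z) = cnt A (age B z) (foot B z)))"
  define pos where "pos = (\<lambda>z. LEAST i. Q i z)"
  define k where "k = (\<lambda>z. int (pos z) - int (age B z))"
  have lccnt: "locally_const X (cnt D n)" if "clopen_on X D" for D n
    unfolding cnt_def by (intro locally_const_sum locally_const_comp[where h=of_bool] locally_const_T that)
  have lcA: "locally_const X (\<lambda>z. cnt A (age B z) (foot B z))"
    by (rule locally_const_select[OF locally_const_age[OF B], where g="\<lambda>n z. cnt A n (foot B z)"])
      (rule locally_const_foot[OF B lccnt[OF A(1)]])
  have lcQ: "locally_const X (Q i)" for i
    unfolding Q_def
    by (rule locally_const_comp2[where h="(\<or>)"],
        rule locally_const_comp[OF locally_const_foot[OF B locally_const_ret[OF B]]],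
        rule locally_const_comp2[where h="(\<and>)"],
        rule locally_const_foot[OF B locally_const_T[OF C(1)]],
        rule locally_const_comp2[where h="(=)", OF locally_const_foot[OF B lccnt[OF C(1)]] lcA])
  have lcpos: "locally_const X pos"
    unfolding pos_def by (rule locally_const_Least[OF lcQ]) (auto simp: Q_def)
  have lck: "locally_const X k"
    unfolding k_def by (rule locally_const_comp2[OF lcpos locally_const_age[OF B]])
  define m where "m = (\<lambda>x. T (k x) x)"
  have m: "m x \<in> C \<and> foot B (m x) = foot B x \<and> cnt C (age B (m x)) (foot B x) = cnt A (age B x) (foot B x)"
    if xA: "x \<in> A" for x
  proof -
    have xX: "x \<in> X" using xA A(2) by blast
    let ?b = "foot B x"
    have b: "?b \<in> B" "?b \<in> X" using foot_in[OF B xX] base_in[OF B] by blast+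
    have "cnt A (Suc (age B x)) ?b \<le> cnt A (ret B ?b) ?b"
      unfolding cnt_def using age_less_ret[OF B xX] by (intro sum_mono2) auto
    moreover have "cnt A (Suc (age B x)) ?b = cnt A (age B x) ?b + 1"
      using T_age_foot[OF B xX] xA by (simp add: cnt_def del: sum_of_bool_eq)
    ultimately have "cnt A (age B x) ?b < cnt C (ret B ?b) ?b" using total[OF b(1)] by simp
    then obtain i where i: "i < ret B ?b" "T (int i) ?b \<in> C" "cnt C i ?b = cnt A (age B x) ?b"
      unfolding cnt_def using hit_of_rank[where h="ret B ?b" and a="\<lambda>i. T (int i) ?b \<in> C"] by blast
    then have "Q i x" by (simp add: Q_def)
    then have "Q (pos x) x" "pos x \<le> i" unfolding pos_def by (rule LeastI, rule Least_le)
    then have p: "pos x < ret B ?b" "T (int (pos x)) ?b \<in> C" "cnt C (pos x) ?b = cnt A (age B x) ?b"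
      using i by (auto simp: Q_def)
    have "m x = T (int (pos x)) ?b"
      unfolding m_def k_def foot_def using T_add[OF xX, of "int (pos x)" "- int (age B x)"] by simp
    then show ?thesis using p age_foot_level[OF B b(1) p(1)] by simp
  qed
  \<comment> \<open>Foot and rank determine a point of \<open>D\<close>. With \<open>D = A\<close>
    this gives injectivity, with \<open>D = C\<close> surjectivity.\<close>
  have rankA: "x = y" if "x \<in> D" "y \<in> D" "D \<subseteq> X" "foot B x = foot B y"
    "cnt D (age B x) (foot B x) = cnt D (age B y) (foot B x)" for x y D
  proof -
    have xy: "x \<in> X" "y \<in> X" using that by auto
    have "T (int (age B x)) (foot B x) \<in> D" unfolding T_age_foot[OF B xy(1)] by (rule that(1))
    moreover have "T (int (age B y)) (foot B x) \<in> D" unfolding that(4) T_age_foot[OF B xy(2)] by (rule that(2))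
    ultimately have "age B x = age B y"
      using that(5) unfolding cnt_def by (rule rank_inj[where a="\<lambda>i. T (int i) (foot B x) \<in> D"])
    then have "T (int (age B x)) (foot B x) = T (int (age B y)) (foot B y)" using that(4) by simp
    then show ?thesis unfolding T_age_foot[OF B xy(1)] T_age_foot[OF B xy(2)] .
  qed
  have "bij_betw m A C"
  proof (rule bij_betwI')
    fix x y assume xy: "x \<in> A" "y \<in> A"
    have "x = y" if "m x = m y"
      using m[OF xy(1)] m[OF xy(2)] that by (intro rankA[OF xy A(2)]) auto
    then show "(m x = m y) = (x = y)" by blast
  next
    fix x assume "x \<in> A" then show "m x \<in> C" using m by blast
  next
    fix z assume z: "z \<in> C"
    have zX: "z \<in> X" using z C(2) by blast
    let ?b = "foot B z"
    have b: "?b \<in> B" "?b \<in> X" using foot_in[OF B zX] base_in[OF B] by blast+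
    have "cnt C (Suc (age B z)) ?b \<le> cnt C (ret B ?b) ?b"
      unfolding cnt_def using age_less_ret[OF B zX] by (intro sum_mono2) auto
    moreover have "cnt C (Suc (age B z)) ?b = cnt C (age B z) ?b + 1"
      using T_age_foot[OF B zX] z by (simp add: cnt_def del: sum_of_bool_eq)
    ultimately have "cnt C (age B z) ?b < cnt A (ret B ?b) ?b" using total[OF b(1)] by simp
    then obtain i where i: "i < ret B ?b" "T (int i) ?b \<in> A" "cnt A i ?b = cnt C (age B z) ?b"
      unfolding cnt_def using hit_of_rank[where h="ret B ?b" and a="\<lambda>i. T (int i) ?b \<in> A"] by blast
    define w where "w = T (int i) ?b"
    have w: "foot B w = ?b" "age B w = i" unfolding w_def using age_foot_level[OF B b(1) i(1)] by blast+
    have mw: "m w \<in> C" "foot B (m w) = foot B w" "cnt C (age B (m w)) (foot B w) = cnt A (age B w) (foot B w)"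
      using m[of w] i(2) unfolding w_def by blast+
    have "cnt C (age B z) ?b = cnt C (age B (m w)) ?b" using mw(3) i(3) unfolding w by simp
    then have "z = m w" using mw(2) w(1) by (intro rankA[OF z mw(1) C(2)]) auto
    then show "\<exists>x\<in>A. z = m x" using i(2) unfolding w_def by blast
  qed
  then show thesis using that[OF lck] by (simp add: m_def)
qed

text \<open>Cut \<open>f\<close> by the values \<open>n\<close> of \<open>k\<close>, finitely many
  by compactness. On each piece \<gamma> acts as the shift by \<open>n\<close>, which keeps the
  class. The exponent has to be right only on the support of \<open>f\<close>, and \<gamma> may be
  any bijection; this leaves room for a discontinuous cocycle elsewhere.\<close>

lemma sim_transport:
  assumes f: "locally_const X f" and k: "locally_const X k" and \<gamma>: "bij_betw \<gamma> X X"
    and g: "\<forall>x\<in>X. g (\<gamma> x) = f x" and fk: "\<forall>x\<in>X. f x \<noteq> 0 \<longrightarrow> \<gamma> x = T (k x) x"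
  shows "locally_const X g" "sim f g"
proof -
  define K where "K = k ` X"
  have fin: "finite K" unfolding K_def using locally_const_finite_image[OF compact_X k] .
  define h where "h = (\<lambda>n x. if k x = n then f x else 0)"
  have lch: "locally_const X (h n)" for n
    unfolding h_def by (rule locally_const_if[OF locally_const_comp[OF k] f]) simp
  have f_eq: "f x = (\<Sum>n\<in>K. h n x)" if "x \<in> X" for x
    using that fin by (simp add: h_def K_def)
  have g_eq: "g z = (\<Sum>n\<in>K. h n (T (- n) z))" if z: "z \<in> X" for z
  proof -
    obtain x where x: "x \<in> X" "z = \<gamma> x" using \<gamma> z by (auto simp: bij_betw_def)
    have preimg: "h n (T (- n) z) \<noteq> 0 \<Longrightarrow> T (- n) z = x \<and> n = k x" for n
    proof -
      assume "h n (T (- n) z) \<noteq> 0"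
      then have y: "k (T (- n) z) = n" "f (T (- n) z) \<noteq> 0" by (auto simp: h_def split: if_splits)
      then have "\<gamma> (T (- n) z) = z" using fk z by (metis T_in T_minus(2))
      then have "T (- n) z = x" using \<gamma> x z by (metis T_in bij_betw_def inj_onD)
      then show "T (- n) z = x \<and> n = k x" using y by simp
    qed
    show ?thesis
    proof (cases "f x = 0")
      case True
      have "h n (T (- n) z) = 0" for n
      proof (rule ccontr)
        assume a: "h n (T (- n) z) \<noteq> 0"
        have "T (- n) z = x" using preimg[OF a] by blast
        then show False using a True by (auto simp: h_def split: if_splits)
      qed
      then show ?thesis using g x True by simp
    next
      case False
      then have zk: "z = T (k x) x" using fk x by simp
      have "(\<Sum>n\<in>K. h n (T (- n) z)) = (\<Sum>n\<in>{k x}. h n (T (- n) z))"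
        using preimg fin x by (intro sum.mono_neutral_right) (auto simp: K_def)
      also have "\<dots> = f x" using T_minus(1)[OF x(1), of "k x"] unfolding zk by (simp add: h_def)
      finally show ?thesis using g x by simp
    qed
  qed
  have "locally_const X (\<lambda>z. \<Sum>n\<in>K. h n (T (- n) z))" by (intro locally_const_sum locally_const_T lch)
  then show "locally_const X g" by (rule locally_const_cong) (use g_eq in simp)
  have "sim f (\<lambda>x. \<Sum>n\<in>K. h n x)" by (rule sim_eq) (rule f_eq)
  also have "sim \<dots> (\<lambda>x. \<Sum>n\<in>K. h n (T (- n) x))" by (intro sim_sum sim_shift lch)
  also have "sim \<dots> g" by (rule sim_eq) (simp add: g_eq)
  finally show "sim f g" .
qed

section \<open>Kakutani--Rokhlin partitions\<close>

definition clopen_partition :: "'a set set \<Rightarrow> bool" where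
  "clopen_partition P \<longleftrightarrow> finite P \<and> \<Union>P = X \<and> (\<forall>C\<in>P. C \<noteq> {} \<and> clopen_on X C)
     \<and> (\<forall>C\<in>P. \<forall>D\<in>P. C \<inter> D \<noteq> {} \<longrightarrow> C = D)"

text \<open>A Kakutani--Rokhlin partition with base \<open>U\<close>, without naming towers or
  heights: atoms are carried onto atoms until they fall into the base, and an atom off the base
  comes from the one below. The heights reappear in \<open>kr_tower\<close>.\<close>

definition kr :: "'a set set \<Rightarrow> 'a set \<Rightarrow> bool" where
  "kr P U \<longleftrightarrow> clopen_partition P \<and> is_base U \<and> (\<forall>C\<in>P. C \<subseteq> U \<or> C \<inter> U = {})
     \<and> (\<forall>C\<in>P. \<alpha> ` C \<in> P \<or> \<alpha> ` C \<subseteq> U) \<and> (\<forall>C\<in>P. C \<subseteq> U \<or> (\<exists>D\<in>P. C = \<alpha> ` D))"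

lemma clopen_partition_levels:
  assumes "locally_const X l"
  shows "clopen_partition ((\<lambda>z. {y\<in>X. l y = l z}) ` X)"
proof -
  have "(\<lambda>z. {y\<in>X. l y = l z}) ` X = (\<lambda>v. {y\<in>X. l y = v}) ` (l ` X)" by auto
  then have "finite ((\<lambda>z. {y\<in>X. l y = l z}) ` X)"
    using locally_const_finite_image[OF compact_X assms] by simp
  moreover have "clopen_on X {y\<in>X. l y = l z}" for z using clopen_on_level[OF assms] .
  ultimately show ?thesis unfolding clopen_partition_def by auto
qed

text \<open>Points share an atom when they have the same age and the labels read along their whole
  columns form the same word. The length of the word is the height of the column, so the key also
  tells whether a point is at the top.\<close>

lemma kr_exists:
  assumes U: "is_base U" and l: "locally_const X l"
  shows "\<exists>P. kr P U \<and> (\<forall>C\<in>P. \<forall>x\<in>C. \<forall>y\<in>C. l x = l y)"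
proof -
  define word where "word = (\<lambda>b. map (\<lambda>i. l (T (int i) b)) [0..<ret U b])"
  define key where "key = (\<lambda>z. (age U z, word (foot U z)))"
  define atom where "atom = (\<lambda>z. {y\<in>X. key y = key z})"
  have "locally_const X word" unfolding word_def
    by (rule locally_const_select[OF locally_const_ret[OF U], where g="\<lambda>n b. map (\<lambda>i. l (T (int i) b)) [0..<n]"])
      (rule locally_const_upto[where h=id, simplified], rule locally_const_T[OF l])
  then have lckey: "locally_const X key"
    unfolding key_def by (rule locally_const_comp2[OF locally_const_age[OF U] locally_const_foot[OF U]])
  have base_atom: "y \<in> U \<longleftrightarrow> z \<in> U" if "y \<in> atom z" "z \<in> X" for y z
    using that age_eq_0[OF U, of y] age_eq_0[OF U, of z] by (auto simp: atom_def key_def)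
  have top_iff: "\<alpha> z \<in> U \<longleftrightarrow> Suc (fst (key z)) = length (snd (key z))" if "z \<in> X" for z
    using base_succ_iff[OF U that] by (simp add: key_def word_def)
  have key_succ: "key (\<alpha> z) = (Suc (fst (key z)), snd (key z))" if "z \<in> X" "\<alpha> z \<notin> U" for z
    using age_foot_succ[OF U that] by (simp add: key_def)
  have img: "\<alpha> ` atom z = atom (\<alpha> z)" if z: "z \<in> X" "\<alpha> z \<notin> U" for z
  proof (intro equalityI subsetI)
    fix w assume "w \<in> \<alpha> ` atom z"
    then obtain y where y: "w = \<alpha> y" "y \<in> X" "key y = key z" by (auto simp: atom_def)
    then have "\<alpha> y \<notin> U" using top_iff[of y] top_iff[of z] z by simp
    then have "key w = key (\<alpha> z)" using key_succ[of y] key_succ[of z] y z by simp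
    then show "w \<in> atom (\<alpha> z)" using y by (simp add: atom_def)
  next
    fix w assume "w \<in> atom (\<alpha> z)"
    then have w: "w \<in> X" "key w = key (\<alpha> z)" by (auto simp: atom_def)
    define y where "y = T (-1) w"
    have y: "y \<in> X" "\<alpha> y = w" unfolding y_def using w T_1[of "T (-1) w"] T_minus(2)[of w 1] by auto
    have "fst (key w) \<noteq> 0" using w key_succ[OF z] by simp
    then have "\<alpha> y \<notin> U" using y w age_eq_0[OF U, of w] by (simp add: key_def)
    then have "key y = key z" using key_succ[OF z] key_succ[of y] y w by (simp add: prod_eq_iff)
    then show "w \<in> \<alpha> ` atom z" using y by (auto simp: atom_def)
  qed
  have lbl: "l z = snd (key z) ! fst (key z)" if "z \<in> X" for z
    using age_less_ret[OF U that] T_age_foot[OF U that] by (simp add: key_def word_def)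
  have part: "clopen_partition (atom ` X)"
    unfolding atom_def by (rule clopen_partition_levels[OF lckey])
  show ?thesis
  proof (intro exI[of _ "atom ` X"] conjI)
    show "kr (atom ` X) U"
      unfolding kr_def
    proof (intro conjI part U ballI)
      fix C assume "C \<in> atom ` X"
      then obtain z where z: "z \<in> X" "C = atom z" by auto
      show "C \<subseteq> U \<or> C \<inter> U = {}" using base_atom z by blast
      show "\<alpha> ` C \<in> atom ` X \<or> \<alpha> ` C \<subseteq> U"
      proof (cases "\<alpha> z \<in> U")
        case True
        have "\<alpha> y \<in> U" if "y \<in> atom z" for y
          using that True top_iff[of y] top_iff[OF z(1)] by (simp add: atom_def)
        then show ?thesis using z by blast
      next
        case False
        then show ?thesis using img[OF z(1)] z by auto
      qed
      show "C \<subseteq> U \<or> (\<exists>D\<in>atom ` X. C = \<alpha> ` D)"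
      proof (cases "z \<in> U")
        case True
        then show ?thesis using base_atom z by blast
      next
        case False
        define y where "y = T (-1) z"
        have y: "y \<in> X" "\<alpha> y = z" unfolding y_def using z T_1[of "T (-1) z"] T_minus(2)[of z 1] by auto
        then have "C = \<alpha> ` atom y" using img[of y] False z by simp
        then show ?thesis using y by blast
      qed
    qed
    show "\<forall>C\<in>atom ` X. \<forall>x\<in>C. \<forall>y\<in>C. l x = l y"
      using lbl by (auto simp: atom_def)
  qed
qed

end

section \<open>Limits of nested locally constant set-valued maps\<close>

text \<open>At each point the decreasing compact sets have a common point. For continuity, the
  \<open>n\<close>-th set is the same near \<open>x\<close>, and for suitable \<open>n\<close> its
  diameter is below the given bound.\<close>

lemma limit_map:
  fixes \<kappa> :: "nat \<Rightarrow> 'a::metric_space \<Rightarrow> 'b::metric_space set"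
  assumes lc: "\<And>n. locally_const X (\<kappa> n)"
    and ne: "\<And>n x. x \<in> X \<Longrightarrow> \<kappa> n x \<noteq> {}" and comp: "\<And>n x. x \<in> X \<Longrightarrow> compact (\<kappa> n x)"
    and dec: "\<And>n x. x \<in> X \<Longrightarrow> \<kappa> (Suc n) x \<subseteq> \<kappa> n x"
    and small: "\<And>e. e > 0 \<Longrightarrow> \<exists>n. \<forall>x\<in>X. \<forall>y\<in>\<kappa> n x. \<forall>z\<in>\<kappa> n x. dist y z < e"
  shows "\<exists>F. continuous_on X F \<and> (\<forall>x\<in>X. \<forall>n. F x \<in> \<kappa> n x)"
proof -
  have "\<exists>y. \<forall>n. y \<in> \<kappa> n x" if x: "x \<in> X" for x
  proof -
    have mono: "\<kappa> n x \<subseteq> \<kappa> m x" if "m \<le> n" for m n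
      using that by (induction rule: dec_induct) (use dec[OF x] in auto)
    have "\<kappa> 0 x \<inter> (\<Inter>n\<in>UNIV. \<kappa> n x) \<noteq> {}"
    proof (rule compact_imp_fip_image[OF comp[OF x]])
      show "closed (\<kappa> n x)" for n using comp[OF x] compact_imp_closed by blast
      fix I :: "nat set" assume I: "finite I"
      have "\<kappa> (Max (insert 0 I)) x \<subseteq> \<kappa> 0 x \<inter> (\<Inter>n\<in>I. \<kappa> n x)"
        using I by (intro Int_greatest INT_greatest mono Max_ge) auto
      then show "\<kappa> 0 x \<inter> (\<Inter>n\<in>I. \<kappa> n x) \<noteq> {}" using ne[OF x] by blast
    qed
    then show ?thesis by blast
  qed
  then obtain F where F: "\<And>x n. x \<in> X \<Longrightarrow> F x \<in> \<kappa> n x" by metis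
  have "continuous_on X F"
    unfolding continuous_on_topological
  proof (intro ballI allI impI)
    fix x B assume x: "x \<in> X" "open B" "F x \<in> B"
    then obtain e where e: "e > 0" "ball (F x) e \<subseteq> B" by (meson open_contains_ball)
    obtain n where n: "\<forall>x\<in>X. \<forall>y\<in>\<kappa> n x. \<forall>z\<in>\<kappa> n x. dist y z < e" using small[OF e(1)] by blast
    obtain A where A: "open A" "x \<in> A" "\<forall>y\<in>A \<inter> X. \<kappa> n y = \<kappa> n x"
      using locally_constD[OF lc[of n] x(1)] unfolding eventually_nhds_principal by blast
    have "F y \<in> B" if y: "y \<in> X" "y \<in> A" for y
    proof -
      have "\<kappa> n y = \<kappa> n x" using A(3) y by blast
      then have "F y \<in> \<kappa> n x" using F[OF y(1), of n] by (simp only:)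
      then have "dist (F x) (F y) < e" using n x(1) F[OF x(1), of n] by blast
      then show ?thesis using e(2) by auto
    qed
    then show "\<exists>A. open A \<and> x \<in> A \<and> (\<forall>y\<in>X. y \<in> A \<longrightarrow> F y \<in> B)" using A(1,2) by blast
  qed
  then show ?thesis using F by blast
qed

section \<open>Homeomorphisms between Cantor sets\<close>

text \<open>The number of pieces must be free from some \<open>K\<close> on, so that two different
  spaces can be cut into equally many. Starting from a fine partition, further pieces are cut off
  one at a time from the piece labelled 0, which is infinite for lack of isolated points.\<close>

lemma cantor_set_split:
  fixes X :: "'a::metric_space set"
  assumes X: "cantor_set X" and A: "clopen_on X A" "A \<subseteq> X" "A \<noteq> {}" and e: "e > 0"
  shows "\<exists>K. \<forall>k\<ge>K. \<exists>l :: 'a \<Rightarrow> nat. locally_const X l \<and> l ` A = {..<k} \<and> (\<forall>x\<in>A. \<forall>y\<in>A. l x = l y \<longrightarrow> dist x y < e)"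
proof -
  obtain l0 :: "'a \<Rightarrow> nat" where l0: "locally_const X l0" "\<forall>x\<in>X. \<forall>y\<in>X. l0 x = l0 y \<longrightarrow> dist x y < e"
    using cantor_set_fine_partition[OF X e] by blast
  have "finite (l0 ` X)" using locally_const_finite_image l0(1) X by (auto simp: cantor_set_def)
  then have "finite (l0 ` A)" using A(2) by (meson finite_subset image_mono)
  then obtain b where b: "bij_betw b (l0 ` A) {..<card (l0 ` A)}"
    using ex_bij_betw_finite_nat by (metis atLeast0LessThan)
  define K where "K = card (l0 ` A)"
  have "\<exists>l :: 'a \<Rightarrow> nat. locally_const X l \<and> l ` A = {..<k} \<and> (\<forall>x\<in>A. \<forall>y\<in>A. l x = l y \<longrightarrow> dist x y < e)"
    if "K \<le> k" for k
    using that
  proof (induction k rule: dec_induct)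
    case base
    have "(b \<circ> l0) ` A = {..<K}" using b by (simp only: bij_betw_def K_def image_comp[symmetric])
    moreover have "dist x y < e" if "x \<in> A" "y \<in> A" "b (l0 x) = b (l0 y)" for x y
    proof -
      have "l0 x = l0 y" using b that by (meson bij_betw_def image_eqI inj_onD)
      then show ?thesis using l0(2) A(2) that by blast
    qed
    ultimately show ?case using locally_const_comp[OF l0(1), of b]
      by (intro exI[of _ "b \<circ> l0"]) (auto simp: comp_def)
  next
    case (step k)
    then obtain l :: "'a \<Rightarrow> nat" where l: "locally_const X l" "l ` A = {..<k}"
      "\<forall>x\<in>A. \<forall>y\<in>A. l x = l y \<longrightarrow> dist x y < e" by blast
    have "k > 0" using l(2) A(3) by (cases k) auto
    then have "0 \<in> l ` A" using l(2) by simp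
    then obtain x where x: "x \<in> A" "l x = 0" by auto
    have "clopen_on X {z\<in>X. z \<in> A \<and> l z = 0}"
      using clopen_on_level[OF locally_const_comp2[OF A(1) l(1), where h=Pair], of "\<lambda>(a, v). a \<and> v = 0"] by simp
    then have "infinite ({z\<in>X. z \<in> A \<and> l z = 0} \<inter> X)" using clopen_infinite[OF X, of _ x] x A(2) by auto
    then have "\<exists>y. y \<in> {z\<in>X. z \<in> A \<and> l z = 0} \<inter> X - {x}" by (metis finite.emptyI finite_Diff2 finite_insert ex_in_conv)
    then obtain y where y: "y \<in> A" "l y = 0" "y \<noteq> x" "y \<in> X" by auto
    obtain S where S: "clopen_on X S" "x \<in> S" "S \<subseteq> X" "S \<subseteq> - {y}"
      using cantor_set_clopen_nbhd[OF X, of x "- {y}"] x y A(2) by blast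
    define l' where "l' = (\<lambda>z. if l z = 0 \<and> z \<notin> S then k else l z)"
    have "locally_const X l'"
      unfolding l'_def
      by (rule locally_const_if[OF locally_const_comp2[OF l(1) S(1), where h="\<lambda>v s. v = 0 \<and> \<not> s"] _ l(1)]) simp
    moreover have "l' ` A = {..<Suc k}"
    proof (intro equalityI subsetI)
      fix v assume "v \<in> l' ` A"
      then show "v \<in> {..<Suc k}" using l(2) by (auto simp: l'_def less_Suc_eq)
    next
      fix v assume "v \<in> {..<Suc k}"
      then consider "v = k" | "v = 0" | "v < k" "v \<noteq> 0" by force
      then show "v \<in> l' ` A"
      proof cases
        case 1
        then show ?thesis using y S(4) by (intro image_eqI[of _ _ y]) (auto simp: l'_def)
      next
        case 2
        then show ?thesis using x S(2) by (intro image_eqI[of _ _ x]) (auto simp: l'_def)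
      next
        case 3
        then have "v \<in> l ` A" using l(2) by simp
        then show ?thesis using 3 by (auto simp: l'_def)
      qed
    qed
    moreover have "dist u v < e" if uv: "u \<in> A" "v \<in> A" "l' u = l' v" for u v
    proof -
      have "l u < k" "l v < k" using l(2) uv by auto
      then have "l u = l v" using uv(3) by (auto simp: l'_def split: if_splits)
      then show ?thesis using l(3) uv by blast
    qed
    ultimately show ?case by blast
  qed
  then show ?thesis by blast
qed

text \<open>Encodes a matching of two clopen partitions: the fibres of \<kappa> in \<open>X\<close>
  and its values in \<open>Y\<close>.\<close>

definition partition_map :: "'a::metric_space set \<Rightarrow> 'b::metric_space set \<Rightarrow> ('a \<Rightarrow> 'b set) \<Rightarrow> bool" where
  "partition_map X Y \<kappa> \<longleftrightarrow> locally_const X \<kappa> \<and> (\<forall>x\<in>X. \<kappa> x \<noteq> {} \<and> \<kappa> x \<subseteq> Y \<and> clopen_on Y (\<kappa> x))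
     \<and> (\<forall>y\<in>Y. \<exists>x\<in>X. y \<in> \<kappa> x) \<and> (\<forall>x\<in>X. \<forall>z\<in>X. \<kappa> x \<inter> \<kappa> z \<noteq> {} \<longrightarrow> \<kappa> x = \<kappa> z)"

text \<open>Each value of \<kappa> and its fibre are cut into the same number of small pieces, the
  maximum of the two thresholds of \<open>cantor_set_split\<close>, and pieces with equal labels are
  matched.\<close>

lemma partition_map_refine:
  fixes X :: "'a::metric_space set" and Y :: "'b::metric_space set"
  assumes X: "cantor_set X" and Y: "cantor_set Y" and \<kappa>: "partition_map X Y \<kappa>" and e: "e > 0"
  shows "\<exists>\<kappa>'. partition_map X Y \<kappa>' \<and> (\<forall>x\<in>X. \<kappa>' x \<subseteq> \<kappa> x)
    \<and> (\<forall>x\<in>X. \<forall>y\<in>\<kappa>' x. \<forall>z\<in>\<kappa>' x. dist y z < e) \<and> (\<forall>x\<in>X. \<forall>z\<in>X. \<kappa>' x = \<kappa>' z \<longrightarrow> dist x z < e)"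
proof -
  have lc: "locally_const X \<kappa>" and atom: "\<And>x. x \<in> X \<Longrightarrow> \<kappa> x \<noteq> {} \<and> \<kappa> x \<subseteq> Y \<and> clopen_on Y (\<kappa> x)"
    and cover: "\<And>y. y \<in> Y \<Longrightarrow> \<exists>x\<in>X. y \<in> \<kappa> x"
    and disj: "\<And>x z. x \<in> X \<Longrightarrow> z \<in> X \<Longrightarrow> \<kappa> x \<inter> \<kappa> z \<noteq> {} \<Longrightarrow> \<kappa> x = \<kappa> z"
    using \<kappa> unfolding partition_map_def by blast+
  define A where "A = (\<lambda>C. {x\<in>X. \<kappa> x = C})"
  define \<Phi> where "\<Phi> = (\<lambda>C (lX :: 'a \<Rightarrow> nat) (lY :: 'b \<Rightarrow> nat). locally_const X lX \<and> locally_const Y lY \<and>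
     (C \<in> \<kappa> ` X \<longrightarrow> lX ` A C = lY ` C \<and>
     (\<forall>x\<in>A C. \<forall>y\<in>A C. lX x = lX y \<longrightarrow> dist x y < e) \<and> (\<forall>x\<in>C. \<forall>y\<in>C. lY x = lY y \<longrightarrow> dist x y < e)))"
  have "\<exists>lX lY. \<Phi> C lX lY"
    for C :: "'b set" 
  proof (cases "C \<in> \<kappa> ` X")
    case False
    then show ?thesis unfolding \<Phi>_def by (intro exI[of _ "\<lambda>_. 0"]) auto
  next
    case True
    then obtain x where x: "x \<in> X" "C = \<kappa> x" by auto
    have "clopen_on X (A C)" unfolding A_def by (rule clopen_on_level[OF lc])
    then obtain K1 where K1: "\<forall>k\<ge>K1. \<exists>l :: 'a \<Rightarrow> nat. locally_const X l \<and> l ` A C = {..<k}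
        \<and> (\<forall>x\<in>A C. \<forall>y\<in>A C. l x = l y \<longrightarrow> dist x y < e)"
      using cantor_set_split[OF X, of "A C" e] x e by (auto simp: A_def)
    obtain K2 where K2: "\<forall>k\<ge>K2. \<exists>l :: 'b \<Rightarrow> nat. locally_const Y l \<and> l ` C = {..<k}
        \<and> (\<forall>x\<in>C. \<forall>y\<in>C. l x = l y \<longrightarrow> dist x y < e)"
      using cantor_set_split[OF Y, of C e] x e atom by blast
    obtain lX :: "'a \<Rightarrow> nat" where "locally_const X lX" "lX ` A C = {..<max K1 K2}"
      "\<forall>x\<in>A C. \<forall>y\<in>A C. lX x = lX y \<longrightarrow> dist x y < e" using K1 max.cobounded1 by blast
    moreover obtain lY :: "'b \<Rightarrow> nat" where "locally_const Y lY" "lY ` C = {..<max K1 K2}"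
      "\<forall>x\<in>C. \<forall>y\<in>C. lY x = lY y \<longrightarrow> dist x y < e" using K2 max.cobounded2 by blast
    ultimately show ?thesis unfolding \<Phi>_def by (intro exI[of _ lX] exI[of _ lY]) simp
  qed
  then obtain lX lY where L: "\<And>C. \<Phi> C (lX C) (lY C)" by metis
  have lX: "locally_const X (lX C)" and lY: "locally_const Y (lY C)" for C
    using L[of C] unfolding \<Phi>_def by blast+
  have onto: "lX C ` A C = lY C ` C"
    and smallX: "\<forall>x\<in>A C. \<forall>y\<in>A C. lX C x = lX C y \<longrightarrow> dist x y < e"
    and smallY: "\<forall>x\<in>C. \<forall>y\<in>C. lY C x = lY C y \<longrightarrow> dist x y < e" if "C \<in> \<kappa> ` X" for C
    using L[of C] that unfolding \<Phi>_def by blast+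
  define \<kappa>' where "\<kappa>' = (\<lambda>x. {y\<in>\<kappa> x. lY (\<kappa> x) y = lX (\<kappa> x) x})"
  have sub: "\<kappa>' x \<subseteq> \<kappa> x" for x by (auto simp: \<kappa>'_def)
  have ne: "\<kappa>' x \<noteq> {}" if x: "x \<in> X" for x
  proof -
    have "lX (\<kappa> x) x \<in> lX (\<kappa> x) ` A (\<kappa> x)" using x by (auto simp: A_def)
    then show ?thesis using onto[of "\<kappa> x"] x by (auto simp: \<kappa>'_def)
  qed
  have eqD: "\<kappa> x = \<kappa> z \<and> lX (\<kappa> x) x = lX (\<kappa> x) z" if xz: "x \<in> X" "z \<in> X" "\<kappa>' x \<inter> \<kappa>' z \<noteq> {}" for x z
  proof -
    have "\<kappa> x = \<kappa> z" using disj[OF xz(1,2)] sub xz(3) by blast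
    moreover obtain y where "y \<in> \<kappa>' x" "y \<in> \<kappa>' z" using xz(3) by blast
    ultimately show ?thesis by (auto simp: \<kappa>'_def)
  qed
  have "partition_map X Y \<kappa>'"
    unfolding partition_map_def
  proof (intro conjI ballI impI)
    show "locally_const X \<kappa>'" unfolding \<kappa>'_def
      by (rule locally_const_select[OF lc, where g="\<lambda>C x. {y\<in>C. lY C y = lX C x}"])
        (rule locally_const_comp[OF lX])
  next
    fix x assume x: "x \<in> X"
    show "\<kappa>' x \<noteq> {}" using ne[OF x] .
    show "\<kappa>' x \<subseteq> Y" using atom[OF x] sub by blast
    show "clopen_on Y (\<kappa>' x)"
      using locally_const_comp2[OF conjunct2[OF conjunct2[OF atom[OF x]]] lY, where h="\<lambda>a v. a \<and> v = lX (\<kappa> x) x"]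
      by (simp add: \<kappa>'_def)
  next
    fix y assume "y \<in> Y"
    then obtain x0 where x0: "x0 \<in> X" "y \<in> \<kappa> x0" using cover by blast
    then have "lY (\<kappa> x0) y \<in> lX (\<kappa> x0) ` A (\<kappa> x0)" using onto[of "\<kappa> x0"] by auto
    then obtain x where "x \<in> X" "\<kappa> x = \<kappa> x0" "lY (\<kappa> x0) y = lX (\<kappa> x0) x" by (auto simp: A_def)
    then show "\<exists>x\<in>X. y \<in> \<kappa>' x" using x0 by (auto simp: \<kappa>'_def)
  next
    fix x z assume "x \<in> X" "z \<in> X" "\<kappa>' x \<inter> \<kappa>' z \<noteq> {}"
    then have "\<kappa> x = \<kappa> z \<and> lX (\<kappa> x) x = lX (\<kappa> x) z" by (rule eqD)
    then show "\<kappa>' x = \<kappa>' z" by (auto simp: \<kappa>'_def)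
  qed
  moreover have "dist y z < e" if "x \<in> X" "y \<in> \<kappa>' x" "z \<in> \<kappa>' x" for x y z
    using smallY[of "\<kappa> x"] that by (auto simp: \<kappa>'_def)
  moreover have "dist x z < e" if xz: "x \<in> X" "z \<in> X" "\<kappa>' x = \<kappa>' z" for x z
  proof -
    have "\<kappa> x = \<kappa> z \<and> lX (\<kappa> x) x = lX (\<kappa> x) z" using ne[OF xz(1)] xz(3) by (intro eqD[OF xz(1,2)]) blast
    then show ?thesis using smallX[of "\<kappa> x"] xz by (auto simp: A_def)
  qed
  ultimately show ?thesis using sub by (intro exI[of _ \<kappa>']) blast
qed

text \<open>Iterated refinement. Small values in \<open>Y\<close> make the limit continuous with
  dense, hence full, image; small fibres in \<open>X\<close> make it injective.\<close>

lemma homeomorphism_of_partition_map: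
  fixes X :: "'a::metric_space set" and Y :: "'b::metric_space set"
  assumes X: "cantor_set X" and Y: "cantor_set Y" and \<kappa>0: "partition_map X Y \<kappa>0"
  shows "\<exists>\<sigma> \<tau>. homeomorphism X Y \<sigma> \<tau> \<and> (\<forall>x\<in>X. \<sigma> x \<in> \<kappa>0 x)"
proof -
  define R where "R = (\<lambda>(n::nat) (\<kappa> :: 'a \<Rightarrow> 'b set) \<kappa>'. (\<forall>x\<in>X. \<kappa>' x \<subseteq> \<kappa> x)
    \<and> (\<forall>x\<in>X. \<forall>y\<in>\<kappa>' x. \<forall>z\<in>\<kappa>' x. dist y z < inverse (real (Suc n))) \<and> (\<forall>x\<in>X. \<forall>z\<in>X. \<kappa>' x = \<kappa>' z \<longrightarrow> dist x z < inverse (real (Suc n))))"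
  have "\<exists>\<kappa>. \<forall>n. (partition_map X Y (\<kappa> n) \<and> (n = 0 \<longrightarrow> \<kappa> n = \<kappa>0)) \<and> R n (\<kappa> n) (\<kappa> (Suc n))"
  proof (rule dependent_nat_choice)
    show "\<exists>x. partition_map X Y x \<and> (0 = 0 \<longrightarrow> x = \<kappa>0)" using \<kappa>0 by blast
    fix \<kappa> and n :: nat assume "partition_map X Y \<kappa> \<and> (n = 0 \<longrightarrow> \<kappa> = \<kappa>0)"
    then show "\<exists>\<kappa>'. (partition_map X Y \<kappa>' \<and> (Suc n = 0 \<longrightarrow> \<kappa>' = \<kappa>0)) \<and> R n \<kappa> \<kappa>'"
      unfolding R_def using partition_map_refine[OF X Y, of \<kappa> "inverse (real (Suc n))"] by auto
  qed
  then obtain \<kappa> where \<kappa>: "\<And>n. partition_map X Y (\<kappa> n)" and start: "\<kappa> 0 = \<kappa>0"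
    and step: "\<And>n. R n (\<kappa> n) (\<kappa> (Suc n))" by blast
  have compY: "compact Y" using Y by (simp add: cantor_set_def)
  have smallY: "\<exists>n. \<forall>x\<in>X. \<forall>y\<in>\<kappa> n x. \<forall>z\<in>\<kappa> n x. dist y z < e" if e: "e > 0" for e :: real
  proof -
    obtain n where "inverse (real (Suc n)) < e" using reals_Archimedean[OF e] by blast
    then show ?thesis using step[of n] unfolding R_def by (meson less_trans)
  qed
  have smallX: "\<exists>n. \<forall>x\<in>X. \<forall>z\<in>X. \<kappa> n x = \<kappa> n z \<longrightarrow> dist x z < e" if e: "e > 0" for e :: real
  proof -
    obtain n where "inverse (real (Suc n)) < e" using reals_Archimedean[OF e] by blast
    then show ?thesis using step[of n] unfolding R_def by (meson less_trans)
  qed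
  have atoms: "\<kappa> n x \<noteq> {} \<and> \<kappa> n x \<subseteq> Y \<and> clopen_on Y (\<kappa> n x)" if "x \<in> X" for n x
    using \<kappa>[of n] that unfolding partition_map_def by blast
  have "\<exists>F. continuous_on X F \<and> (\<forall>x\<in>X. \<forall>n. F x \<in> \<kappa> n x)"
  proof (rule limit_map[OF _ _ _ _ smallY])
    show "locally_const X (\<kappa> n)" for n using \<kappa>[of n] unfolding partition_map_def by blast
    show "\<kappa> n x \<noteq> {}" if "x \<in> X" for n x using atoms[OF that] by blast
    show "compact (\<kappa> n x)" if "x \<in> X" for n x
    proof -
      have "{y\<in>Y. y \<in> \<kappa> n x} = \<kappa> n x" using atoms[OF that, of n] by blast
      then show ?thesis using locally_const_compact[OF compY, of "\<lambda>y. y \<in> \<kappa> n x" "\<lambda>b. b"] atoms[OF that, of n] by simp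
    qed
    show "\<kappa> (Suc n) x \<subseteq> \<kappa> n x" if "x \<in> X" for n x using step[of n] that unfolding R_def by blast
  qed
  then obtain F where F: "continuous_on X F" "\<And>x n. x \<in> X \<Longrightarrow> F x \<in> \<kappa> n x" by blast
  have compX: "compact X" using X by (simp add: cantor_set_def)
  have inj: "inj_on F X"
  proof (rule inj_onI)
    fix x z assume xz: "x \<in> X" "z \<in> X" "F x = F z"
    show "x = z"
    proof (rule ccontr)
      assume "x \<noteq> z"
      then obtain n where n: "\<forall>u\<in>X. \<forall>v\<in>X. \<kappa> n u = \<kappa> n v \<longrightarrow> dist u v < dist x z"
        using smallX[of "dist x z"] by auto
      have "\<kappa> n x \<inter> \<kappa> n z \<noteq> {}" using F(2)[OF xz(1), of n] F(2)[OF xz(2), of n] xz(3) by auto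
      then have "\<kappa> n x = \<kappa> n z" using \<kappa>[of n] xz unfolding partition_map_def by blast
      then have "dist x z < dist x z" using n xz by blast
      then show False by simp
    qed
  qed
  have "F ` X \<subseteq> Y" using F(2) atoms by blast
  moreover have "Y \<subseteq> F ` X"
  proof
    fix y assume y: "y \<in> Y"
    have "y \<in> closure (F ` X)"
      unfolding closure_approachable
    proof (intro allI impI)
      fix e :: real assume "e > 0"
      then obtain n where n: "\<forall>x\<in>X. \<forall>y\<in>\<kappa> n x. \<forall>z\<in>\<kappa> n x. dist y z < e" using smallY by blast
      obtain x where "x \<in> X" "y \<in> \<kappa> n x" using \<kappa>[of n] y unfolding partition_map_def by blast
      then show "\<exists>z\<in>F ` X. dist z y < e" using n F(2)[of x n] by blast
    qed
    moreover have "closed (F ` X)" using compact_continuous_image[OF F(1) compX] compact_imp_closed by blast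
    ultimately show "y \<in> F ` X" by simp
  qed
  ultimately have "F ` X = Y" by blast
  then obtain \<tau> where "homeomorphism X Y F \<tau>" using homeomorphism_compact[OF compX F(1)] inj by blast
  then show ?thesis using F(2)[of _ 0] start by blast
qed

section \<open>Order homomorphisms read on representatives\<close>

lemma locally_const_Ball:
  assumes "finite I" "\<And>i. i \<in> I \<Longrightarrow> locally_const X (f i)"
  shows "locally_const X (\<lambda>x. \<forall>i\<in>I. Q i (f i x))"
  by (rule locally_const_cong[OF locally_const_comp[OF locally_const_restrict[OF assms], where h="\<lambda>\<phi>. \<forall>i\<in>I. Q i (\<phi> i)"]])
    auto

locale k0_map = X: cantor_minimal X \<alpha> + Y: cantor_minimal Y \<beta>
  for X :: "'a::metric_space set" and \<alpha> and Y :: "'b::metric_space set" and \<beta> +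
  fixes r :: "('b \<Rightarrow> int) \<Rightarrow> 'a \<Rightarrow> int"
  assumes r_lc: "locally_const Y g \<Longrightarrow> locally_const X (r g)"
    and r_add: "locally_const Y g \<Longrightarrow> locally_const Y g' \<Longrightarrow>
      X.sim (r (\<lambda>y. g y + g' y)) (\<lambda>x. r g x + r g' x)"
    and r_sim: "locally_const Y g \<Longrightarrow> locally_const Y g' \<Longrightarrow> Y.sim g g' \<Longrightarrow> X.sim (r g) (r g')"
    and r_pos: "locally_const Y g \<Longrightarrow> \<forall>y\<in>Y. 0 \<le> g y \<Longrightarrow> X.posc (r g)"
    and r_one: "X.sim (r (\<lambda>_. 1)) (\<lambda>_. 1)"
begin

lemma r_zero: "X.sim (r (\<lambda>_. 0)) (\<lambda>_. 0)"
proof -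
  have "X.sim (r (\<lambda>_. 0)) (\<lambda>x. r (\<lambda>_. 0) x + r (\<lambda>_. 0) x)" using r_add[of "\<lambda>_. 0" "\<lambda>_. 0"] by simp
  then have "X.sim (\<lambda>x. r (\<lambda>_. 0) x - r (\<lambda>_. 0) x) (\<lambda>x. r (\<lambda>_. 0) x + r (\<lambda>_. 0) x - r (\<lambda>_. 0) x)"
    by (intro X.sim_diff) auto
  then show ?thesis using X.sim_sym by simp
qed

lemma r_eq:
  assumes "locally_const Y g" "\<And>y. y \<in> Y \<Longrightarrow> g y = g' y"
  shows "X.sim (r g) (r g')"
  by (rule r_sim[OF assms(1) locally_const_cong[OF assms] Y.sim_eq[OF assms(2)]])

lemma r_uminus:
  assumes g: "locally_const Y g"
  shows "X.sim (r (\<lambda>y. - g y)) (\<lambda>x. - r g x)"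
proof -
  have g': "locally_const Y (\<lambda>y. - g y)" using locally_const_comp[OF g] .
  have "X.sim (\<lambda>x. r g x + r (\<lambda>y. - g y) x) (r (\<lambda>y. g y + - g y))" using X.sim_sym[OF r_add[OF g g']] .
  also have "X.sim \<dots> (\<lambda>_. 0)" using r_zero by simp
  finally have "X.sim (\<lambda>x. r g x + r (\<lambda>y. - g y) x - r g x) (\<lambda>x. 0 - r g x)" by (intro X.sim_diff) auto
  then show ?thesis by simp
qed

lemma r_diff:
  assumes g: "locally_const Y g" and h: "locally_const Y h"
  shows "X.sim (r (\<lambda>y. g y - h y)) (\<lambda>x. r g x - r h x)"
proof -
  have h': "locally_const Y (\<lambda>y. - h y)" using locally_const_comp[OF h] .
  have "X.sim (r (\<lambda>y. g y + - h y)) (\<lambda>x. r g x + r (\<lambda>y. - h y) x)" by (rule r_add[OF g h'])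
  also have "X.sim \<dots> (\<lambda>x. r g x + - r h x)" by (intro X.sim_add r_uminus h) auto
  finally show ?thesis by simp
qed

lemma r_mult:
  assumes g: "locally_const Y g"
  shows "X.sim (r (\<lambda>y. c * g y)) (\<lambda>x. c * r g x)"
proof -
  have nat: "X.sim (r (\<lambda>y. int n * g y)) (\<lambda>x. int n * r g x)" for n
  proof (induction n)
    case 0
    show ?case using r_zero by simp
  next
    case (Suc n)
    have "locally_const Y (\<lambda>y. int n * g y)" using locally_const_comp[OF g] .
    then have "X.sim (r (\<lambda>y. g y + int n * g y)) (\<lambda>x. r g x + r (\<lambda>y. int n * g y) x)" by (rule r_add[OF g])
    also have "X.sim \<dots> (\<lambda>x. r g x + int n * r g x)" by (intro X.sim_add Suc) auto
    finally show ?case by (simp add: distrib_right)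
  qed
  show ?thesis
  proof (cases "0 \<le> c")
    case True
    then show ?thesis using nat[of "nat c"] by simp
  next
    case False
    have "locally_const Y (\<lambda>y. int (nat (- c)) * g y)" using locally_const_comp[OF g] .
    then have "X.sim (r (\<lambda>y. - (int (nat (- c)) * g y))) (\<lambda>x. - r (\<lambda>y. int (nat (- c)) * g y) x)" by (rule r_uminus)
    also have "X.sim \<dots> (\<lambda>x. - (int (nat (- c)) * r g x))" by (rule X.sim_uminus[OF nat])
    finally show ?thesis using False by simp
  qed
qed

lemma r_sum:
  assumes "\<And>i. i \<in> I \<Longrightarrow> locally_const Y (g i)"
  shows "X.sim (r (\<lambda>y. \<Sum>i\<in>I. g i y)) (\<lambda>x. \<Sum>i\<in>I. r (g i) x)"
  using assms
proof (induction I rule: infinite_finite_induct)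
  case (insert i I)
  have "locally_const Y (\<lambda>y. \<Sum>i\<in>I. g i y)" using insert by (intro locally_const_sum) auto
  then have "X.sim (r (\<lambda>y. g i y + (\<Sum>i\<in>I. g i y))) (\<lambda>x. r (g i) x + r (\<lambda>y. \<Sum>i\<in>I. g i y) x)"
    using insert by (intro r_add) auto
  also have "X.sim \<dots> (\<lambda>x. r (g i) x + (\<Sum>i\<in>I. r (g i) x))" using insert by (intro X.sim_add) auto
  finally show ?case using insert by simp
qed (use r_zero in simp_all)

lemma r_mono:
  assumes g: "locally_const Y g" and h: "locally_const Y h" and "\<forall>y\<in>Y. g y \<le> h y"
  shows "X.posc (\<lambda>x. r h x - r g x)"
proof (rule X.posc_sim[OF _ r_diff[OF h g]])
  show "X.posc (r (\<lambda>y. h y - g y))"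
    using assms locally_const_comp2[OF h g, where h="(-)"] by (intro r_pos) auto
qed

lemma r_shift: "locally_const Y g \<Longrightarrow> X.sim (r (\<lambda>y. g (Y.T n y))) (r g)"
  by (rule r_sim[OF Y.locally_const_T _ Y.sim_sym[OF Y.sim_shift]])

text \<open>By minimality of \<beta>, boundedly many translates of \<open>g\<close> add up to at
  least 1 everywhere, and \<open>r\<close> sends all of them to the class of \<open>r g\<close>.
  Were that class zero, \<open>-1\<close> would be positive.\<close>

lemma r_faithful:
  assumes g: "locally_const Y g" "\<forall>y\<in>Y. 0 \<le> g y" and y: "y \<in> Y" "g y \<noteq> 0"
  shows "\<not> X.sim (r g) (\<lambda>_. 0)"
proof
  assume zero: "X.sim (r g) (\<lambda>_. 0)"
  have "clopen_on Y {y\<in>Y. g y \<noteq> 0}" using clopen_on_level[OF g(1), of "\<lambda>v. v \<noteq> 0"] .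
  then obtain M where M: "\<forall>z\<in>Y. \<exists>i\<le>M. Y.T (int i) z \<in> {y\<in>Y. g y \<noteq> 0}" using Y.hits_bounded[of _ y] y by blast
  define h where "h = (\<lambda>y. \<Sum>i\<le>M. g (Y.T (int i) y))"
  have lch: "locally_const Y h" unfolding h_def by (intro locally_const_sum Y.locally_const_T g)
  have "X.sim (r h) (\<lambda>x. \<Sum>i\<le>M. r (\<lambda>y. g (Y.T (int i) y)) x)"
    unfolding h_def by (intro r_sum Y.locally_const_T g)
  also have "X.sim \<dots> (\<lambda>x. \<Sum>i\<le>M. 0)"
    by (intro X.sim_sum X.sim_trans[OF r_shift[OF g(1)] zero])
  finally have rh: "X.sim (r h) (\<lambda>_. 0)" by simp
  have "1 \<le> h z" if z: "z \<in> Y" for z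
  proof -
    obtain i where i: "i \<le> M" "g (Y.T (int i) z) \<noteq> 0" using M z by blast
    have "g (Y.T (int i) z) \<le> h z" unfolding h_def using g(2) i z by (intro member_le_sum) auto
    moreover have "0 \<le> g (Y.T (int i) z)" using g(2) z by simp
    ultimately show ?thesis using i by linarith
  qed
  then have "X.posc (\<lambda>x. r h x - r (\<lambda>_. 1) x)" by (intro r_mono lch) auto
  then have "X.posc (\<lambda>x. 0 - 1)" by (rule X.posc_sim) (intro X.sim_diff rh r_one)
  then show False using X.not_posc_minus_one by simp
qed

lemma r_ind_nonzero:
  assumes "clopen_on Y C" "y \<in> C" "y \<in> Y"
  shows "\<not> X.sim (r (ind C)) (\<lambda>_. 0)"
  using assms by (intro r_faithful[of "ind C" y] locally_const_ind) auto

text \<open>The translates of \<open>G\<close> by \<open>M + 1\<close> consecutive times cover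
  \<open>X\<close>, so \<open>M + 1\<close> times its class is at least the unit. If a point visits
  \<open>U\<close> at most once during \<open>M + 1\<close> consecutive times, then
  \<open>M + 1\<close> times the class of \<open>r (ind U)\<close> is at most the unit.
  Unperforation cancels the factor.\<close>

lemma small_class:
  assumes G: "clopen_on X G" "x0 \<in> G" "x0 \<in> X" and y: "y \<in> Y"
  obtains W where "clopen_on Y W" "y \<in> W" "W \<subseteq> Y"
    "\<And>U. clopen_on Y U \<Longrightarrow> U \<subseteq> W \<Longrightarrow> X.posc (\<lambda>x. of_bool (x \<in> G) - r (ind U) x)"
proof -
  obtain M where M: "\<forall>x\<in>X. \<exists>i\<le>M. X.T (int i) x \<in> G" using X.hits_bounded[OF G] by blast
  define N where "N = - ((\<lambda>d. Y.T (int d) y) ` {1..M})"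
  have "open N" unfolding N_def by (intro open_Compl finite_imp_closed) simp
  moreover have "y \<in> N" unfolding N_def
  proof (rule ComplI, safe)
    fix i assume "y = Y.T (int i) y" "i \<in> {1..M}"
    then show False using Y.not_periodic[OF y, of i] by simp
  qed
  ultimately obtain S where S: "clopen_on Y S" "y \<in> S" "S \<subseteq> Y" "S \<subseteq> N"
    using cantor_set_clopen_nbhd[OF Y.cantor y] by metis
  \<comment> \<open>From a point of \<open>W\<close> the set \<open>S\<close> is not met at times 1
    to \<open>M\<close>, so no orbit visits \<open>W\<close> twice within \<open>M\<close> steps.
    The choice of \<open>S\<close> puts \<open>y\<close> into \<open>W\<close>.\<close>
  define W where "W = {z\<in>Y. z \<in> S \<and> (\<forall>d\<in>{1..M}. Y.T (int d) z \<notin> S)}"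
  have "locally_const Y (\<lambda>z. \<forall>d\<in>{1..M}. \<not> (Y.T (int d) z \<in> S))"
    by (rule locally_const_Ball[where Q="\<lambda>_ b. \<not> b"]) (auto intro: Y.locally_const_T S)
  then have "locally_const Y (\<lambda>z. z \<in> S \<and> (\<forall>d\<in>{1..M}. \<not> (Y.T (int d) z \<in> S)))"
    by (rule locally_const_comp2[OF S(1)])
  then have W: "clopen_on Y W" by (rule locally_const_cong) (auto simp: W_def)
  have yW: "y \<in> W" using y S by (auto simp: W_def N_def)
  have "X.posc (\<lambda>x. of_bool (x \<in> G) - r (ind U) x)" if U: "clopen_on Y U" "U \<subseteq> W" for U
  proof -
    define h where "h = (\<lambda>y. \<Sum>i\<le>M. ind U (Y.T (int i) y))"
    have lcU: "locally_const Y (\<lambda>y. ind U (Y.T n y))" for n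
      by (rule Y.locally_const_T[OF locally_const_ind[OF U(1)]])
    have lch: "locally_const Y h" unfolding h_def by (intro locally_const_sum lcU)
    have "X.sim (r h) (\<lambda>x. \<Sum>i\<le>M. r (\<lambda>y. ind U (Y.T (int i) y)) x)"
      unfolding h_def by (intro r_sum lcU)
    also have "X.sim \<dots> (\<lambda>x. \<Sum>i\<le>M. r (ind U) x)"
      by (intro X.sim_sum r_shift locally_const_ind U)
    finally have rh: "X.sim (r h) (\<lambda>x. int (Suc M) * r (ind U) x)" by simp
    have "h z \<le> 1" if z: "z \<in> Y" for z
    proof -
      have no: False if ij: "i < j" "j \<le> M" "Y.T (int i) z \<in> U" "Y.T (int j) z \<in> U" for i j
      proof -
        have "Y.T (int (j - i)) (Y.T (int i) z) = Y.T (int j) z"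
          using Y.T_add[OF z, of "int (j - i)" "int i"] ij by (simp add: of_nat_diff)
        then have "Y.T (int (j - i)) (Y.T (int i) z) \<in> S" using ij U(2) by (auto simp: W_def)
        moreover have "j - i \<in> {1..M}" using ij by auto
        ultimately show False using ij(3) U(2) unfolding W_def by blast
      qed
      have "card {i\<in>{..M}. Y.T (int i) z \<in> U} \<le> Suc 0"
      proof (subst card_le_Suc0_iff_eq, simp, safe)
        fix i j assume "i \<le> M" "j \<le> M" "Y.T (int i) z \<in> U" "Y.T (int j) z \<in> U"
        then show "i = j" using no[of i j] no[of j i] by (cases i j rule: linorder_cases) auto
      qed
      moreover have "h z = int (card {i\<in>{..M}. Y.T (int i) z \<in> U})"
        unfolding h_def by (simp add: Int_def)
      ultimately show ?thesis by simp
    qed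
    then have "X.posc (\<lambda>x. r (\<lambda>_. 1) x - r h x)" by (intro r_mono lch) auto
    then have p1: "X.posc (\<lambda>x. 1 - int (Suc M) * r (ind U) x)" 
      by (rule X.posc_sim) (intro X.sim_diff rh r_one)
    have lcG: "locally_const X (\<lambda>x. ind G (X.T n x))" for n
      by (rule X.locally_const_T[OF locally_const_ind[OF G(1)]])
    have "1 \<le> (\<Sum>i\<le>M. ind G (X.T (int i) x))" if x: "x \<in> X" for x
    proof -
      obtain i where i: "i \<le> M" "X.T (int i) x \<in> G" using M x by blast
      have "ind G (X.T (int i) x) \<le> (\<Sum>i\<le>M. ind G (X.T (int i) x))" using i by (intro member_le_sum) auto
      then show ?thesis using i by simp
    qed
    then have "X.posc (\<lambda>x. (\<Sum>i\<le>M. ind G (X.T (int i) x)) - 1)"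
    proof (intro X.poscI)
      show "locally_const X (\<lambda>x. (\<Sum>i\<le>M. ind G (X.T (int i) x)) - 1)"
        by (rule locally_const_comp[where h="\<lambda>v. v - 1"]) (intro locally_const_sum lcG)
    next
      fix x assume "x \<in> X"
      with \<open>\<And>x. x \<in> X \<Longrightarrow> 1 \<le> (\<Sum>i\<le>M. ind G (X.T (int i) x))\<close>
      have "1 \<le> (\<Sum>i\<le>M. ind G (X.T (int i) x))" by blast
      then show "0 \<le> (\<Sum>i\<le>M. ind G (X.T (int i) x)) - 1" by linarith
    qed
    moreover have "X.sim (\<lambda>x. \<Sum>i\<le>M. ind G (X.T (int i) x)) (\<lambda>x. \<Sum>i\<le>M. ind G x)"
      by (intro X.sim_sum X.sim_sym[OF X.sim_shift] locally_const_ind G)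
    ultimately have "X.posc (\<lambda>x. (\<Sum>i\<le>M. ind G x) - 1)"
      by (rule X.posc_sim[OF _ X.sim_diff[OF _ X.sim_refl]])
    then have p2: "X.posc (\<lambda>x. int (Suc M) * ind G x - 1)" by simp
    have "X.posc (\<lambda>x. (1 - int (Suc M) * r (ind U) x) + (int (Suc M) * ind G x - 1))"
      by (rule X.posc_add[OF p1 p2])
    then have "X.posc (\<lambda>x. int (Suc M) * (ind G x - r (ind U) x))" by (simp add: algebra_simps)
    then show ?thesis
      by (rule X.posc_unperforated)
        (auto intro!: locally_const_comp2[where h="(-)"] locally_const_ind G r_lc U)
  qed
  moreover have "W \<subseteq> Y" by (auto simp: W_def)
  ultimately show thesis using that[OF W yW] by blast
qed

text \<open>Realises the homomorphism by clopen sets on the atoms of \<open>P\<close>. By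
  \<open>sim_of_lift\<close>, such a labelling computes \<open>r\<close> on every function constant
  on atoms.\<close>

definition lift_of :: "('a \<Rightarrow> 'b set) \<Rightarrow> 'b set set \<Rightarrow> bool" where
  "lift_of \<kappa> P \<longleftrightarrow> locally_const X \<kappa> \<and> \<kappa> ` X \<subseteq> P \<and> (\<forall>C\<in>P. X.sim (ind {x\<in>X. \<kappa> x = C}) (r (ind C)))"

text \<open>An empty fibre has class zero, while the image under \<open>r\<close> of a nonempty
  clopen set does not.\<close>

lemma lift_of_onto:
  assumes \<kappa>: "lift_of \<kappa> P" and P: "Y.clopen_partition P" and C: "C \<in> P"
  shows "\<exists>x\<in>X. \<kappa> x = C"
proof (rule ccontr)
  assume no: "\<not> (\<exists>x\<in>X. \<kappa> x = C)"
  have "C \<noteq> {}" "C \<subseteq> Y" "clopen_on Y C" using P C unfolding Y.clopen_partition_def by blast+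
  then obtain y where "y \<in> C" "y \<in> Y" "clopen_on Y C" by blast
  then have "\<not> X.sim (r (ind C)) (\<lambda>_. 0)" using r_ind_nonzero by blast
  moreover have "X.sim (ind {x\<in>X. \<kappa> x = C}) (r (ind C))" using \<kappa> C by (auto simp: lift_of_def)
  moreover have "X.sim (\<lambda>_. 0) (ind {x\<in>X. \<kappa> x = C})" using no by (intro X.sim_eq) auto
  ultimately show False by (meson X.sim_trans X.sim_sym)
qed

lemma lift_of_partition_map:
  assumes \<kappa>: "lift_of \<kappa> P" and P: "Y.clopen_partition P"
  shows "partition_map X Y \<kappa>"
  unfolding partition_map_def
proof (intro conjI ballI impI)
  show "locally_const X \<kappa>" using \<kappa> by (simp add: lift_of_def)
next
  fix x assume "x \<in> X"
  then have "\<kappa> x \<in> P" using \<kappa> by (auto simp: lift_of_def)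
  then show "\<kappa> x \<noteq> {}" "\<kappa> x \<subseteq> Y" "clopen_on Y (\<kappa> x)" using P unfolding Y.clopen_partition_def by blast+
next
  fix y assume "y \<in> Y"
  then obtain C where "C \<in> P" "y \<in> C" using P unfolding Y.clopen_partition_def by blast
  then show "\<exists>x\<in>X. y \<in> \<kappa> x" using lift_of_onto[OF \<kappa> P] by blast
next
  fix x z assume "x \<in> X" "z \<in> X" "\<kappa> x \<inter> \<kappa> z \<noteq> {}"
  moreover from this have "\<kappa> x \<in> P" "\<kappa> z \<in> P" using \<kappa> by (auto simp: lift_of_def)
  ultimately show "\<kappa> x = \<kappa> z" using P unfolding Y.clopen_partition_def by blast
qed

text \<open>Both sides expand into the same combination of atoms. The selector \<open>s\<close> is
  arbitrary: it is later a homeomorphism in one place and a mere choice function in another.\<close>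

lemma sim_of_lift:
  assumes \<kappa>: "lift_of \<kappa> P" and P: "Y.clopen_partition P" and f: "locally_const Y f"
    and const: "\<forall>C\<in>P. \<forall>y\<in>C. \<forall>z\<in>C. f y = f z" and s: "\<forall>x\<in>X. s x \<in> \<kappa> x"
  shows "X.sim (f \<circ> s) (r f)"
proof -
  have fin: "finite P" and ne: "\<And>C. C \<in> P \<Longrightarrow> C \<noteq> {}" and cl: "\<And>C. C \<in> P \<Longrightarrow> clopen_on Y C"
    and cov: "\<Union>P = Y" and dj: "\<And>C D y. C \<in> P \<Longrightarrow> D \<in> P \<Longrightarrow> y \<in> C \<Longrightarrow> y \<in> D \<Longrightarrow> C = D"
    using P unfolding Y.clopen_partition_def by blast+
  obtain c where c: "\<And>C. C \<in> P \<Longrightarrow> c C \<in> C" using ne by (metis ex_in_conv)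
  have fC: "f y = f (c C)" if "C \<in> P" "y \<in> C" for C y using const c that by blast
  have lcC: "locally_const Y (\<lambda>y. f (c C) * ind C y)" if "C \<in> P" for C
    using locally_const_comp[OF locally_const_ind[OF cl[OF that]]] .
  have "X.sim (f \<circ> s) (\<lambda>x. \<Sum>C\<in>P. f (c C) * ind {x\<in>X. \<kappa> x = C} x)"
  proof (rule X.sim_eq)
    fix x assume x: "x \<in> X"
    then have k: "\<kappa> x \<in> P" "s x \<in> \<kappa> x" using \<kappa> s by (auto simp: lift_of_def)
    have "(\<Sum>C\<in>P. f (c C) * ind {x\<in>X. \<kappa> x = C} x) = (\<Sum>C\<in>P. if \<kappa> x = C then f (c C) else 0)"
      using x by (intro sum.cong) auto
    also have "\<dots> = f (c (\<kappa> x))" using fin k(1) by simp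
    finally show "(f \<circ> s) x = (\<Sum>C\<in>P. f (c C) * ind {x\<in>X. \<kappa> x = C} x)" using fC[OF k] by simp
  qed
  also have "X.sim \<dots> (\<lambda>x. \<Sum>C\<in>P. f (c C) * r (ind C) x)"
    using \<kappa> by (intro X.sim_sum X.sim_mult) (simp add: lift_of_def)
  also have "X.sim \<dots> (\<lambda>x. \<Sum>C\<in>P. r (\<lambda>y. f (c C) * ind C y) x)"
    by (intro X.sim_sum X.sim_sym[OF r_mult] locally_const_ind cl)
  also have "X.sim \<dots> (r (\<lambda>y. \<Sum>C\<in>P. f (c C) * ind C y))"
    by (rule X.sim_sym[OF r_sum]) (rule lcC)
  also have "X.sim \<dots> (r f)"
  proof (rule r_eq)
    show "locally_const Y (\<lambda>y. \<Sum>C\<in>P. f (c C) * ind C y)" by (intro locally_const_sum lcC)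
    fix y assume "y \<in> Y"
    then obtain C where C: "C \<in> P" "y \<in> C" using cov by blast
    have "(\<Sum>D\<in>P. f (c D) * ind D y) = (\<Sum>D\<in>P. if C = D then f (c D) else 0)"
      using C dj by (intro sum.cong) auto
    also have "\<dots> = f (c C)" using fin C(1) by simp
    finally show "(\<Sum>C\<in>P. f (c C) * ind C y) = f y" using fC[OF C] by simp
  qed
  finally show ?thesis .
qed

end

context cantor_minimal begin

section \<open>Towers and tilings\<close>

text \<open>The rule for labels along an orbit: below the roof the next atom is forced, from the
  roof any atom of the base may come next.\<close>

definition follows :: "'a set \<Rightarrow> 'a set \<Rightarrow> 'a set \<Rightarrow> bool" where
  "follows U C D \<longleftrightarrow> (if \<alpha> ` C \<subseteq> U then D \<subseteq> U else D = \<alpha> ` C)"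

lemma krD:
  assumes "kr P U"
  shows "finite P" "\<Union>P = X" "C \<in> P \<Longrightarrow> C \<noteq> {}" "C \<in> P \<Longrightarrow> C \<subseteq> X" "C \<in> P \<Longrightarrow> clopen_on X C"
    "C \<in> P \<Longrightarrow> D \<in> P \<Longrightarrow> y \<in> C \<Longrightarrow> y \<in> D \<Longrightarrow> C = D" "is_base U" "C \<in> P \<Longrightarrow> y \<in> C \<Longrightarrow> y \<in> U \<Longrightarrow> C \<subseteq> U"
    "C \<in> P \<Longrightarrow> \<alpha> ` C \<in> P \<or> \<alpha> ` C \<subseteq> U" "C \<in> P \<Longrightarrow> C \<subseteq> U \<or> (\<exists>D\<in>P. C = \<alpha> ` D)" "clopen_partition P"
proof -
  note k = assms[unfolded kr_def]
  show part: "clopen_partition P" and "is_base U" using k by blast+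
  note c = part[unfolded clopen_partition_def]
  show "finite P" and un: "\<Union>P = X" using c by blast+
  show "C \<in> P \<Longrightarrow> C \<noteq> {}" "C \<in> P \<Longrightarrow> clopen_on X C" using c by blast+
  show "C \<in> P \<Longrightarrow> C \<subseteq> X" using Union_upper[of C P] unfolding un .
  have "\<forall>C\<in>P. \<forall>D\<in>P. C \<inter> D \<noteq> {} \<longrightarrow> C = D" using c by blast
  then show "C \<in> P \<Longrightarrow> D \<in> P \<Longrightarrow> y \<in> C \<Longrightarrow> y \<in> D \<Longrightarrow> C = D" by (metis IntI empty_iff)
  have "\<forall>C\<in>P. C \<subseteq> U \<or> C \<inter> U = {}" using k by blast
  then show "C \<in> P \<Longrightarrow> y \<in> C \<Longrightarrow> y \<in> U \<Longrightarrow> C \<subseteq> U" by blast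
  show "C \<in> P \<Longrightarrow> \<alpha> ` C \<in> P \<or> \<alpha> ` C \<subseteq> U" "C \<in> P \<Longrightarrow> C \<subseteq> U \<or> (\<exists>D\<in>P. C = \<alpha> ` D)" using k by blast+
qed

lemma image_T_succ: "C \<subseteq> X \<Longrightarrow> \<alpha> ` (T n ` C) = T (n + 1) ` C"
  unfolding image_image by (rule image_cong) (auto simp: T_succ)

text \<open>The return time of one point \<open>y\<close> serves as the height of the whole tower,
  because an atom that meets \<open>U\<close> lies in \<open>U\<close>.\<close>

lemma kr_tower:
  assumes P: "kr P U" and C: "C \<in> P" "C \<subseteq> U" "y \<in> C"
  shows "j < ret U y \<Longrightarrow> T (int j) ` C \<in> P"
    and "0 < j \<Longrightarrow> j < ret U y \<Longrightarrow> T (int j) ` C \<inter> U = {}"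
    and "\<alpha> ` (T (int (ret U y - 1)) ` C) \<subseteq> U"
proof -
  note U = krD(7)[OF P]
  have CX: "C \<subseteq> X" using krD(4)[OF P C(1)] .
  then have yX: "y \<in> X" using C by blast
  have suc: "\<alpha> ` (T (int j) ` C) = T (int (Suc j)) ` C" for j
    using image_T_succ[OF CX, of "int j"] by (simp add: add.commute)
  show inP: "T (int j) ` C \<in> P" if "j < ret U y" for j
    using that
  proof (induction j)
    case 0
    then show ?case using C by simp
  next
    case (Suc j)
    then have "T (int j) ` C \<in> P" by simp
    then have "T (int (Suc j)) ` C \<in> P \<or> T (int (Suc j)) ` C \<subseteq> U" using krD(9)[OF P] suc[of j] by metis
    moreover have "T (int (Suc j)) y \<notin> U" using not_in_before_ret[OF U _ Suc.prems] by blast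
    ultimately show ?case using C(3) by blast
  qed
  show "T (int j) ` C \<inter> U = {}" if "0 < j" "j < ret U y"
    using krD(8)[OF P inP[OF that(2)]] not_in_before_ret[OF U that] C(3) by blast
  have "ret U y - 1 < ret U y" using ret_pos[OF U, of y] by simp
  then have "T (int (ret U y - 1)) ` C \<in> P" using inP by blast
  then have "T (int (ret U y)) ` C \<in> P \<or> T (int (ret U y)) ` C \<subseteq> U"
    using krD(9)[OF P] suc[of "ret U y - 1"] ret_pos[OF U, of y] by (metis Suc_diff_1)
  moreover have "T (int (ret U y)) y \<in> U" using T_ret_in[OF U yX] .
  ultimately have "T (int (ret U y)) ` C \<subseteq> U" using krD(8)[OF P] C(3) by blast
  then show "\<alpha> ` (T (int (ret U y - 1)) ` C) \<subseteq> U"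
    unfolding suc using ret_pos[OF U, of y] by simp
qed

text \<open>Descend the tower by induction on the age; \<open>m\<close> does not change on the
  way.\<close>

lemma kr_base_of:
  assumes P: "kr P U" and m: "\<forall>C\<in>P. \<not> \<alpha> ` C \<subseteq> U \<longrightarrow> m (\<alpha> ` C) = m C" and C: "C \<in> P"
  shows "\<exists>D\<in>P. D \<subseteq> U \<and> m D = m C"
proof -
  note U = krD(7)[OF P]
  have "\<exists>D\<in>P. D \<subseteq> U \<and> m D = m C" if "C \<in> P" "y \<in> C" "age U y = n" for n y C
    using that
  proof (induction n arbitrary: y C)
    case 0
    then have "y \<in> U" using age_eq_0[OF U, of y] krD(4)[OF P] by blast
    then show ?case using krD(8)[OF P] 0 by blast
  next
    case (Suc n)
    show ?case
    proof (cases "C \<subseteq> U")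
      case True
      then show ?thesis using Suc by blast
    next
      case False
      then obtain D where D: "D \<in> P" "C = \<alpha> ` D" using krD(10)[OF P Suc.prems(1)] by blast
      then obtain z where z: "z \<in> D" "y = \<alpha> z" using Suc by blast
      have zX: "z \<in> X" using krD(4)[OF P D(1)] z by blast
      have "\<alpha> z \<notin> U" using False krD(8)[OF P Suc.prems(1)] Suc.prems z by blast
      then have "age U z = n" using age_foot_succ(1)[OF U zX] Suc.prems z by simp
      then obtain E where "E \<in> P" "E \<subseteq> U" "m E = m D" using Suc.IH[OF D(1) z(1)] by blast
      then show ?thesis using m D False by auto
    qed
  qed
  then show ?thesis using C krD(3)[OF P] by blast
qed

text \<open>Since \<open>m\<close> is constant along towers, a whole tower can be peeled off at a
  time, by induction on the total multiplicity. Towers start in the base and end at the roof, so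
  they may be concatenated in any order.\<close>

lemma tiling_word:
  fixes m :: "'a set \<Rightarrow> nat"
  assumes P: "kr P U" and m: "\<forall>C\<in>P. \<not> \<alpha> ` C \<subseteq> U \<longrightarrow> m (\<alpha> ` C) = m C"
  shows "\<exists>cs. set cs \<subseteq> P \<and> (\<forall>C\<in>P. count_list cs C = m C) \<and> successively (follows U) cs
    \<and> (cs \<noteq> [] \<longrightarrow> hd cs \<subseteq> U \<and> \<alpha> ` last cs \<subseteq> U)"
  using m
proof (induction "sum m P" arbitrary: m rule: less_induct)
  case less
  note fin = krD(1)[OF P] and U = krD(7)[OF P]
  show ?case
  proof (cases "\<forall>C\<in>P. m C = 0")
    case True
    then show ?thesis by (intro exI[of _ "[]"]) auto
  next
    case False
    then obtain C1 where "C1 \<in> P" "m C1 \<noteq> 0" by blast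
    then obtain C where C: "C \<in> P" "C \<subseteq> U" "m C > 0" using kr_base_of[OF P less.prems] by (metis gr0I)
    obtain y where y: "y \<in> C" using krD(3)[OF P C(1)] by blast
    have CX: "C \<subseteq> X" and yX: "y \<in> X" using krD(4)[OF P C(1)] y by auto
    define h where "h = ret U y"
    have hpos: "h > 0" unfolding h_def by (rule ret_pos[OF U])
    define lev where "lev = (\<lambda>j. T (int j) ` C)"
    have levP: "lev j \<in> P" if "j < h" for j
      using kr_tower(1)[OF P C(1,2) y] that by (simp add: lev_def h_def)
    have lev_disj: "lev j \<inter> U = {}" if "0 < j" "j < h" for j
      using kr_tower(2)[OF P C(1,2) y] that by (simp add: lev_def h_def)
    have lev_suc: "\<alpha> ` lev j = lev (Suc j)" for j
      unfolding lev_def using image_T_succ[OF CX, of "int j"] by (simp add: add.commute)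
    have lev0: "lev 0 = C" by (simp add: lev_def)
    have not_roof: "\<not> \<alpha> ` lev j \<subseteq> U" if "Suc j < h" for j
      using lev_disj[of "Suc j"] levP[OF that] krD(3)[OF P] that unfolding lev_suc by blast
    have roof: "\<alpha> ` lev (h - 1) \<subseteq> U"
      using kr_tower(3)[OF P C(1,2) y] by (simp add: lev_def h_def)
    have lev_m: "m (lev j) = m C" if "j < h" for j
      using that
    proof (induction j)
      case 0
      then show ?case by (simp add: lev0)
    next
      case (Suc j)
      then have "lev j \<in> P" "\<not> \<alpha> ` lev j \<subseteq> U" using levP not_roof by auto
      then have "m (\<alpha> ` lev j) = m (lev j)" using less.prems by blast
      then show ?case using Suc unfolding lev_suc by simp
    qed
    \<comment> \<open>Two equal levels would bring \<open>y\<close> back to \<open>U\<close> before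
      its return time.\<close>
    have lev_inj: "i = j" if "i \<le> j" "j < h" "lev i = lev j" for i j
    proof (rule ccontr)
      assume "i \<noteq> j"
      then have ij: "0 < j - i" "j - i < h" using that(1,2) by linarith+
      have "T (int j) y \<in> lev i" unfolding that(3) using y unfolding lev_def by blast
      then obtain z where z: "z \<in> C" "T (int j) y = T (int i) z" unfolding lev_def by blast
      have "T (int (j - i)) y = T (- int i) (T (int j) y)"
        using T_add[OF yX, of "- int i" "int j"] that(1) by (simp add: of_nat_diff)
      also have "\<dots> = z" unfolding z(2) using z(1) CX by (intro T_minus) blast
      finally have "T (int (j - i)) y \<in> U" using z C by blast
      then show False using not_in_before_ret[OF U ij(1)] ij(2) by (simp add: h_def)
    qed
    have injlev: "inj_on lev {..<h}"
    proof (rule inj_onI)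
      fix i j assume "i \<in> {..<h}" "j \<in> {..<h}" "lev i = lev j"
      then show "i = j" using lev_inj[of i j] lev_inj[of j i] by (cases "i \<le> j") auto
    qed
    define tw where "tw = map lev [0..<h]"
    have settw: "set tw = lev ` {..<h}" by (auto simp: tw_def)
    have disttw: "distinct tw" using injlev by (simp add: tw_def distinct_map atLeast0LessThan)
    have cnttw: "count_list tw D = of_bool (D \<in> set tw)" for D
    proof -
      have "count_list xs D = of_bool (D \<in> set xs)" if "distinct xs" for xs
        using that by (induction xs) auto
      then show ?thesis using disttw .
    qed
    \<comment> \<open>The truncated subtraction is exact: every level of the tower has the positive
      multiplicity of its base atom.\<close>
    define m' where "m' = (\<lambda>D. m D - of_bool (D \<in> set tw))"
    have mm': "m D = m' D + of_bool (D \<in> set tw)" for D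
      using lev_m C(3) by (auto simp: m'_def settw)
    have inv: "\<forall>D\<in>P. \<not> \<alpha> ` D \<subseteq> U \<longrightarrow> m' (\<alpha> ` D) = m' D"
    proof (intro ballI impI)
      fix D assume D: "D \<in> P" "\<not> \<alpha> ` D \<subseteq> U"
      have "D \<in> set tw \<longleftrightarrow> \<alpha> ` D \<in> set tw"
      proof
        assume "D \<in> set tw"
        then obtain j where j: "j < h" "D = lev j" by (auto simp: settw)
        then have "Suc j < h" using roof D(2) by (cases "j = h - 1") auto
        then show "\<alpha> ` D \<in> set tw" using j lev_suc by (auto simp: settw)
      next
        assume "\<alpha> ` D \<in> set tw"
        then obtain j where j: "j < h" "\<alpha> ` D = lev j" by (auto simp: settw)
        then have "j \<noteq> 0" using D(2) C(2) lev0 by (metis)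
        then obtain i where i: "j = Suc i" using not0_implies_Suc by blast
        then have "\<alpha> ` D = \<alpha> ` lev i" using j lev_suc by simp
        moreover have "D \<subseteq> X" "lev i \<subseteq> X" using krD(4)[OF P] D levP[of i] i j by auto
        ultimately have "D = lev i" using inj_on_image_eq_iff[of \<alpha> X D "lev i"] bij by (simp add: bij_betw_def)
        then show "D \<in> set tw" using i j by (auto simp: settw)
      qed
      then show "m' (\<alpha> ` D) = m' D" using less.prems D by (auto simp: m'_def)
    qed
    have "sum m' P < sum m P"
    proof (rule sum_strict_mono_ex1[OF fin])
      show "\<forall>D\<in>P. m' D \<le> m D" by (simp add: m'_def)
      have "C \<in> set tw" using lev0 hpos by (auto simp: settw intro!: image_eqI[of _ _ 0])
      then show "\<exists>D\<in>P. m' D < m D" using C mm'[of C] by (intro bexI[of _ C]) auto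
    qed
    then obtain cs where cs: "set cs \<subseteq> P" "\<forall>C\<in>P. count_list cs C = m' C" "successively (follows U) cs"
      "cs \<noteq> [] \<longrightarrow> hd cs \<subseteq> U \<and> \<alpha> ` last cs \<subseteq> U" using less.hyps[OF _ inv] by blast
    have twne: "tw \<noteq> []" and hdtw: "hd tw = C" and lasttw: "last tw = lev (h - 1)"
      using hpos lev0 by (auto simp: tw_def hd_map last_map)
    have "successively (follows U) tw"
      unfolding successively_conv_nth
    proof (intro allI impI)
      fix i assume i: "Suc i < length tw"
      then have "\<not> \<alpha> ` lev i \<subseteq> U" using not_roof by (simp add: tw_def)
      then show "follows U (tw ! i) (tw ! Suc i)" using i lev_suc[of i] by (simp add: tw_def follows_def)
    qed
    moreover have "follows U (last tw) (hd cs)" if "cs \<noteq> []"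
      using roof cs(4) that by (simp add: follows_def lasttw)
    ultimately have "successively (follows U) (tw @ cs)"
      using cs(3) by (auto simp: successively_append_iff)
    moreover have "set (tw @ cs) \<subseteq> P" using cs(1) levP by (auto simp: settw)
    moreover have "\<forall>D\<in>P. count_list (tw @ cs) D = m D" using cs(2) mm' cnttw by simp
    moreover have "hd (tw @ cs) \<subseteq> U" using twne hdtw C(2) by simp
    moreover have "\<alpha> ` last (tw @ cs) \<subseteq> U" using roof lasttw cs(4) by (cases "cs = []") auto
    ultimately show ?thesis by blast
  qed
qed

end

context k0_map begin

text \<open>The column sum of \<open>r (ind C)\<close> says how often the atom \<open>C\<close> must
  occur in a column. Over a small base these numbers are nonnegative, constant along towers since
  \<beta> does not change classes, and add up to the height of the column since \<open>r\<close>
  preserves the unit. So \<open>tiling_word\<close> fills every column exactly.\<close>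

lemma tiling:
  assumes P: "Y.kr P U"
  shows "\<exists>\<kappa>. lift_of \<kappa> P \<and> (\<forall>x\<in>X. Y.follows U (\<kappa> x) (\<kappa> (\<alpha> x)))"
proof -
  note fin = Y.krD(1)[OF P]
  have lcC: "locally_const Y (ind C)" if "C \<in> P" for C using locally_const_ind[OF Y.krD(5)[OF P that]] .
  define f where "f = (\<lambda>C. r (ind C))"
  have lcf: "locally_const X (f C)" if "C \<in> P" for C unfolding f_def using r_lc[OF lcC[OF that]] .
  have "\<exists>u :: 'a \<Rightarrow> int. locally_const X u \<and>
    (\<forall>B. X.is_base B \<longrightarrow> (\<forall>x\<in>B. \<forall>y\<in>B. u x = u y) \<longrightarrow> (\<forall>b\<in>B. 0 \<le> X.colsum B (f C) b))" if C: "C \<in> P" for C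
  proof -
    have "X.posc (f C)" unfolding f_def by (rule r_pos[OF lcC[OF C]]) simp
    then show ?thesis by (rule X.posc_colsum) blast
  qed
  then obtain u1 :: "'b set \<Rightarrow> 'a \<Rightarrow> int" where u1: "\<And>C. C \<in> P \<Longrightarrow> locally_const X (u1 C) \<and>
    (\<forall>B. X.is_base B \<longrightarrow> (\<forall>x\<in>B. \<forall>y\<in>B. u1 C x = u1 C y) \<longrightarrow> (\<forall>b\<in>B. 0 \<le> X.colsum B (f C) b))" by metis
  have "\<exists>u :: 'a \<Rightarrow> int. locally_const X u \<and> (\<forall>B. X.is_base B \<longrightarrow> (\<forall>x\<in>B. \<forall>y\<in>B. u x = u y) \<longrightarrow>
      \<not> \<beta> ` C \<subseteq> U \<longrightarrow> (\<forall>b\<in>B. X.colsum B (f (\<beta> ` C)) b = X.colsum B (f C) b))" if C: "C \<in> P" for C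
  proof (cases "\<beta> ` C \<subseteq> U")
    case True
    then show ?thesis by (intro exI[of _ "\<lambda>_. 0"]) auto
  next
    case False
    then have "\<beta> ` C \<in> P" using Y.krD(9)[OF P C] by blast
    have CY: "C \<subseteq> Y" using Y.krD(4)[OF P C] .
    have "X.sim (f (\<beta> ` C)) (r (\<lambda>y. ind (\<beta> ` C) (Y.T 1 y)))"
      unfolding f_def by (rule X.sim_sym[OF r_shift[OF lcC[OF \<open>\<beta> ` C \<in> P\<close>]]])
    also have "X.sim \<dots> (f C)"
      unfolding f_def
    proof (rule r_eq)
      show "locally_const Y (\<lambda>y. ind (\<beta> ` C) (Y.T 1 y))" by (rule Y.locally_const_T[OF lcC[OF \<open>\<beta> ` C \<in> P\<close>]])
      fix y assume y: "y \<in> Y"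
      have "\<beta> y \<in> \<beta> ` C \<longleftrightarrow> y \<in> C" using Y.bij y CY by (meson bij_betw_def inj_on_image_mem_iff)
      then show "ind (\<beta> ` C) (Y.T 1 y) = ind C y" using Y.T_1[OF y] by simp
    qed
    finally show ?thesis by (rule X.sim_colsum) blast
  qed
  then obtain u2 :: "'b set \<Rightarrow> 'a \<Rightarrow> int" where u2: "\<And>C. C \<in> P \<Longrightarrow> locally_const X (u2 C) \<and>
    (\<forall>B. X.is_base B \<longrightarrow> (\<forall>x\<in>B. \<forall>y\<in>B. u2 C x = u2 C y) \<longrightarrow>
      \<not> \<beta> ` C \<subseteq> U \<longrightarrow> (\<forall>b\<in>B. X.colsum B (f (\<beta> ` C)) b = X.colsum B (f C) b))" by metis
  have "X.sim (\<lambda>x. \<Sum>C\<in>P. f C x) (r (\<lambda>y. \<Sum>C\<in>P. ind C y))"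
    unfolding f_def by (rule X.sim_sym[OF r_sum]) (rule lcC)
  also have "X.sim \<dots> (r (\<lambda>_. 1))"
  proof (rule r_eq)
    show "locally_const Y (\<lambda>y. \<Sum>C\<in>P. ind C y)" by (intro locally_const_sum lcC)
    fix y assume "y \<in> Y"
    then obtain C where C: "C \<in> P" "y \<in> C" using Y.krD(2)[OF P] by blast
    have "(\<Sum>D\<in>P. ind D y) = (\<Sum>D\<in>P. if C = D then 1 else 0 :: int)"
      using C Y.krD(6)[OF P] by (intro sum.cong) auto
    then show "(\<Sum>D\<in>P. ind D y) = 1" using fin C(1) by simp
  qed
  also have "X.sim \<dots> (\<lambda>_. 1)" by (rule r_one)
  finally have "\<exists>u :: 'a \<Rightarrow> int. locally_const X u \<and> (\<forall>B. X.is_base B \<longrightarrow> (\<forall>x\<in>B. \<forall>y\<in>B. u x = u y) \<longrightarrow>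
    (\<forall>b\<in>B. X.colsum B (\<lambda>x. \<Sum>C\<in>P. f C x) b = X.colsum B (\<lambda>_. 1) b))" by (rule X.sim_colsum) blast
  then obtain u3 :: "'a \<Rightarrow> int" where u3: "locally_const X u3" "\<And>B. X.is_base B \<Longrightarrow> (\<forall>x\<in>B. \<forall>y\<in>B. u3 x = u3 y) \<Longrightarrow>
    (\<forall>b\<in>B. X.colsum B (\<lambda>x. \<Sum>C\<in>P. f C x) b = X.colsum B (\<lambda>_. 1) b)" by blast
  define u where "u = (\<lambda>x. (u3 x, restrict (\<lambda>C. u1 C x) P, restrict (\<lambda>C. u2 C x) P))"
  have "locally_const X (\<lambda>x. restrict (\<lambda>C. u1 C x) P)" "locally_const X (\<lambda>x. restrict (\<lambda>C. u2 C x) P)"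
    using u1 u2 by (intro locally_const_restrict fin; blast)+
  then have lcu: "locally_const X u"
    unfolding u_def by (intro locally_const_comp2[OF u3(1), where h=Pair] locally_const_comp2[where h=Pair])
  obtain x0 where x0: "x0 \<in> X" using X.nonempty by blast
  define B where "B = {z\<in>X. u z = u x0}"
  have B: "X.is_base B" unfolding B_def using X.is_base_level[OF lcu x0] by blast
  have uB: "u x = u y" if "x \<in> B" "y \<in> B" for x y using that by (simp add: B_def)
  have c3: "\<forall>x\<in>B. \<forall>y\<in>B. u3 x = u3 y"
  proof (intro ballI)
    fix x y assume "x \<in> B" "y \<in> B"
    then have "fst (u x) = fst (u y)" using uB by metis
    then show "u3 x = u3 y" by (simp add: u_def)
  qed
  have c12: "\<forall>x\<in>B. \<forall>y\<in>B. u1 C x = u1 C y" "\<forall>x\<in>B. \<forall>y\<in>B. u2 C x = u2 C y" if C: "C \<in> P" for C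
  proof -
    have "u1 C x = u1 C y \<and> u2 C x = u2 C y" if xy: "x \<in> B" "y \<in> B" for x y
    proof -
      have "fst (snd (u x)) C = fst (snd (u y)) C" "snd (snd (u x)) C = snd (snd (u y)) C"
        unfolding uB[OF xy] by blast+
      then show ?thesis using C by (simp add: u_def)
    qed
    then show "\<forall>x\<in>B. \<forall>y\<in>B. u1 C x = u1 C y" "\<forall>x\<in>B. \<forall>y\<in>B. u2 C x = u2 C y" by blast+
  qed
  \<comment> \<open>Restricted to the finite set \<open>P\<close>, the multiplicity function depends
    on finitely many column sums and is locally constant.\<close>
  define m where "m = (\<lambda>b. restrict (\<lambda>C. nat (X.colsum B (f C) b)) P)"
  have lcm: "locally_const X m"
    unfolding m_def
    by (rule locally_const_restrict[OF fin]) (rule locally_const_comp[OF X.locally_const_colsum[OF B lcf]])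
  have pos: "0 \<le> X.colsum B (f C) b" if "C \<in> P" "b \<in> B" for C b
    using u1[OF that(1)] B c12(1)[OF that(1)] that(2) by blast
  have minv: "\<forall>C\<in>P. \<not> \<beta> ` C \<subseteq> U \<longrightarrow> m b (\<beta> ` C) = m b C" if b: "b \<in> B" for b
  proof (intro ballI impI)
    fix C assume C: "C \<in> P" "\<not> \<beta> ` C \<subseteq> U"
    then have "\<beta> ` C \<in> P" using Y.krD(9)[OF P] by blast
    moreover have "X.colsum B (f (\<beta> ` C)) b = X.colsum B (f C) b"
      using u2[OF C(1)] B c12(2)[OF C(1)] b C(2) by blast
    ultimately show "m b (\<beta> ` C) = m b C" using C by (simp add: m_def)
  qed
  define ok where "ok = (\<lambda>m cs. set cs \<subseteq> P \<and> (\<forall>C\<in>P. count_list cs C = m C) \<and> successively (Y.follows U) cs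
    \<and> (cs \<noteq> [] \<longrightarrow> hd cs \<subseteq> U \<and> \<beta> ` last cs \<subseteq> U))"
  \<comment> \<open>The word is chosen from the multiplicities alone, so that it is locally constant
    in the foot of the column.\<close>
  define w where "w = (\<lambda>m. SOME cs. ok m cs)"
  have okw: "ok (m b) (w (m b))" if "b \<in> B" for b
    unfolding w_def using Y.tiling_word[OF P minv[OF that]] by (intro someI_ex[of "ok (m b)"]) (simp add: ok_def)
  have len: "length (w (m b)) = X.ret B b" if b: "b \<in> B" for b
  proof -
    have "length (w (m b)) = (\<Sum>C\<in>P. count_list (w (m b)) C)"
      using okw[OF b] fin sum_count_set[of "w (m b)" P] by (simp add: ok_def)
    also have "int \<dots> = (\<Sum>C\<in>P. X.colsum B (f C) b)"
      using okw[OF b] pos[OF _ b] by (simp add: ok_def m_def)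
    also have "\<dots> = X.colsum B (\<lambda>x. \<Sum>C\<in>P. f C x) b"
      unfolding X.colsum_def by (rule sum.swap)
    also have "\<dots> = int (X.ret B b)" using u3(2)[OF B c3] b by (simp add: X.colsum_def)
    finally show ?thesis by simp
  qed
  define \<kappa> where "\<kappa> = (\<lambda>x. w (m (X.foot B x)) ! X.age B x)"
  have lc\<kappa>: "locally_const X \<kappa>"
    unfolding \<kappa>_def
    by (rule locally_const_comp2[OF X.locally_const_foot[OF B lcm] X.locally_const_age[OF B], where h="\<lambda>m j. w m ! j"])
  have \<kappa>P: "\<kappa> x \<in> P" if x: "x \<in> X" for x
  proof -
    have b: "X.foot B x \<in> B" using X.foot_in[OF B x] .
    then have "\<kappa> x \<in> set (w (m (X.foot B x)))" unfolding \<kappa>_def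
      using len[OF b] X.age_less_ret[OF B x] by simp
    then show ?thesis using okw[OF b] by (auto simp: ok_def)
  qed
  have "X.sim (ind {x\<in>X. \<kappa> x = C}) (r (ind C))" if C: "C \<in> P" for C
  proof -
    have lci: "locally_const X (ind {x\<in>X. \<kappa> x = C})" by (rule locally_const_ind[OF clopen_on_level[OF lc\<kappa>]])
    have "X.colsum B (ind {x\<in>X. \<kappa> x = C}) b = X.colsum B (f C) b" if b: "b \<in> B" for b
    proof -
      have bX: "b \<in> X" using X.base_in[OF B b] .
      have "X.colsum B (ind {x\<in>X. \<kappa> x = C}) b = (\<Sum>i<X.ret B b. of_bool (w (m b) ! i = C))"
        unfolding X.colsum_def using X.age_foot_level[OF B b] bX by (intro sum.cong) (auto simp: \<kappa>_def)
      also have "\<dots> = int (card {i. i < length (w (m b)) \<and> w (m b) ! i = C})"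
        using len[OF b] by (simp add: Int_def)
      also have "\<dots> = int (count_list (w (m b)) C)"
        by (simp add: count_list_eq_length_filter length_filter_conv_card eq_commute)
      also have "\<dots> = X.colsum B (f C) b"
        using okw[OF b] C pos[OF C b] by (simp add: ok_def m_def)
      finally show ?thesis .
    qed
    then have "X.sim (ind {x\<in>X. \<kappa> x = C}) (f C)" by (intro X.sim_of_colsum[OF B lci lcf[OF C]]) blast
    then show ?thesis by (simp add: f_def)
  qed
  moreover have "Y.follows U (\<kappa> x) (\<kappa> (\<alpha> x))" if x: "x \<in> X" for x
  proof -
    let ?b = "X.foot B x"
    have b: "?b \<in> B" using X.foot_in[OF B x] .
    note ok = okw[OF b, unfolded ok_def]
    show ?thesis
    proof (cases "\<alpha> x \<in> B")
      case True
      \<comment> \<open>Crossing from one column to the next: the finished word ends at the roof,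
        and the new one begins in the base.\<close>
      have L: "Suc (X.age B x) = length (w (m ?b))" using X.base_succ_iff[OF B x] True len[OF b] by simp
      then have ne: "w (m ?b) \<noteq> []" by (metis length_0_conv nat.distinct(1))
      have "X.age B x = length (w (m ?b)) - 1" using L by simp
      then have "\<kappa> x = last (w (m ?b))" unfolding \<kappa>_def last_conv_nth[OF ne] by (simp only:)
      moreover have "\<beta> ` last (w (m ?b)) \<subseteq> U" using ok ne by blast
      ultimately have "\<beta> ` \<kappa> x \<subseteq> U" by (simp only:)
      have "w (m (\<alpha> x)) \<noteq> []" using len[OF True] X.ret_pos[OF B, of "\<alpha> x"] by auto
      then have "\<kappa> (\<alpha> x) \<subseteq> U"
        using okw[OF True] X.age_base[OF B True] by (simp add: \<kappa>_def ok_def hd_conv_nth)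
      then show ?thesis using \<open>\<beta> ` \<kappa> x \<subseteq> U\<close> by (simp add: Y.follows_def)
    next
      case False
      have "Suc (X.age B x) < length (w (m ?b))"
        using X.base_succ_iff[OF B x] False len[OF b] X.age_less_ret[OF B x] by linarith
      then have "Y.follows U (w (m ?b) ! X.age B x) (w (m ?b) ! Suc (X.age B x))"
        using ok by (simp add: successively_conv_nth)
      then show ?thesis using X.age_foot_succ[OF B x False] by (simp add: \<kappa>_def)
    qed
  qed
  ultimately have "lift_of \<kappa> P" "\<forall>x\<in>X. Y.follows U (\<kappa> x) (\<kappa> (\<alpha> x))"
    using lc\<kappa> \<kappa>P unfolding lift_of_def by (blast, blast)
  then show ?thesis by blast
qed

end

section \<open>Order homomorphisms at the level of functions\<close>

context cantor_minimal begin

lemma mem_k0_class: "g \<in> k0_class X \<alpha> f \<longleftrightarrow> locally_const X g \<and> sim g f"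
  by (simp add: k0_class_def cont_int_iff sim_def)

lemma k0_class_eq:
  assumes "locally_const X f"
  shows "k0_class X \<alpha> f = k0_class X \<alpha> g \<longleftrightarrow> sim f g"
proof
  assume "k0_class X \<alpha> f = k0_class X \<alpha> g"
  then show "sim f g" using assms mem_k0_class[of f f] mem_k0_class[of f g] by simp
next
  assume fg: "sim f g"
  have "sim h f \<longleftrightarrow> sim h g" for h using fg sim_sym sim_trans by metis
  then show "k0_class X \<alpha> f = k0_class X \<alpha> g" by (simp add: set_eq_iff mem_k0_class)
qed

text \<open>For the nontrivial inclusion, a representative \<open>h\<close> of the sum is written as
  \<open>f\<close> plus \<open>h - f\<close>.\<close>

lemma k0_mult:
  assumes f: "locally_const X f" and g: "locally_const X g"
  shows "mult (k0 X \<alpha>) (k0_class X \<alpha> f) (k0_class X \<alpha> g) = k0_class X \<alpha> (\<lambda>x. f x + g x)"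
proof (intro equalityI subsetI)
  fix h assume "h \<in> mult (k0 X \<alpha>) (k0_class X \<alpha> f) (k0_class X \<alpha> g)"
  then obtain f' g' where "h = (\<lambda>x. f' x + g' x)" "f' \<in> k0_class X \<alpha> f" "g' \<in> k0_class X \<alpha> g"
    by (auto simp: k0_def)
  then show "h \<in> k0_class X \<alpha> (\<lambda>x. f x + g x)"
    by (auto simp: mem_k0_class intro: sim_add locally_const_comp2[where h="(+)"])
next
  fix h assume "h \<in> k0_class X \<alpha> (\<lambda>x. f x + g x)"
  then have h: "locally_const X h" "sim h (\<lambda>x. f x + g x)" by (auto simp: mem_k0_class)
  have "sim (\<lambda>x. h x - f x) (\<lambda>x. f x + g x - f x)" by (intro sim_diff h) auto
  then have "(\<lambda>x. h x - f x) \<in> k0_class X \<alpha> g"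
    using h(1) f by (auto simp: mem_k0_class intro: locally_const_comp2[where h="(-)"])
  moreover have "f \<in> k0_class X \<alpha> f" using f by (simp add: mem_k0_class)
  moreover have "h = (\<lambda>x. f x + (h x - f x))" by auto
  ultimately show "h \<in> mult (k0 X \<alpha>) (k0_class X \<alpha> f) (k0_class X \<alpha> g)"
    unfolding k0_def monoid.simps by (intro CollectI exI[of _ f] exI[of _ "\<lambda>x. h x - f x"]) blast
qed

lemma carrier_k0: "A \<in> carrier (k0 X \<alpha>) \<longleftrightarrow> (\<exists>f. locally_const X f \<and> A = k0_class X \<alpha> f)"
  by (auto simp: k0_def cont_int_iff)

lemma k0_pos_iff: "locally_const X f \<Longrightarrow> k0_class X \<alpha> f \<in> k0_pos X \<alpha> \<longleftrightarrow> posc f"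
  unfolding k0_pos_def posc_def cont_int_iff by (auto simp: k0_class_eq)

end

lemma k0_map_of_order_hom:
  assumes X: "cantor_minimal X \<alpha>" and Y: "cantor_minimal Y \<beta>" and \<rho>: "unital_order_hom Y \<beta> X \<alpha> \<rho>"
  shows "\<exists>r. k0_map X \<alpha> Y \<beta> r"
proof -
  interpret X: cantor_minimal X \<alpha> by (rule X)
  interpret Y: cantor_minimal Y \<beta> by (rule Y)
  have hom: "\<rho> \<in> hom (k0 Y \<beta>) (k0 X \<alpha>)" and pos: "\<rho> ` k0_pos Y \<beta> \<subseteq> k0_pos X \<alpha>"
    and unit: "\<rho> (k0_unit Y \<beta>) = k0_unit X \<alpha>"
    using \<rho> by (auto simp: unital_order_hom_def)
  define r where "r = (\<lambda>g. SOME f. locally_const X f \<and> \<rho> (k0_class Y \<beta> g) = k0_class X \<alpha> f)"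
  have r: "locally_const X (r g) \<and> \<rho> (k0_class Y \<beta> g) = k0_class X \<alpha> (r g)" if g: "locally_const Y g" for g
  proof -
    have "k0_class Y \<beta> g \<in> carrier (k0 Y \<beta>)" using g Y.carrier_k0 by blast
    then have "\<rho> (k0_class Y \<beta> g) \<in> carrier (k0 X \<alpha>)" using hom by (auto simp: hom_def)
    then have "\<exists>f. locally_const X f \<and> \<rho> (k0_class Y \<beta> g) = k0_class X \<alpha> f" using X.carrier_k0 by blast
    then show ?thesis unfolding r_def by (rule someI_ex)
  qed
  have "k0_map X \<alpha> Y \<beta> r"
  proof (intro k0_map.intro X Y k0_map_axioms.intro)
    show "locally_const X (r g)" if "locally_const Y g" for g using r[OF that] by blast
    show "X.sim (r (\<lambda>y. g y + g' y)) (\<lambda>x. r g x + r g' x)" if g: "locally_const Y g" "locally_const Y g'" for g g'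
    proof -
      have gg: "locally_const Y (\<lambda>y. g y + g' y)" using locally_const_comp2[OF g] .
      have "k0_class X \<alpha> (r (\<lambda>y. g y + g' y)) = \<rho> (mult (k0 Y \<beta>) (k0_class Y \<beta> g) (k0_class Y \<beta> g'))"
        using r[OF gg] Y.k0_mult[OF g] by simp
      also have "\<dots> = mult (k0 X \<alpha>) (k0_class X \<alpha> (r g)) (k0_class X \<alpha> (r g'))"
      proof -
        have "k0_class Y \<beta> g \<in> carrier (k0 Y \<beta>)" "k0_class Y \<beta> g' \<in> carrier (k0 Y \<beta>)"
          using g Y.carrier_k0 by blast+
        then show ?thesis using hom_mult[OF hom] r[OF g(1)] r[OF g(2)] by metis
      qed
      also have "\<dots> = k0_class X \<alpha> (\<lambda>x. r g x + r g' x)" using X.k0_mult r g by simp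
      finally show ?thesis using X.k0_class_eq r[OF gg] by simp
    qed
    show "X.sim (r g) (r g')" if g: "locally_const Y g" "locally_const Y g'" "Y.sim g g'" for g g'
      using r[OF g(1)] r[OF g(2)] Y.k0_class_eq[OF g(1)] g(3) X.k0_class_eq by metis
    show "X.posc (r g)" if g: "locally_const Y g" "\<forall>y\<in>Y. 0 \<le> g y" for g
    proof -
      have "k0_class Y \<beta> g \<in> k0_pos Y \<beta>" using Y.k0_pos_iff[OF g(1)] Y.poscI g by blast
      then have "k0_class X \<alpha> (r g) \<in> k0_pos X \<alpha>" using pos r[OF g(1)] by auto
      then show ?thesis using X.k0_pos_iff r[OF g(1)] by blast
    qed
    show "X.sim (r (\<lambda>_. 1)) (\<lambda>_. 1)"
      using r[of "\<lambda>_. 1"] unit X.k0_class_eq[of "r (\<lambda>_. 1)"] unfolding k0_unit_def by (metis locally_const_const)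
  qed
  then show ?thesis by blast
qed

context k0_map begin

lemma order_hom_exists: "\<exists>\<rho>. unital_order_hom Y \<beta> X \<alpha> \<rho>"
proof -
  define \<rho> where "\<rho> = (\<lambda>A. k0_class X \<alpha> (r (SOME g. g \<in> A)))"
  have \<rho>: "\<rho> (k0_class Y \<beta> g) = k0_class X \<alpha> (r g)" if g: "locally_const Y g" for g
  proof -
    have "g \<in> k0_class Y \<beta> g" using g by (simp add: Y.mem_k0_class)
    then have "(SOME h. h \<in> k0_class Y \<beta> g) \<in> k0_class Y \<beta> g" by (rule someI[where P="\<lambda>h. h \<in> k0_class Y \<beta> g"])
    then have "locally_const Y (SOME h. h \<in> k0_class Y \<beta> g)" "Y.sim (SOME h. h \<in> k0_class Y \<beta> g) g"
      by (auto simp: Y.mem_k0_class)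
    then show ?thesis unfolding \<rho>_def using g by (subst X.k0_class_eq) (auto intro: r_lc r_sim)
  qed
  have "\<rho> \<in> hom (k0 Y \<beta>) (k0 X \<alpha>)"
    unfolding hom_def
  proof (intro CollectI conjI ballI funcsetI)
    fix A assume "A \<in> carrier (k0 Y \<beta>)"
    then show "\<rho> A \<in> carrier (k0 X \<alpha>)" using \<rho> r_lc unfolding X.carrier_k0 Y.carrier_k0 by metis
  next
    fix A B assume "A \<in> carrier (k0 Y \<beta>)" "B \<in> carrier (k0 Y \<beta>)"
    then obtain g g' where g: "locally_const Y g" "A = k0_class Y \<beta> g" "locally_const Y g'" "B = k0_class Y \<beta> g'"
      unfolding Y.carrier_k0 by blast
    have gg: "locally_const Y (\<lambda>y. g y + g' y)" using locally_const_comp2[OF g(1,3)] .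
    have "\<rho> (mult (k0 Y \<beta>) A B) = k0_class X \<alpha> (r (\<lambda>y. g y + g' y))"
      using Y.k0_mult[OF g(1,3)] g \<rho>[OF gg] by simp
    also have "\<dots> = k0_class X \<alpha> (\<lambda>x. r g x + r g' x)"
      using X.k0_class_eq[OF r_lc[OF gg]] r_add[OF g(1,3)] by blast
    also have "\<dots> = mult (k0 X \<alpha>) (\<rho> A) (\<rho> B)" using X.k0_mult r_lc g \<rho> by simp
    finally show "\<rho> (mult (k0 Y \<beta>) A B) = mult (k0 X \<alpha>) (\<rho> A) (\<rho> B)" .
  qed
  moreover have "\<rho> ` k0_pos Y \<beta> \<subseteq> k0_pos X \<alpha>"
    using \<rho> r_pos X.k0_pos_iff r_lc unfolding k0_pos_def[of Y] cont_int_iff by auto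
  moreover have "\<rho> (k0_unit Y \<beta>) = k0_unit X \<alpha>"
    unfolding k0_unit_def using \<rho>[of "\<lambda>_. 1"] X.k0_class_eq[OF r_lc, of "\<lambda>_. 1"] r_one by simp
  ultimately show ?thesis by (auto simp: unital_order_hom_def)
qed

text \<open>Each \<open>\<sigma> n\<close> respects a labelling from \<open>tiling\<close>, at a
  scale tending to 0. Once \<open>f\<close> is constant on the atoms, \<open>sim_of_lift\<close>
  puts the class of \<open>f \<circ> \<sigma> n\<close> equal to that of \<open>r f\<close>.\<close>

lemma approximate_conjugacies:
  "\<exists>\<sigma> :: nat \<Rightarrow> 'a \<Rightarrow> 'b. (\<forall>n. \<exists>\<tau>. homeomorphism X Y (\<sigma> n) \<tau>)
     \<and> uniform_limit Y (\<lambda>n y. \<sigma> n (\<alpha> (inv_into X (\<sigma> n) y))) \<beta> sequentially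
     \<and> (\<forall>f. cont_int Y f \<longrightarrow> (\<exists>c N. \<forall>n\<ge>N. k0_class X \<alpha> (f \<circ> \<sigma> n) = c))"
proof -
  define ok where "ok = (\<lambda>(e::real) P U \<kappa> \<sigma>. Y.kr P U \<and> lift_of \<kappa> P \<and> (\<forall>x\<in>X. Y.follows U (\<kappa> x) (\<kappa> (\<alpha> x)))
    \<and> (\<forall>C\<in>P. \<forall>y\<in>C. \<forall>z\<in>C. dist y z < e) \<and> (\<forall>y\<in>U. \<forall>z\<in>U. dist y z < e)
    \<and> (\<exists>\<tau>. homeomorphism X Y \<sigma> \<tau>) \<and> (\<forall>x\<in>X. \<sigma> x \<in> \<kappa> x))"
  have "\<exists>P U \<kappa> \<sigma>. ok e P U \<kappa> \<sigma>" if e: "e > 0" for e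
  proof -
    obtain y0 where y0: "y0 \<in> Y" using Y.nonempty by blast
    obtain l :: "'b \<Rightarrow> nat" where l: "locally_const Y l" "\<forall>x\<in>Y. \<forall>y\<in>Y. l x = l y \<longrightarrow> dist x y < e"
      using cantor_set_fine_partition[OF Y.cantor e] by blast
    define U where "U = {y\<in>Y. l y = l y0}"
    have "Y.is_base U" unfolding U_def using Y.is_base_level[OF l(1) y0] by blast
    then obtain P where P: "Y.kr P U" "\<forall>C\<in>P. \<forall>x\<in>C. \<forall>y\<in>C. l x = l y" using Y.kr_exists[OF _ l(1)] by blast
    obtain \<kappa> where \<kappa>: "lift_of \<kappa> P" "\<forall>x\<in>X. Y.follows U (\<kappa> x) (\<kappa> (\<alpha> x))" using tiling[OF P(1)] by blast
    obtain \<sigma> \<tau> where \<sigma>: "homeomorphism X Y \<sigma> \<tau>" "\<forall>x\<in>X. \<sigma> x \<in> \<kappa> x"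
      using homeomorphism_of_partition_map[OF X.cantor Y.cantor lift_of_partition_map[OF \<kappa>(1) Y.krD(11)[OF P(1)]]]
      by blast
    have "dist y z < e" if "C \<in> P" "y \<in> C" "z \<in> C" for C y z
    proof -
      have "y \<in> Y" "z \<in> Y" using Y.krD(4)[OF P(1) that(1)] that(2,3) by blast+
      moreover have "l y = l z" using P(2) that by blast
      ultimately show ?thesis using l(2) by blast
    qed
    moreover have "dist y z < e" if "y \<in> U" "z \<in> U" for y z using l(2) that by (auto simp: U_def)
    ultimately show ?thesis unfolding ok_def using P(1) \<kappa> \<sigma> by blast
  qed
  then have "\<forall>n::nat. \<exists>P U \<kappa> \<sigma>. ok (inverse (real (Suc n))) P U \<kappa> \<sigma>" by simp
  then obtain P U \<kappa> \<sigma> where ok: "\<And>n. ok (inverse (real (Suc n))) (P n) (U n) (\<kappa> n) (\<sigma> n)" by metis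
  have kr: "Y.kr (P n) (U n)" and lift: "lift_of (\<kappa> n) (P n)"
    and fol: "x \<in> X \<Longrightarrow> Y.follows (U n) (\<kappa> n x) (\<kappa> n (\<alpha> x))"
    and smallP: "C \<in> P n \<Longrightarrow> y \<in> C \<Longrightarrow> z \<in> C \<Longrightarrow> dist y z < inverse (real (Suc n))"
    and smallU: "y \<in> U n \<Longrightarrow> z \<in> U n \<Longrightarrow> dist y z < inverse (real (Suc n))"
    and homeo: "\<exists>\<tau>. homeomorphism X Y (\<sigma> n) \<tau>" and in\<kappa>: "x \<in> X \<Longrightarrow> \<sigma> n x \<in> \<kappa> n x" for n x C y z
    using ok[of n] unfolding ok_def by blast+
  have close: "dist (\<sigma> n (\<alpha> (inv_into X (\<sigma> n) y))) (\<beta> y) < inverse (real (Suc n))" if y: "y \<in> Y" for n y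
  proof -
    obtain \<tau> where \<tau>: "homeomorphism X Y (\<sigma> n) \<tau>" using homeo by blast
    then have im: "\<sigma> n ` X = Y" by (simp add: homeomorphism_def)
    define x where "x = inv_into X (\<sigma> n) y"
    have x: "x \<in> X" "\<sigma> n x = y" unfolding x_def using im y by (auto intro: inv_into_into f_inv_into_f)
    have yk: "y \<in> \<kappa> n x" using in\<kappa>[OF x(1)] x(2) by blast
    have ax: "\<sigma> n (\<alpha> x) \<in> \<kappa> n (\<alpha> x)" using in\<kappa> x(1) by simp
    have "\<beta> y \<in> \<beta> ` \<kappa> n x" using yk by blast
    have "dist (\<sigma> n (\<alpha> x)) (\<beta> y) < inverse (real (Suc n))"
    \<comment> \<open>At the roof both points lie in the small base, elsewhere both lie in the small
      atom that is the image of the label of \<open>x\<close>.\<close>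
    proof (cases "\<beta> ` \<kappa> n x \<subseteq> U n")
      case True
      then have "\<kappa> n (\<alpha> x) \<subseteq> U n" using fol[OF x(1), of n] by (simp add: Y.follows_def)
      then show ?thesis using smallU ax True yk by blast
    next
      case False
      then have eq: "\<kappa> n (\<alpha> x) = \<beta> ` \<kappa> n x" using fol[OF x(1), of n] by (simp add: Y.follows_def)
      have "\<kappa> n (\<alpha> x) \<in> P n" using lift[of n] x(1) by (auto simp: lift_of_def)
      then show ?thesis using smallP ax \<open>\<beta> y \<in> \<beta> ` \<kappa> n x\<close> unfolding eq by blast
    qed
    then show ?thesis by (simp add: x_def)
  qed
  show ?thesis
  proof (intro exI[of _ \<sigma>] conjI allI impI)
    show "\<exists>\<tau>. homeomorphism X Y (\<sigma> n) \<tau>" for n by (rule homeo)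
    show "uniform_limit Y (\<lambda>n y. \<sigma> n (\<alpha> (inv_into X (\<sigma> n) y))) \<beta> sequentially"
      unfolding uniform_limit_iff
    proof (intro allI impI)
      fix e :: real assume "e > 0"
      then obtain N where N: "inverse (real (Suc N)) < e" using reals_Archimedean by blast
      show "\<forall>\<^sub>F n in sequentially. \<forall>y\<in>Y. dist (\<sigma> n (\<alpha> (inv_into X (\<sigma> n) y))) (\<beta> y) < e"
        unfolding eventually_sequentially
      proof (intro exI[of _ N] allI impI ballI)
        fix n y assume n: "N \<le> n" "y \<in> Y"
        have "inverse (real (Suc n)) \<le> inverse (real (Suc N))" using n by (intro le_imp_inverse_le) auto
        then show "dist (\<sigma> n (\<alpha> (inv_into X (\<sigma> n) y))) (\<beta> y) < e" using close[OF n(2), of n] N by linarith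
      qed
    qed
    fix f assume "cont_int Y f"
    then have f: "locally_const Y f" by (simp add: cont_int_iff)
    then obtain e where e: "e > 0" "\<forall>x\<in>Y. \<forall>y\<in>Y. dist x y < e \<longrightarrow> f x = f y"
      using locally_const_small_sets[OF Y.compact_X] by blast
    obtain N where N: "inverse (real (Suc N)) < e" using reals_Archimedean[OF e(1)] by blast
    have "k0_class X \<alpha> (f \<circ> \<sigma> n) = k0_class X \<alpha> (r f)" if n: "N \<le> n" for n
    proof -
      have le: "inverse (real (Suc n)) \<le> inverse (real (Suc N))" using n by (intro le_imp_inverse_le) auto
      have const: "\<forall>C\<in>P n. \<forall>y\<in>C. \<forall>z\<in>C. f y = f z"
      proof (intro ballI)
        fix C y z assume C: "C \<in> P n" "y \<in> C" "z \<in> C"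
        then have "dist y z < e" using smallP[OF C] le N by linarith
        moreover have "y \<in> Y" "z \<in> Y" using Y.krD(4)[OF kr C(1)] C(2,3) by blast+
        ultimately show "f y = f z" using e(2) by blast
      qed
      have "X.sim (f \<circ> \<sigma> n) (r f)"
        using sim_of_lift[OF lift Y.krD(11)[OF kr] f const] in\<kappa> by blast
      moreover have "locally_const X (f \<circ> \<sigma> n)"
      proof -
        obtain \<tau> where "homeomorphism X Y (\<sigma> n) \<tau>" using homeo by blast
        then have "continuous_on X (\<sigma> n)" "\<sigma> n ` X \<subseteq> Y" by (auto simp: homeomorphism_def)
        then show ?thesis unfolding comp_def by (rule locally_const_compose[OF f])
      qed
      ultimately show ?thesis using X.k0_class_eq by blast
    qed
    then show "\<exists>c N. \<forall>n\<ge>N. k0_class X \<alpha> (f \<circ> \<sigma> n) = c" by blast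
  qed
qed

end

section \<open>Homomorphisms from conditions (3) and (4)\<close>

lemma k0_map_of_continuous_map:
  fixes X :: "'a::metric_space set" and Y :: "'b::metric_space set"
  assumes X: "cantor_minimal X \<alpha>" and Y: "cantor_minimal Y \<beta>"
    and F: "continuous_on X F" "F ` X \<subseteq> Y" and cob: "\<forall>g. cob Y \<beta> g \<longrightarrow> cob X \<alpha> (g \<circ> F)"
  shows "k0_map X \<alpha> Y \<beta> (\<lambda>g. g \<circ> F)"
proof -
  interpret X: cantor_minimal X \<alpha> by (rule X)
  interpret Y: cantor_minimal Y \<beta> by (rule Y)
  have lc: "locally_const X (g \<circ> F)" if "locally_const Y g" for g :: "'b \<Rightarrow> int"
    unfolding comp_def by (rule locally_const_compose[OF that F])
  show ?thesis
  proof (intro k0_map.intro X Y k0_map_axioms.intro)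
    \<comment> \<open>The only law that needs the hypothesis on coboundaries; the others are
      pointwise.\<close>
    show "X.sim (g \<circ> F) (g' \<circ> F)" if "Y.sim g g'" for g g'
      using that cob unfolding X.sim_def Y.sim_def by (auto simp: comp_def)
    show "X.posc (g \<circ> F)" if "locally_const Y g" "\<forall>y\<in>Y. 0 \<le> g y" for g
      using F that by (intro X.poscI lc) auto
    show "locally_const X (g \<circ> F)" if "locally_const Y g" for g :: "'b \<Rightarrow> int" by (rule lc[OF that])
  qed (auto simp: comp_def intro: X.sim_eq)
qed

text \<open>\<open>r g\<close> is a late term of the eventually constant sequence. Any one law
  involves finitely many functions, so it can be checked at a common large \<open>n\<close>.\<close>

lemma k0_map_of_approximate_conjugacies:
  fixes X :: "'a::metric_space set" and Y :: "'b::metric_space set"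
  assumes X: "cantor_minimal X \<alpha>" and Y: "cantor_minimal Y \<beta>"
    and homeo: "\<forall>n. \<exists>\<tau>. homeomorphism X Y (\<sigma> n) \<tau>"
    and lim: "uniform_limit Y (\<lambda>n y. \<sigma> n (\<alpha> (inv_into X (\<sigma> n) y))) \<beta> sequentially"
    and stab: "\<forall>f. cont_int Y f \<longrightarrow> (\<exists>c N. \<forall>n\<ge>N. k0_class X \<alpha> (f \<circ> \<sigma> n) = c)"
  shows "\<exists>r. k0_map X \<alpha> Y \<beta> r"
proof -
  interpret X: cantor_minimal X \<alpha> by (rule X)
  interpret Y: cantor_minimal Y \<beta> by (rule Y)
  have \<sigma>: "continuous_on X (\<sigma> n)" "\<sigma> n ` X = Y" "inj_on (\<sigma> n) X" for n
  proof -
    obtain \<tau> where "homeomorphism X Y (\<sigma> n) \<tau>" using homeo by blast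
    then show "continuous_on X (\<sigma> n)" "\<sigma> n ` X = Y" "inj_on (\<sigma> n) X"
      by (auto simp: homeomorphism_def intro: inj_on_inverseI)
  qed
  have lc: "locally_const X (g \<circ> \<sigma> n)" if "locally_const Y g" for g :: "'b \<Rightarrow> int" and n
    unfolding comp_def by (rule locally_const_compose[OF that \<sigma>(1)]) (simp add: \<sigma>(2))
  have "\<exists>N. locally_const Y g \<longrightarrow> (\<forall>n\<ge>N. X.sim (g \<circ> \<sigma> N) (g \<circ> \<sigma> n))" for g
  proof (cases "locally_const Y g")
    case True
    then obtain c N where N: "\<forall>n\<ge>N. k0_class X \<alpha> (g \<circ> \<sigma> n) = c" using stab by (auto simp: cont_int_iff)
    then have "k0_class X \<alpha> (g \<circ> \<sigma> N) = k0_class X \<alpha> (g \<circ> \<sigma> n)" if "n \<ge> N" for n using that by simp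
    then show ?thesis using X.k0_class_eq[OF lc[OF True]] by blast
  qed simp
  then obtain N where N: "\<And>g n. locally_const Y g \<Longrightarrow> n \<ge> N g \<Longrightarrow> X.sim (g \<circ> \<sigma> (N g)) (g \<circ> \<sigma> n)" by metis
  define r where "r = (\<lambda>g. g \<circ> \<sigma> (N g))"
  have "k0_map X \<alpha> Y \<beta> r"
  proof (intro k0_map.intro X Y k0_map_axioms.intro)
    show "locally_const X (r g)" if "locally_const Y g" for g using lc[OF that] by (simp add: r_def)
    show "X.sim (r (\<lambda>y. g y + g' y)) (\<lambda>x. r g x + r g' x)" if g: "locally_const Y g" "locally_const Y g'" for g g'
    proof -
      have gg: "locally_const Y (\<lambda>y. g y + g' y)" using locally_const_comp2[OF g] .
      define n where "n = max (N (\<lambda>y. g y + g' y)) (max (N g) (N g'))"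
      have "X.sim (r (\<lambda>y. g y + g' y)) ((\<lambda>y. g y + g' y) \<circ> \<sigma> n)"
        unfolding r_def by (rule N[OF gg]) (simp add: n_def)
      also have "(\<lambda>y. g y + g' y) \<circ> \<sigma> n = (\<lambda>x. (g \<circ> \<sigma> n) x + (g' \<circ> \<sigma> n) x)" by auto
      also have "X.sim \<dots> (\<lambda>x. r g x + r g' x)"
        unfolding r_def by (intro X.sim_add X.sim_sym[OF N[OF g(1)]] X.sim_sym[OF N[OF g(2)]]) (auto simp: n_def)
      finally show ?thesis .
    qed
    show "X.sim (r g) (r g')" if g: "locally_const Y g" "locally_const Y g'" "Y.sim g g'" for g g'
    proof -
      obtain u where u: "locally_const Y u" "\<forall>y\<in>Y. g y - g' y = u y - u (Y.T (-1) y)"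
        using g(3) by (auto simp: Y.sim_iff)
      \<comment> \<open>Once \<open>\<sigma> n (\<alpha> x)\<close> is close to
        \<open>\<beta> (\<sigma> n x)\<close> on the scale of \<open>v\<close>, the value of
        \<open>v\<close> there is \<open>u (\<sigma> n x)\<close>. So \<open>v\<close> after
        \<open>\<sigma> n\<close>, moved one step forward, is a transfer function on
        \<open>X\<close>.\<close>
      define v where "v = (\<lambda>y. u (Y.T (-1) y))"
      have lcv: "locally_const Y v" unfolding v_def by (rule Y.locally_const_T[OF u(1)])
      obtain e where e: "e > 0" "\<forall>x\<in>Y. \<forall>y\<in>Y. dist x y < e \<longrightarrow> v x = v y"
        using locally_const_small_sets[OF Y.compact_X lcv] by blast
      then obtain M where M: "\<forall>n\<ge>M. \<forall>y\<in>Y. dist (\<sigma> n (\<alpha> (inv_into X (\<sigma> n) y))) (\<beta> y) < e"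
        using lim unfolding uniform_limit_iff eventually_sequentially by meson
      define n where "n = max M (max (N g) (N g'))"
      have "(g \<circ> \<sigma> n) x - (g' \<circ> \<sigma> n) x = v (\<sigma> n (X.T 1 x)) - v (\<sigma> n (X.T 1 (X.T (-1) x)))" if x: "x \<in> X" for x
      proof -
        let ?y = "\<sigma> n x"
        have y: "?y \<in> Y" "inv_into X (\<sigma> n) ?y = x" using \<sigma> x by (auto simp: inv_into_f_f)
        have "M \<le> n" by (simp add: n_def)
        then have "dist (\<sigma> n (\<alpha> x)) (\<beta> ?y) < e" using M y by metis
        moreover have "\<sigma> n (\<alpha> x) \<in> Y" "\<beta> ?y \<in> Y" using \<sigma>(2)[of n] X.\<alpha>_in[OF x] Y.\<alpha>_in[OF y(1)] by blast+
        ultimately have "v (\<sigma> n (\<alpha> x)) = v (\<beta> ?y)" using e(2) by blast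
        also have "\<dots> = u ?y"
          unfolding v_def using Y.T_1[OF y(1)] Y.T_minus(1)[OF y(1), of 1] by simp
        finally show ?thesis
          using u(2) y(1) X.T_1[OF x] X.T_minus(2)[OF x, of 1] by (simp add: v_def)
      qed
      then have "X.sim (g \<circ> \<sigma> n) (g' \<circ> \<sigma> n)"
        using X.locally_const_T[OF lc[OF lcv, of n], of 1]
        by (intro X.simI[of "\<lambda>x. v (\<sigma> n (X.T 1 x))"]) (auto simp: comp_def)
      moreover have "X.sim (r g) (g \<circ> \<sigma> n)" "X.sim (g' \<circ> \<sigma> n) (r g')"
        unfolding r_def by (auto intro!: N X.sim_sym[OF N] g simp: n_def)
      ultimately show ?thesis using X.sim_trans by blast
    qed
    show "X.posc (r g)" if "locally_const Y g" "\<forall>y\<in>Y. 0 \<le> g y" for g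
      unfolding r_def using that \<sigma>(2) by (intro X.poscI lc) auto
    show "X.sim (r (\<lambda>_. 1)) (\<lambda>_. 1)" by (rule X.sim_eq) (simp add: r_def)
  qed
  then show ?thesis by blast
qed

section \<open>Full group elements and the transport of coboundaries\<close>

context cantor_minimal begin

lemma orbit_cocycle_eq: "x \<in> X \<Longrightarrow> g x = T n x \<Longrightarrow> orbit_cocycle X \<alpha> g x = n"
  unfolding orbit_cocycle_def by (rule the_equality) (auto dest: T_inj)

lemma full_groupD:
  assumes "\<gamma> \<in> full_group X \<alpha>"
  shows "bij_betw \<gamma> X X" "x \<in> X \<Longrightarrow> \<gamma> x = T (orbit_cocycle X \<alpha> \<gamma> x) x"
proof -
  obtain g where "homeomorphism X X \<gamma> g" using assms by (auto simp: full_group_def is_homeo_def)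
  then show "bij_betw \<gamma> X X" by (auto simp: homeomorphism_def bij_betw_def intro!: inj_on_inverseI)
  show "\<gamma> x = T (orbit_cocycle X \<alpha> \<gamma> x) x" if x: "x \<in> X"
  proof -
    obtain n where "\<gamma> x = T n x" using assms x by (auto simp: full_group_def)
    then show ?thesis using orbit_cocycle_eq[OF x] by simp
  qed
qed

end

text \<open>Subtracting its value at the discontinuity \<^term>\<open>p\<close>, one may assume that the function to be
  transported vanishes near \<^term>\<open>p\<close>, and the cocycle is locally constant on its support.\<close>

lemma cob_of_factor:
  fixes X :: "'a::metric_space set" and Y :: "'b::metric_space set"
  assumes X: "cantor_minimal X \<alpha>" and Y: "cantor_minimal Y \<beta>"
    and F: "continuous_on X F" "F ` X \<subseteq> Y" and \<gamma>: "\<gamma> \<in> full_group X \<alpha>"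
    and cont: "\<forall>x\<in>X. x \<noteq> p \<longrightarrow> continuous (at x within X) (\<lambda>y. real_of_int (orbit_cocycle X \<alpha> \<gamma> y))"
    and eq: "\<forall>x\<in>X. \<beta> (F x) = F (\<gamma> x)" and g: "cob Y \<beta> g"
  shows "cob X \<alpha> (g \<circ> F)"
proof -
  interpret X: cantor_minimal X \<alpha> by (rule X)
  interpret Y: cantor_minimal Y \<beta> by (rule Y)
  define n where "n = orbit_cocycle X \<alpha> \<gamma>"
  have bij: "bij_betw \<gamma> X X" and \<gamma>n: "\<And>x. x \<in> X \<Longrightarrow> \<gamma> x = X.T (n x) x"
    unfolding n_def using X.full_groupD[OF \<gamma>] by blast+
  obtain u where u: "locally_const Y u" "\<forall>y\<in>Y. g y = u y - u (Y.T (-1) y)"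
    using g by (auto simp: Y.cob_iff)
  define f where "f = (\<lambda>x. u (F x) - u (F p))"
  have lcf: "locally_const X f"
    unfolding f_def by (rule locally_const_comp[OF locally_const_compose[OF u(1) F], where h="\<lambda>v. v - u (F p)"])
  \<comment> \<open>Where \<open>f\<close> vanishes the exponent is irrelevant to
    \<open>sim_transport\<close>, and the value 0 makes it locally constant across
    \<open>p\<close>.\<close>
  define k where "k = (\<lambda>x. if f x = 0 then 0 else n x)"
  have "locally_const X k"
  proof (rule locally_constI)
    fix x assume x: "x \<in> X"
    have near: "\<forall>\<^sub>F y in inf (nhds x) (principal X). f y = f x" using locally_constD[OF lcf x] .
    show "\<forall>\<^sub>F y in inf (nhds x) (principal X). k y = k x"
    proof (cases "f x = 0")
      case True
      show ?thesis using near by eventually_elim (use True in \<open>simp add: k_def\<close>)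
    next
      case False
      then have "x \<noteq> p" by (auto simp: f_def)
      then have "((\<lambda>y. real_of_int (n y)) \<longlongrightarrow> real_of_int (n x)) (at x within X)"
        using cont x by (simp add: continuous_within n_def)
      then have "\<forall>\<^sub>F y in at x within X. dist (real_of_int (n y)) (real_of_int (n x)) < 1"
        by (rule tendstoD) simp
      then have "\<forall>\<^sub>F y in nhds x. y \<noteq> x \<longrightarrow> y \<in> X \<longrightarrow> dist (real_of_int (n y)) (real_of_int (n x)) < 1"
        by (simp add: eventually_at_filter)
      then have "\<forall>\<^sub>F y in nhds x. y \<in> X \<longrightarrow> n y = n x"
        by eventually_elim (auto simp: dist_real_def simp flip: of_int_diff)
      then have "\<forall>\<^sub>F y in inf (nhds x) (principal X). n y = n x" by (simp add: eventually_inf_principal)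
      then show ?thesis using near by eventually_elim (use False in \<open>simp add: k_def\<close>)
    qed
  qed
  \<comment> \<open>Since \<open>F\<close> intertwines \<gamma> with \<beta>, moving
    \<open>f\<close> by \<gamma> amounts to moving \<open>u\<close> by \<beta>. The constant
    \<open>u (F p)\<close> cancels in \<open>f - h\<close>, which is
    \<open>g \<circ> F\<close>.\<close>
  define h where "h = (\<lambda>x. f (inv_into X \<gamma> x))"
  have h: "h (\<gamma> x) = f x" if "x \<in> X" for x
    unfolding h_def using bij that by (simp add: bij_betw_inv_into_left)
  have "X.sim f h"
    using h \<gamma>n by (intro X.sim_transport(2)[OF lcf \<open>locally_const X k\<close> bij]) (auto simp: k_def)
  moreover have "(g \<circ> F) x = f x - h x" if x: "x \<in> X" for x
  proof -
    obtain z where z: "z \<in> X" "x = \<gamma> z" using bij x by (auto simp: bij_betw_def)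
    have Fz: "F z \<in> Y" "F x \<in> Y" using F(2) z x by auto
    have "Y.T (-1) (F x) = F z"
      using eq z Y.T_1[OF Fz(1)] Y.T_minus(1)[OF Fz(1), of 1] by simp
    then show ?thesis using u(2) Fz h[OF z(1)] z(2) by (simp add: f_def)
  qed
  ultimately have "X.sim (g \<circ> F) (\<lambda>_. 0)"
    using X.sim_diff[of f h h h] X.sim_trans[OF X.sim_eq[of "g \<circ> F" "\<lambda>x. f x - h x"]] by simp
  then show ?thesis by (simp add: X.sim_def comp_def)
qed

context cantor_minimal begin

section \<open>Homeomorphisms that are locally powers\<close>

text \<open>The topological full group: elements of the full group with continuous cocycle.\<close>

definition tfg :: "('a \<Rightarrow> 'a) \<Rightarrow> bool" where
  "tfg \<gamma> \<longleftrightarrow> bij_betw \<gamma> X X \<and> (\<exists>k. locally_const X k \<and> (\<forall>x\<in>X. \<gamma> x = T (k x) x))"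

context
  fixes \<gamma> assumes \<gamma>: "tfg \<gamma>"
begin

lemma tfg_bij: "bij_betw \<gamma> X X" using \<gamma> by (simp add: tfg_def)

lemma tfg_in: "x \<in> X \<Longrightarrow> \<gamma> x \<in> X" using tfg_bij by (auto simp: bij_betw_def)

lemma tfg_inv_in: "x \<in> X \<Longrightarrow> inv_into X \<gamma> x \<in> X"
  using tfg_bij by (auto simp: bij_betw_def intro: inv_into_into)

lemma tfg_inv: "x \<in> X \<Longrightarrow> \<gamma> (inv_into X \<gamma> x) = x" "x \<in> X \<Longrightarrow> inv_into X \<gamma> (\<gamma> x) = x"
  using tfg_bij by (auto simp: bij_betw_def f_inv_into_f)

lemma tfg_inv_pow_in: "x \<in> X \<Longrightarrow> (inv_into X \<gamma> ^^ n) x \<in> X"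
  by (induction n) (auto intro: tfg_inv_in)

lemma tfg_sim:
  assumes f: "locally_const X f" and g: "\<forall>x\<in>X. g (\<gamma> x) = f x"
  shows "locally_const X g" "sim f g"
proof -
  obtain k where k: "locally_const X k" "\<forall>x\<in>X. \<gamma> x = T (k x) x" using \<gamma> by (auto simp: tfg_def)
  show "locally_const X g" "sim f g"
    using sim_transport[OF f k(1) tfg_bij g] k(2) by blast+
qed

lemma tfg_image:
  assumes A: "clopen_on X A" "A \<subseteq> X"
  shows "sim (ind A) (ind (\<gamma> ` A))"
proof (rule tfg_sim(2)[OF locally_const_ind[OF A(1)]], rule ballI)
  fix x assume "x \<in> X"
  then have "\<gamma> x \<in> \<gamma> ` A \<longleftrightarrow> x \<in> A" using A(2) tfg_bij by (meson bij_betw_def inj_on_image_mem_iff)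
  then show "ind (\<gamma> ` A) (\<gamma> x) = ind A x" by simp
qed

text \<open>\<open>tfg_sim\<close> concerns integer valued functions; it is applied to the indicator
  of one value of \<open>f\<close>, whose type is arbitrary.\<close>

lemma locally_const_tfg_inv:
  assumes f: "locally_const X f"
  shows "locally_const X (\<lambda>x. f (inv_into X \<gamma> x))"
proof (rule locally_constI)
  fix z assume z: "z \<in> X"
  let ?v = "f (inv_into X \<gamma> z)"
  have lc: "locally_const X (\<lambda>x. of_bool (f x = ?v) :: int)" using locally_const_comp[OF f] .
  have "locally_const X (\<lambda>x. of_bool (f (inv_into X \<gamma> x) = ?v) :: int)"
    by (rule tfg_sim(1)[OF lc]) (auto simp: tfg_inv)
  then have "\<forall>\<^sub>F y in inf (nhds z) (principal X).
      of_bool (f (inv_into X \<gamma> y) = ?v) = (of_bool (f (inv_into X \<gamma> z) = ?v) :: int)"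
    using z by (rule locally_constD)
  then show "\<forall>\<^sub>F y in inf (nhds z) (principal X). f (inv_into X \<gamma> y) = ?v"
    by eventually_elim (simp split: if_splits)
qed

lemma locally_const_tfg_inv_pow:
  "locally_const X f \<Longrightarrow> locally_const X (\<lambda>x. f ((inv_into X \<gamma> ^^ n) x))"
proof (induction n arbitrary: f)
  case (Suc n)
  from Suc.IH[OF locally_const_tfg_inv[OF Suc.prems]] show ?case by simp
qed simp

end

lemma clopen_partitionD:
  assumes "clopen_partition P"
  shows "finite P" "\<Union>P = X" "C \<in> P \<Longrightarrow> C \<noteq> {}" "C \<in> P \<Longrightarrow> C \<subseteq> X" "C \<in> P \<Longrightarrow> clopen_on X C"
    "C \<in> P \<Longrightarrow> D \<in> P \<Longrightarrow> C \<inter> D \<noteq> {} \<Longrightarrow> C = D"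
proof -
  note c = assms[unfolded clopen_partition_def]
  show "finite P" and un: "\<Union>P = X" using c by blast+
  show "C \<in> P \<Longrightarrow> C \<noteq> {}" "C \<in> P \<Longrightarrow> clopen_on X C" using c by blast+
  show "C \<in> P \<Longrightarrow> C \<subseteq> X" using Union_upper[of C P] unfolding un .
  have "\<forall>C\<in>P. \<forall>D\<in>P. C \<inter> D \<noteq> {} \<longrightarrow> C = D" using c by blast
  then show "C \<in> P \<Longrightarrow> D \<in> P \<Longrightarrow> C \<inter> D \<noteq> {} \<Longrightarrow> C = D" by metis
qed

text \<open>An atom in the base has age 0, and any other is the image of the atom below it. So the
  level of an atom may be read off at any of its points.\<close>

lemma kr_age_const:
  assumes P: "kr P U" and C: "C \<in> P" "y \<in> C" "z \<in> C"
  shows "age U y = age U z"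
proof -
  note U = krD(7)[OF P]
  have "age U z = n" if "C \<in> P" "y \<in> C" "z \<in> C" "age U y = n" for n y z C
    using that
  proof (induction n arbitrary: y z C)
    case 0
    have yz: "y \<in> X" "z \<in> X" using krD(4)[OF P 0(1)] 0(2,3) by blast+
    then have "y \<in> U" using age_eq_0[OF U] 0 by blast
    then have "z \<in> U" using krD(8)[OF P 0(1,2)] 0(3) by blast
    then show ?case using age_eq_0[OF U yz(2)] by blast
  next
    case (Suc n)
    have yz: "y \<in> X" "z \<in> X" using krD(4)[OF P Suc.prems(1)] Suc.prems(2,3) by blast+
    have "y \<notin> U" using age_eq_0[OF U yz(1)] Suc.prems(4) by auto
    then obtain D where D: "D \<in> P" "C = \<alpha> ` D" using krD(10)[OF P Suc.prems(1)] Suc.prems(2) by blast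
    obtain y' z' where yz': "y' \<in> D" "z' \<in> D" "y = \<alpha> y'" "z = \<alpha> z'" using Suc.prems(2,3) D(2) by blast
    have X': "y' \<in> X" "z' \<in> X" using krD(4)[OF P D(1)] yz' by blast+
    have "z \<notin> U" using krD(8)[OF P Suc.prems(1,3)] \<open>y \<notin> U\<close> Suc.prems(2) by blast
    have "age U y' = n" using age_foot_succ(1)[OF U X'(1)] \<open>y \<notin> U\<close> yz'(3) Suc.prems(4) by simp
    then have "age U z' = n" using Suc.IH[OF D(1) yz'(1,2)] by blast
    then show ?case using age_foot_succ(1)[OF U X'(2)] \<open>z \<notin> U\<close> yz'(4) by simp
  qed
  then show ?thesis using C by metis
qed

end

context k0_map begin

section \<open>Refining lifts\<close>

lemma ind_T_image:
  assumes C: "clopen_on Y C" "C \<subseteq> Y"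
  shows "clopen_on Y (Y.T n ` C)" "X.sim (r (ind (Y.T n ` C))) (r (ind C))"
proof -
  have mem: "y \<in> Y.T n ` C \<longleftrightarrow> Y.T (- n) y \<in> C" if y: "y \<in> Y" for y
  proof
    assume "y \<in> Y.T n ` C"
    then obtain c where "c \<in> C" "y = Y.T n c" by blast
    then show "Y.T (- n) y \<in> C" using C(2) by (metis Y.T_minus(1) subsetD)
  next
    assume "Y.T (- n) y \<in> C"
    then show "y \<in> Y.T n ` C" using Y.T_minus(2)[OF y, of n] by (metis imageI)
  qed
  have lc: "locally_const Y (\<lambda>y. Y.T (- n) y \<in> C)" by (rule Y.locally_const_T[OF C(1)])
  show cl: "clopen_on Y (Y.T n ` C)" by (rule locally_const_cong[OF lc]) (simp add: mem)
  have "X.sim (r (ind (Y.T n ` C))) (r (\<lambda>y. ind C (Y.T (- n) y)))"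
    by (rule r_eq[OF locally_const_ind[OF cl]]) (simp add: mem)
  also have "X.sim \<dots> (r (ind C))" by (rule r_shift[OF locally_const_ind[OF C(1)]])
  finally show "X.sim (r (ind (Y.T n ` C))) (r (ind C))" .
qed

lemma ind_succ_image:
  assumes C: "clopen_on Y C" "C \<subseteq> Y"
  shows "X.sim (r (ind (\<beta> ` C))) (r (ind C))"
proof -
  have "Y.T 1 ` C = \<beta> ` C" using C(2) by (intro image_cong) (auto simp: Y.T_1)
  then show ?thesis using ind_T_image(2)[OF C, of 1] by simp
qed

text \<open>The class of \<open>D\<close> lies between zero and that of \<open>V\<close>, so a
  clopen part of \<open>A\<close> realises it, and subtraction gives the class of the rest. The last
  conclusion steers a chosen point into the part for \<open>D\<close>.\<close>

lemma split_off:
  assumes A: "clopen_on X A" "A \<subseteq> X" and V: "clopen_on Y V" "V \<subseteq> Y" and D: "clopen_on Y D" "D \<subseteq> V"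
    and AV: "X.sim (ind A) (r (ind V))" and x: "x \<in> X"
  obtains E where "clopen_on X E" "E \<subseteq> A" "X.sim (ind E) (r (ind D))" "X.sim (ind (A - E)) (r (ind (V - D)))"
    "x \<in> A \<Longrightarrow> D \<noteq> {} \<Longrightarrow> x \<in> E"
proof -
  have lD: "locally_const Y (ind D)" and lV: "locally_const Y (ind V)"
    using locally_const_ind D V by blast+
  have "X.posc (\<lambda>x. r (ind V) x - r (ind D) x)" using D by (intro r_mono lD lV) auto
  then have le: "X.posc (\<lambda>x. of_bool (x \<in> A) - r (ind D) x)"
    by (rule X.posc_sim) (intro X.sim_diff X.sim_sym[OF AV] X.sim_refl)
  have pos: "X.posc (r (ind D))" by (rule r_pos[OF lD]) simp
  obtain E where E: "clopen_on X E" "E \<subseteq> A" "X.sim (ind E) (r (ind D))"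
    "x \<in> A \<Longrightarrow> \<not> X.sim (r (ind D)) (\<lambda>_. 0) \<Longrightarrow> x \<in> E"
    by (rule X.clopen_subset_of_class[OF A r_lc[OF lD] pos le x]) blast
  have "X.sim (ind (A - E)) (\<lambda>x. ind A x - ind E x)" using E(2) by (intro X.sim_eq) auto
  also have "X.sim \<dots> (\<lambda>x. r (ind V) x - r (ind D) x)" by (intro X.sim_diff AV E)
  also have "X.sim \<dots> (r (\<lambda>y. ind V y - ind D y))" by (rule X.sim_sym[OF r_diff[OF lV lD]])
  also have "X.sim \<dots> (r (ind (V - D)))"
    using D(2) by (intro r_eq locally_const_comp2[OF lV lD]) auto
  finally have "X.sim (ind (A - E)) (r (ind (V - D)))" .
  moreover have "x \<in> E" if "x \<in> A" "D \<noteq> {}"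
  proof -
    from \<open>D \<noteq> {}\<close> obtain y where "y \<in> D" "y \<in> Y" using D(2) V(2) by blast
    then show ?thesis using E(4)[OF \<open>x \<in> A\<close>] r_ind_nonzero[OF D(1)] by blast
  qed
  ultimately show thesis by (rule that[OF E(1-3)])
qed

text \<open>Atoms are split off one by one. When none is left, the remaining set has class zero and
  is therefore empty.\<close>

lemma extend_lift:
  assumes "finite \<D>" "\<forall>D\<in>\<D>. clopen_on Y D \<and> D \<subseteq> Y" "\<forall>D\<in>\<D>. \<forall>E\<in>\<D>. D \<inter> E \<noteq> {} \<longrightarrow> D = E"
    "clopen_on X A" "A \<subseteq> X" "X.sim (ind A) (r (ind (\<Union>\<D>)))"
  shows "\<exists>\<kappa>. locally_const X \<kappa> \<and> (\<forall>x\<in>A. \<kappa> x \<in> \<D>) \<and> (\<forall>D\<in>\<D>. X.sim (ind {x\<in>A. \<kappa> x = D}) (r (ind D)))"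
  using assms
proof (induction \<D> arbitrary: A rule: finite_induct)
  case empty
  have "X.sim (ind A) (r (\<lambda>_. 0))" using empty.prems(5) by simp
  then have "X.sim (ind A) (\<lambda>_. 0)" using X.sim_trans r_zero by blast
  then have "ind A x = 0" if "x \<in> X" for x
    using X.sim_0_nonneg[OF locally_const_ind[OF empty.prems(3)] _ _ that] by simp
  then have "A = {}" using empty.prems(4) by fastforce
  then show ?case by (intro exI[of _ "\<lambda>_. {}"]) auto
next
  case (insert D \<D>)
  obtain x0 where x0: "x0 \<in> X" using X.nonempty by blast
  have D: "clopen_on Y D" "D \<subseteq> \<Union>(insert D \<D>)" using insert.prems(1) by auto
  have "locally_const Y (\<lambda>y. \<exists>D\<in>insert D \<D>. y \<in> D)"
  proof -
    have "locally_const Y (\<lambda>y. \<not> (\<forall>E\<in>insert D \<D>. \<not> (y \<in> E)))"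
      by (rule locally_const_comp[where h=Not], rule locally_const_Ball[where Q="\<lambda>_ b. \<not> b"])
        (use insert in auto)
    then show ?thesis by (rule locally_const_cong) auto
  qed
  then have V: "clopen_on Y (\<Union>(insert D \<D>))" "\<Union>(insert D \<D>) \<subseteq> Y" using insert.prems(1) by auto
  obtain E where E: "clopen_on X E" "E \<subseteq> A" "X.sim (ind E) (r (ind D))"
    "X.sim (ind (A - E)) (r (ind (\<Union>(insert D \<D>) - D)))"
    by (rule split_off[OF insert.prems(3,4) V D insert.prems(5) x0]) blast
  have "\<Union>(insert D \<D>) - D = \<Union>\<D>"
  proof -
    have "D \<inter> C = {}" if C: "C \<in> \<D>" for C using insert.prems(2) insert.hyps(2) C by (metis insertCI)
    then show ?thesis by blast
  qed
  then have AE: "X.sim (ind (A - E)) (r (ind (\<Union>\<D>)))" using E(4) by (simp only:)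
  have 1: "\<forall>D\<in>\<D>. clopen_on Y D \<and> D \<subseteq> Y" using insert.prems(1) by blast
  have 2: "\<forall>D\<in>\<D>. \<forall>E\<in>\<D>. D \<inter> E \<noteq> {} \<longrightarrow> D = E" using insert.prems(2) by blast
  have 3: "A - E \<subseteq> X" using insert.prems(4) by blast
  obtain \<kappa> where \<kappa>: "locally_const X \<kappa>" "\<forall>x\<in>A - E. \<kappa> x \<in> \<D>"
    "\<forall>C\<in>\<D>. X.sim (ind {x\<in>A - E. \<kappa> x = C}) (r (ind C))"
    using insert.IH[OF 1 2 clopen_on_Diff[OF insert.prems(3) E(1)] 3 AE] by blast
  define \<kappa>' where "\<kappa>' = (\<lambda>x. if x \<in> E then D else \<kappa> x)"
  have "locally_const X \<kappa>'" unfolding \<kappa>'_def by (rule locally_const_if[OF E(1) _ \<kappa>(1)]) simp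
  moreover have "\<forall>x\<in>A. \<kappa>' x \<in> insert D \<D>" using \<kappa>(2) by (auto simp: \<kappa>'_def)
  moreover have "X.sim (ind {x\<in>A. \<kappa>' x = C}) (r (ind C))" if C: "C \<in> insert D \<D>" for C
  proof (cases "C = D")
    case True
    have "{x\<in>A. \<kappa>' x = D} = E" using E(2) \<kappa>(2) insert.hyps(2) by (auto simp: \<kappa>'_def)
    then show ?thesis using E(3) True by simp
  next
    case False
    have "{x\<in>A. \<kappa>' x = C} = {x\<in>A - E. \<kappa> x = C}" using False by (auto simp: \<kappa>'_def)
    then show ?thesis using \<kappa>(3) C False by simp
  qed
  ultimately show ?case by blast
qed

text \<open>The atom containing \<open>y\<close> is split off first, with \<open>x\<close> steered
  into its part; \<open>extend_lift\<close> distributes the rest.\<close>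

lemma extend_lift_point:
  assumes \<D>: "finite \<D>" "\<forall>D\<in>\<D>. clopen_on Y D \<and> D \<subseteq> Y \<and> D \<noteq> {}" "\<forall>D\<in>\<D>. \<forall>E\<in>\<D>. D \<inter> E \<noteq> {} \<longrightarrow> D = E"
    and A: "clopen_on X A" "A \<subseteq> X" and V: "clopen_on Y V" "V = \<Union>\<D>" and AV: "X.sim (ind A) (r (ind V))"
    and x: "x \<in> X"
  shows "\<exists>\<kappa>. locally_const X \<kappa> \<and> (\<forall>x\<in>A. \<kappa> x \<in> \<D>) \<and> (\<forall>D\<in>\<D>. X.sim (ind {x\<in>A. \<kappa> x = D}) (r (ind D)))
    \<and> (x \<in> A \<longrightarrow> y \<in> V \<longrightarrow> y \<in> \<kappa> x)"
proof (cases "y \<in> V")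
  case False
  show ?thesis using extend_lift[OF \<D>(1) _ \<D>(3) A AV[unfolded V(2)]] \<D>(2) False by blast
next
  case True
  then obtain D where D: "D \<in> \<D>" "y \<in> D" using V(2) by blast
  have VY: "V \<subseteq> Y" and DV: "D \<subseteq> V" "clopen_on Y D" "D \<noteq> {}" using \<D>(2) V(2) D by blast+
  obtain E where E: "clopen_on X E" "E \<subseteq> A" "X.sim (ind E) (r (ind D))"
    "X.sim (ind (A - E)) (r (ind (V - D)))" "x \<in> A \<Longrightarrow> D \<noteq> {} \<Longrightarrow> x \<in> E"
    by (rule split_off[OF A V(1) VY DV(2,1) AV x]) blast
  define \<D>' where "\<D>' = \<D> - {D}"
  have "V - D = \<Union>\<D>'"
  proof -
    have "D \<inter> C = {}" if "C \<in> \<D>'" for C using \<D>(3) D(1) that by (auto simp: \<D>'_def)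
    then show ?thesis using V(2) D(1) by (auto simp: \<D>'_def)
  qed
  then have AE: "X.sim (ind (A - E)) (r (ind (\<Union>\<D>')))" using E(4) by (simp only:)
  have 0: "finite \<D>'" using \<D>(1) by (simp add: \<D>'_def)
  have 1: "\<forall>D\<in>\<D>'. clopen_on Y D \<and> D \<subseteq> Y" using \<D>(2) by (auto simp: \<D>'_def)
  have 2: "\<forall>D\<in>\<D>'. \<forall>E\<in>\<D>'. D \<inter> E \<noteq> {} \<longrightarrow> D = E" using \<D>(3) unfolding \<D>'_def by blast
  have 3: "A - E \<subseteq> X" using A(2) by blast
  obtain \<kappa> where \<kappa>: "locally_const X \<kappa>" "\<forall>x\<in>A - E. \<kappa> x \<in> \<D>'"
    "\<forall>C\<in>\<D>'. X.sim (ind {x\<in>A - E. \<kappa> x = C}) (r (ind C))"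
    using extend_lift[OF 0 1 2 clopen_on_Diff[OF A(1) E(1)] 3 AE] by blast
  define \<kappa>' where "\<kappa>' = (\<lambda>x. if x \<in> E then D else \<kappa> x)"
  have "locally_const X \<kappa>'" unfolding \<kappa>'_def by (rule locally_const_if[OF E(1) _ \<kappa>(1)]) simp
  moreover have "\<forall>x\<in>A. \<kappa>' x \<in> \<D>" using \<kappa>(2) D(1) by (auto simp: \<kappa>'_def \<D>'_def)
  moreover have "X.sim (ind {x\<in>A. \<kappa>' x = C}) (r (ind C))" if C: "C \<in> \<D>" for C
  proof (cases "C = D")
    case True
    have "{x\<in>A. \<kappa>' x = D} = E" using E(2) \<kappa>(2) by (auto simp: \<kappa>'_def \<D>'_def)
    then show ?thesis using E(3) True by simp
  next
    case False
    have "{x\<in>A. \<kappa>' x = C} = {x\<in>A - E. \<kappa> x = C}" using False by (auto simp: \<kappa>'_def)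
    then show ?thesis using \<kappa>(3) C False by (simp add: \<D>'_def)
  qed
  moreover have "y \<in> \<kappa>' x" if "x \<in> A" using E(5)[OF that DV(3)] D(2) by (simp add: \<kappa>'_def)
  ultimately show ?thesis by blast
qed

text \<open>Each fibre is refined on its own, and \<open>extend_lift_point\<close> can honour one
  point per fibre. Different labels at \<open>x1\<close> and \<open>x2\<close> put the two
  prescriptions into different fibres.\<close>

lemma refine_lift:
  assumes \<kappa>: "lift_of \<kappa> P" and P: "Y.clopen_partition P" and Q: "Y.clopen_partition Q"
    and ref: "\<forall>D\<in>Q. \<exists>C\<in>P. D \<subseteq> C" and x: "x1 \<in> X" "x2 \<in> X" and y: "y1 \<in> \<kappa> x1" "y2 \<in> \<kappa> x2" "\<kappa> x1 \<noteq> \<kappa> x2"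
  shows "\<exists>\<kappa>'. lift_of \<kappa>' Q \<and> (\<forall>x\<in>X. \<kappa>' x \<subseteq> \<kappa> x) \<and> y1 \<in> \<kappa>' x1 \<and> y2 \<in> \<kappa>' x2"
proof -
  have lc\<kappa>: "locally_const X \<kappa>" and \<kappa>P: "\<And>x. x \<in> X \<Longrightarrow> \<kappa> x \<in> P"
    and cls: "\<And>C. C \<in> P \<Longrightarrow> X.sim (ind {x\<in>X. \<kappa> x = C}) (r (ind C))"
    using \<kappa> by (auto simp: lift_of_def)
  have clP: "\<And>C. C \<in> P \<Longrightarrow> clopen_on Y C" and djP: "\<And>C D. C \<in> P \<Longrightarrow> D \<in> P \<Longrightarrow> C \<inter> D \<noteq> {} \<Longrightarrow> C = D"
    and subP: "\<And>C. C \<in> P \<Longrightarrow> C \<subseteq> Y"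
    using Y.clopen_partitionD[OF P] by metis+
  have finQ: "finite Q" and clQ: "\<And>C. C \<in> Q \<Longrightarrow> clopen_on Y C \<and> C \<subseteq> Y \<and> C \<noteq> {}"
    and djQ: "\<forall>C\<in>Q. \<forall>D\<in>Q. C \<inter> D \<noteq> {} \<longrightarrow> C = D" and covQ: "\<Union>Q = Y"
    using Y.clopen_partitionD[OF Q] by metis+
  define \<D> where "\<D> = (\<lambda>C. {D\<in>Q. D \<subseteq> C})"
  have Un: "C = \<Union>(\<D> C)" if C: "C \<in> P" for C
  proof
    show "\<Union>(\<D> C) \<subseteq> C" by (auto simp: \<D>_def)
    show "C \<subseteq> \<Union>(\<D> C)"
    proof
      fix y assume y: "y \<in> C"
      then obtain D where D: "D \<in> Q" "y \<in> D" using covQ subP[OF C] by blast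
      then obtain C' where C': "C' \<in> P" "D \<subseteq> C'" using ref by blast
      then have "C' = C" using djP[OF C'(1) C] D(2) y by blast
      then show "y \<in> \<Union>(\<D> C)" using D C' by (auto simp: \<D>_def)
    qed
  qed
  \<comment> \<open>The fibre of \<open>x1\<close> gets the prescription \<open>y1\<close> at
    \<open>x1\<close>; every other fibre nominally gets \<open>y2\<close> at \<open>x2\<close>,
    which is void unless \<open>x2\<close> belongs to it.\<close>
  define sx where "sx = (\<lambda>C. if C = \<kappa> x1 then x1 else x2)"
  define sy where "sy = (\<lambda>C. if C = \<kappa> x1 then y1 else y2)"
  define \<Phi> where "\<Phi> = (\<lambda>C \<mu>. locally_const X \<mu> \<and> (\<forall>x\<in>{x\<in>X. \<kappa> x = C}. \<mu> x \<in> \<D> C)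
      \<and> (\<forall>D\<in>\<D> C. X.sim (ind {x\<in>{x\<in>X. \<kappa> x = C}. \<mu> x = D}) (r (ind D)))
      \<and> (sx C \<in> {x\<in>X. \<kappa> x = C} \<longrightarrow> sy C \<in> C \<longrightarrow> sy C \<in> \<mu> (sx C)))"
  have "\<exists>\<mu>. C \<in> P \<longrightarrow> \<Phi> C \<mu>" for C
  proof (cases "C \<in> P")
    case True
    have "finite (\<D> C)" "\<forall>D\<in>\<D> C. clopen_on Y D \<and> D \<subseteq> Y \<and> D \<noteq> {}" "\<forall>D\<in>\<D> C. \<forall>E\<in>\<D> C. D \<inter> E \<noteq> {} \<longrightarrow> D = E"
      using finQ clQ djQ by (auto simp: \<D>_def)
    moreover have "clopen_on X {x\<in>X. \<kappa> x = C}" by (rule clopen_on_level[OF lc\<kappa>])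
    moreover have "sx C \<in> X" using x by (simp add: sx_def)
    ultimately have "\<exists>\<mu>. \<Phi> C \<mu>"
      unfolding \<Phi>_def
      by (intro extend_lift_point clP[OF True] Un[OF True] cls[OF True]) auto
    then show ?thesis by blast
  qed simp
  then obtain \<mu> where \<mu>: "\<And>C. C \<in> P \<Longrightarrow> \<Phi> C (\<mu> C)" by metis
  have lc\<mu>: "locally_const X (\<mu> C)" and \<mu>D: "\<And>x. x \<in> X \<Longrightarrow> \<kappa> x = C \<Longrightarrow> \<mu> C x \<in> \<D> C"
    and cls\<mu>: "\<And>D. D \<in> \<D> C \<Longrightarrow> X.sim (ind {x\<in>{x\<in>X. \<kappa> x = C}. \<mu> C x = D}) (r (ind D))"
    and pt\<mu>: "sx C \<in> X \<Longrightarrow> \<kappa> (sx C) = C \<Longrightarrow> sy C \<in> C \<Longrightarrow> sy C \<in> \<mu> C (sx C)" if "C \<in> P" for C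
    using \<mu>[OF that] unfolding \<Phi>_def by blast+
  define \<kappa>' where "\<kappa>' = (\<lambda>x. \<mu> (\<kappa> x) x)"
  have inD: "\<kappa>' x \<in> Q \<and> \<kappa>' x \<subseteq> \<kappa> x" if "x \<in> X" for x
    using \<mu>D[OF \<kappa>P[OF that] that refl] by (simp add: \<kappa>'_def \<D>_def)
  have "locally_const X \<kappa>'"
  proof -
    have "locally_const X (\<lambda>x. if \<kappa> x \<in> P then \<mu> (\<kappa> x) x else {})"
    proof (rule locally_const_select[OF lc\<kappa>, where g="\<lambda>C x. if C \<in> P then \<mu> C x else {}"])
      show "locally_const X (\<lambda>x. if C \<in> P then \<mu> C x else {})" for C
        using lc\<mu>[of C] by (cases "C \<in> P") auto
    qed
    then show ?thesis by (rule locally_const_cong) (simp add: \<kappa>'_def \<kappa>P)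
  qed
  moreover have "X.sim (ind {x\<in>X. \<kappa>' x = D}) (r (ind D))" if D: "D \<in> Q" for D
  proof -
    obtain C where C: "C \<in> P" "D \<subseteq> C" using ref D by blast
    have "\<kappa> x = C" if "x \<in> X" "\<kappa>' x = D" for x
      using inD[OF that(1)] that(2) C clQ[OF D] djP[OF \<kappa>P[OF that(1)] C(1)] by blast
    then have "\<kappa>' x = D \<longleftrightarrow> \<kappa> x = C \<and> \<mu> C x = D" if "x \<in> X" for x using that by (metis \<kappa>'_def)
    then have "{x\<in>X. \<kappa>' x = D} = {x\<in>{x\<in>X. \<kappa> x = C}. \<mu> C x = D}" by blast
    then show ?thesis using cls\<mu>[OF C(1), of D] D C(2) by (simp add: \<D>_def)
  qed
  ultimately have "lift_of \<kappa>' Q" using inD unfolding lift_of_def by blast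
  moreover have "y1 \<in> \<kappa>' x1" using pt\<mu>[OF \<kappa>P[OF x(1)]] x(1) y(1) by (simp add: \<kappa>'_def sx_def sy_def)
  moreover have "y2 \<in> \<kappa>' x2"
    using pt\<mu>[OF \<kappa>P[OF x(2)]] x(2) y(2) y(3)[symmetric] by (simp add: \<kappa>'_def sx_def sy_def)
  ultimately show ?thesis using inD by blast
qed

text \<open>Here the fibre over the new atom \<open>W\<close> is a set \<open>G\<close> given in
  advance; this is how \<open>step\<close> controls where in \<open>X\<close> a fibre lies.\<close>

lemma split_lift:
  assumes \<kappa>: "lift_of \<kappa> P" and P: "Y.clopen_partition P" and C: "C \<in> P"
    and W: "clopen_on Y W" "W \<subseteq> C" "W \<noteq> {}" "W \<noteq> C"
    and G: "clopen_on X G" "G \<subseteq> {x\<in>X. \<kappa> x = C}" "X.sim (ind G) (r (ind W))"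
  defines "\<kappa>' \<equiv> \<lambda>x. if \<kappa> x = C then if x \<in> G then W else C - W else \<kappa> x"
    and "P' \<equiv> {W, C - W} \<union> (P - {C})"
  shows "lift_of \<kappa>' P'" "Y.clopen_partition P'"
proof -
  have lc\<kappa>: "locally_const X \<kappa>" and \<kappa>P: "\<And>x. x \<in> X \<Longrightarrow> \<kappa> x \<in> P"
    and cls: "\<And>C. C \<in> P \<Longrightarrow> X.sim (ind {x\<in>X. \<kappa> x = C}) (r (ind C))"
    using \<kappa> by (auto simp: lift_of_def)
  have fin: "finite P" and clP: "\<And>C. C \<in> P \<Longrightarrow> clopen_on Y C" and djP: "\<And>C D. C \<in> P \<Longrightarrow> D \<in> P \<Longrightarrow> C \<inter> D \<noteq> {} \<Longrightarrow> C = D"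
    and neP: "\<And>C. C \<in> P \<Longrightarrow> C \<noteq> {}" and cov: "\<Union>P = Y"
    using Y.clopen_partitionD[OF P] by metis+
  have dC: "D \<inter> C = {}" if "D \<in> P - {C}" for D using djP[of D C] C that by blast
  have "C - W \<noteq> {}" using W by blast
  have "\<Union>P' = Y"
  proof -
    have "\<Union>P' = \<Union>P" unfolding P'_def using W(2) C by auto
    then show ?thesis using cov by simp
  qed
  moreover have "\<forall>D\<in>P'. \<forall>E\<in>P'. D \<inter> E \<noteq> {} \<longrightarrow> D = E"
    unfolding P'_def using W(2) dC djP by blast
  moreover have "\<forall>D\<in>P'. D \<noteq> {} \<and> clopen_on Y D"
    unfolding P'_def using W neP clP clopen_on_Diff[OF clP[OF C] W(1)] \<open>C - W \<noteq> {}\<close> by blast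
  moreover have "finite P'" using fin by (simp add: P'_def)
  ultimately show "Y.clopen_partition P'" unfolding Y.clopen_partition_def by blast
  have "locally_const X \<kappa>'"
    unfolding \<kappa>'_def
    by (intro locally_const_if locally_const_comp[OF lc\<kappa>, where h="\<lambda>D. D = C"] G(1) lc\<kappa> locally_const_const)
  moreover have "\<kappa>' ` X \<subseteq> P'" using \<kappa>P by (auto simp: \<kappa>'_def P'_def)
  moreover have "X.sim (ind {x\<in>X. \<kappa>' x = D}) (r (ind D))" if D: "D \<in> P'" for D
  proof -
    consider "D = W" | "D = C - W" | "D \<in> P - {C}" using D by (auto simp: P'_def)
    then show ?thesis
    proof cases
      case 1
      have "\<kappa>' x = W \<longleftrightarrow> x \<in> G" if x: "x \<in> X" for x
      proof (cases "\<kappa> x = C")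
        case True
        have "C - W \<noteq> W" using W(3) by blast
        then show ?thesis using True by (simp add: \<kappa>'_def)
      next
        case False
        then have "\<kappa> x \<noteq> W" using dC[of "\<kappa> x"] \<kappa>P[OF x] W(2,3) by blast
        then show ?thesis using False G(2) by (auto simp: \<kappa>'_def)
      qed
      then have "{x\<in>X. \<kappa>' x = D} = G" unfolding 1 using G(2) by blast
      then show ?thesis using G(3) 1 by simp
    next
      case 2
      have "\<kappa>' x = C - W \<longleftrightarrow> \<kappa> x = C \<and> x \<notin> G" if x: "x \<in> X" for x
      proof (cases "\<kappa> x = C")
        case True
        have "W \<noteq> C - W" using W(3) by blast
        then show ?thesis using True by (simp add: \<kappa>'_def)
      next
        case False
        then have "\<kappa> x \<noteq> C - W" using dC[of "\<kappa> x"] \<kappa>P[OF x] \<open>C - W \<noteq> {}\<close> by blast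
        then show ?thesis using False by (simp add: \<kappa>'_def)
      qed
      then have eq: "{x\<in>X. \<kappa>' x = D} = {x\<in>X. \<kappa> x = C} - G" unfolding 2 by blast
      have "X.sim (ind ({x\<in>X. \<kappa> x = C} - G)) (\<lambda>x. ind {x\<in>X. \<kappa> x = C} x - ind G x)"
        using G(2) by (intro X.sim_eq) auto
      also have "X.sim \<dots> (\<lambda>x. r (ind C) x - r (ind W) x)" by (intro X.sim_diff cls C G)
      also have "X.sim \<dots> (r (\<lambda>y. ind C y - ind W y))"
        by (rule X.sim_sym[OF r_diff[OF locally_const_ind[OF clP[OF C]] locally_const_ind[OF W(1)]]])
      also have "X.sim \<dots> (r (ind (C - W)))"
        by (rule r_eq[OF locally_const_comp2[OF locally_const_ind[OF clP[OF C]] locally_const_ind[OF W(1)]]])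
          (use W(2) in auto)
      finally show ?thesis unfolding eq unfolding 2 .
    next
      case 3
      then have "D \<in> P" "D \<noteq> C" by auto
      have "D \<noteq> W" "D \<noteq> C - W" using dC[OF 3] W(2,3) \<open>C - W \<noteq> {}\<close> by blast+
      then have "\<kappa>' x = D \<longleftrightarrow> \<kappa> x = D" for x using \<open>D \<noteq> C\<close> by (cases "\<kappa> x = C"; cases "x \<in> G"; simp add: \<kappa>'_def)
      then have "{x\<in>X. \<kappa>' x = D} = {x\<in>X. \<kappa> x = D}" by blast
      then show ?thesis using cls[OF \<open>D \<in> P\<close>] by simp
    qed
  qed
  ultimately show "lift_of \<kappa>' P'" by (simp add: lift_of_def)
qed

section \<open>Refining a tower structure\<close>

text \<open>The approximants: \<kappa> for the factor map and \<gamma> for the homeomorphism. On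
  labels \<gamma> acts like \<beta>, except that from the roof it may enter any atom of the
  base.\<close>

definition tower_lift :: "'b set set \<Rightarrow> 'b set \<Rightarrow> ('a \<Rightarrow> 'b set) \<Rightarrow> ('a \<Rightarrow> 'a) \<Rightarrow> bool" where
  "tower_lift P U \<kappa> \<gamma> \<longleftrightarrow> Y.kr P U \<and> lift_of \<kappa> P \<and> X.tfg \<gamma> \<and> (\<forall>x\<in>X. Y.follows U (\<kappa> x) (\<kappa> (\<gamma> x)))"

text \<open>The refined labels \<kappa>0 are used only over the base and carried up the towers along
  \<gamma>, which makes the new labels compatible with \<gamma> below the old roof. By
  \<open>kr_age_const\<close> any point of the old label gives the level.\<close>

definition push :: "'b set \<Rightarrow> ('a \<Rightarrow> 'b set) \<Rightarrow> ('a \<Rightarrow> 'a) \<Rightarrow> ('a \<Rightarrow> 'b set) \<Rightarrow> 'a \<Rightarrow> 'b set" where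
  "push U \<kappa> \<gamma> \<kappa>0 x = (let n = Y.age U (SOME y. y \<in> \<kappa> x) in Y.T (int n) ` \<kappa>0 ((inv_into X \<gamma> ^^ n) x))"

context
  fixes P U \<kappa> \<gamma> assumes td: "tower_lift P U \<kappa> \<gamma>"
begin

lemma tower_kr: "Y.kr P U" and tower_labels: "lift_of \<kappa> P" and tower_tfg: "X.tfg \<gamma>"
  and tower_follows: "x \<in> X \<Longrightarrow> Y.follows U (\<kappa> x) (\<kappa> (\<gamma> x))"
  using td by (auto simp: tower_lift_def)

lemma tower_in: "x \<in> X \<Longrightarrow> \<kappa> x \<in> P" and tower_lc: "locally_const X \<kappa>"
  using tower_labels by (auto simp: lift_of_def)

lemma tower_sub: "x \<in> X \<Longrightarrow> \<kappa> x \<subseteq> Y"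
  using Y.krD(4)[OF tower_kr tower_in] .

lemma tower_meets: "x \<in> X \<Longrightarrow> y \<in> \<kappa> x \<Longrightarrow> y \<in> U \<Longrightarrow> \<kappa> x \<subseteq> U"
  using Y.krD(8)[OF tower_kr tower_in] .

lemma tower_succ:
  assumes "x \<in> X" "\<not> \<beta> ` \<kappa> x \<subseteq> U"
  shows "\<kappa> (\<gamma> x) = \<beta> ` \<kappa> x" "\<kappa> (\<gamma> x) \<inter> U = {}"
proof -
  show eq: "\<kappa> (\<gamma> x) = \<beta> ` \<kappa> x" using tower_follows[OF assms(1)] assms(2) by (simp add: Y.follows_def)
  show "\<kappa> (\<gamma> x) \<inter> U = {}" using tower_meets[OF X.tfg_in[OF tower_tfg assms(1)]] assms(2) unfolding eq by blast
qed

lemma tower_back: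
  assumes x: "x \<in> X" "\<not> \<kappa> x \<subseteq> U"
  shows "\<kappa> x = \<beta> ` \<kappa> (inv_into X \<gamma> x)" "\<not> \<beta> ` \<kappa> (inv_into X \<gamma> x) \<subseteq> U"
proof -
  let ?z = "inv_into X \<gamma> x"
  have z: "?z \<in> X" "\<gamma> ?z = x" using X.tfg_inv_in[OF tower_tfg x(1)] X.tfg_inv(1)[OF tower_tfg x(1)] .
  show nr: "\<not> \<beta> ` \<kappa> ?z \<subseteq> U"
  proof
    assume "\<beta> ` \<kappa> ?z \<subseteq> U"
    then have "\<kappa> (\<gamma> ?z) \<subseteq> U" using tower_follows[OF z(1)] by (simp add: Y.follows_def)
    then show False using x(2) z(2) by simp
  qed
  show "\<kappa> x = \<beta> ` \<kappa> ?z" using tower_succ(1)[OF z(1) nr] z(2) by simp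
qed

text \<open>Until the foot is reached no label on the way lies in the base, so each step back is
  forced by \<open>tower_back\<close>.\<close>

lemma tower_root:
  assumes x: "x \<in> X" "y \<in> \<kappa> x" and t: "t \<le> Y.age U y"
  shows "Y.T (- int t) y \<in> \<kappa> ((inv_into X \<gamma> ^^ t) x)"
  using t
proof (induction t)
  case 0
  then show ?case using x by simp
next
  case (Suc t)
  let ?z = "(inv_into X \<gamma> ^^ t) x"
  have z: "?z \<in> X" by (rule X.tfg_inv_pow_in[OF tower_tfg x(1)])
  have yY: "y \<in> Y" using tower_sub x by blast
  have in_z: "Y.T (- int t) y \<in> \<kappa> ?z" using Suc by simp
  have "Y.T (- int t) y \<notin> U" using Suc.prems not_less_Least[of t "\<lambda>j. Y.T (- int j) y \<in> U"] by (simp add: Y.age_def)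
  then have "\<not> \<kappa> ?z \<subseteq> U" using in_z by blast
  then have "Y.T (- int t) y \<in> \<beta> ` \<kappa> (inv_into X \<gamma> ?z)" using tower_back(1)[OF z] in_z by simp
  then obtain w where w: "w \<in> \<kappa> (inv_into X \<gamma> ?z)" "Y.T (- int t) y = \<beta> w" by blast
  have wY: "w \<in> Y" using w(1) tower_sub[OF X.tfg_inv_in[OF tower_tfg z]] by blast
  have "Y.T (- int (Suc t)) y = Y.T (-1) (Y.T (- int t) y)" using Y.T_add[OF yY, of "-1" "- int t"] by simp
  also have "\<dots> = w" unfolding w(2) using Y.T_1[OF wY] Y.T_minus(1)[OF wY, of 1] by simp
  finally show ?case using w(1) by simp
qed

lemma push_at:
  assumes x: "x \<in> X" "y \<in> \<kappa> x"
  shows "push U \<kappa> \<gamma> \<kappa>0 x = Y.T (int (Y.age U y)) ` \<kappa>0 ((inv_into X \<gamma> ^^ Y.age U y) x)"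
proof -
  have "(SOME y. y \<in> \<kappa> x) \<in> \<kappa> x" using x(2) by (rule someI[where P="\<lambda>y. y \<in> \<kappa> x"])
  then have "Y.age U (SOME y. y \<in> \<kappa> x) = Y.age U y" using Y.kr_age_const[OF tower_kr tower_in[OF x(1)]] x(2) by blast
  then show ?thesis unfolding push_def Let_def by (simp only:)
qed

lemma push_base:
  assumes x: "x \<in> X" "\<kappa> x \<subseteq> U"
  shows "push U \<kappa> \<gamma> \<kappa>0 x = \<kappa>0 x"
proof -
  obtain y where y: "y \<in> \<kappa> x" using Y.krD(3)[OF tower_kr tower_in[OF x(1)]] by blast
  have "Y.age U y = 0" using Y.age_base(1)[OF Y.krD(7)[OF tower_kr]] x(2) y by blast
  then show ?thesis using push_at[OF x(1) y, of \<kappa>0] by simp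
qed

lemma push_succ:
  assumes x: "x \<in> X" "\<not> \<beta> ` \<kappa> x \<subseteq> U" and \<kappa>0: "\<And>x. x \<in> X \<Longrightarrow> \<kappa>0 x \<subseteq> Y"
  shows "push U \<kappa> \<gamma> \<kappa>0 (\<gamma> x) = \<beta> ` push U \<kappa> \<gamma> \<kappa>0 x"
proof -
  obtain y where y: "y \<in> \<kappa> x" using Y.krD(3)[OF tower_kr tower_in[OF x(1)]] by blast
  have yY: "y \<in> Y" using tower_sub[OF x(1)] y by blast
  have \<gamma>x: "\<gamma> x \<in> X" using X.tfg_in[OF tower_tfg x(1)] .
  have bet: "\<beta> y \<in> \<kappa> (\<gamma> x)" "\<beta> y \<notin> U" using tower_succ[OF x] y by blast+
  let ?n = "Y.age U y"
  have "Y.age U (\<beta> y) = Suc ?n" using Y.age_foot_succ(1)[OF Y.krD(7)[OF tower_kr] yY bet(2)] .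
  then have "push U \<kappa> \<gamma> \<kappa>0 (\<gamma> x) = Y.T (int (Suc ?n)) ` \<kappa>0 ((inv_into X \<gamma> ^^ Suc ?n) (\<gamma> x))"
    using push_at[OF \<gamma>x bet(1)] by simp
  also have "(inv_into X \<gamma> ^^ Suc ?n) (\<gamma> x) = (inv_into X \<gamma> ^^ ?n) x"
    unfolding funpow_Suc_right using X.tfg_inv(2)[OF tower_tfg x(1)] by simp
  also have "Y.T (int (Suc ?n)) ` \<kappa>0 ((inv_into X \<gamma> ^^ ?n) x) = \<beta> ` (Y.T (int ?n) ` \<kappa>0 ((inv_into X \<gamma> ^^ ?n) x))"
    using Y.image_T_succ[OF \<kappa>0[OF X.tfg_inv_pow_in[OF tower_tfg x(1)]], of "int ?n" ?n] by (simp add: add.commute)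
  also have "Y.T (int ?n) ` \<kappa>0 ((inv_into X \<gamma> ^^ ?n) x) = push U \<kappa> \<gamma> \<kappa>0 x" using push_at[OF x(1) y] by simp
  finally show ?thesis .
qed

context
  fixes P' U' \<kappa>0
  assumes kr': "Y.kr P' U'" and U'U: "U' \<subseteq> U" and ref: "\<And>D. D \<in> P' \<Longrightarrow> \<exists>C\<in>P. D \<subseteq> C"
    and lift0: "lift_of \<kappa>0 P'" and \<kappa>0\<kappa>: "\<And>x. x \<in> X \<Longrightarrow> \<kappa>0 x \<subseteq> \<kappa> x"
begin

lemma \<kappa>0_in: "x \<in> X \<Longrightarrow> \<kappa>0 x \<in> P'" and \<kappa>0_lc: "locally_const X \<kappa>0"
  and \<kappa>0_class: "D \<in> P' \<Longrightarrow> X.sim (ind {x\<in>X. \<kappa>0 x = D}) (r (ind D))"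
  using lift0 by (auto simp: lift_of_def)

lemma \<kappa>0_sub: "x \<in> X \<Longrightarrow> \<kappa>0 x \<subseteq> Y"
  using Y.krD(4)[OF kr' \<kappa>0_in] .

text \<open>Induction on the level. Above the old base the pushed label avoids \<open>U\<close>,
  hence \<open>U'\<close>, so the \<beta>-image of an atom of \<open>P'\<close> is again an atom of
  \<open>P'\<close> there.\<close>

lemma push_in:
  assumes "x \<in> X"
  shows "push U \<kappa> \<gamma> \<kappa>0 x \<in> P' \<and> push U \<kappa> \<gamma> \<kappa>0 x \<subseteq> \<kappa> x"
proof -
  have "push U \<kappa> \<gamma> \<kappa>0 x \<in> P' \<and> push U \<kappa> \<gamma> \<kappa>0 x \<subseteq> \<kappa> x" if "x \<in> X" "y \<in> \<kappa> x" "Y.age U y = n" for n x y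
    using that
  proof (induction n arbitrary: x y)
    case 0
    have "y \<in> Y" using tower_sub[OF 0(1)] 0(2) by blast
    then have "y \<in> U" using Y.age_eq_0[OF Y.krD(7)[OF tower_kr]] 0 by blast
    then have "\<kappa> x \<subseteq> U" using tower_meets 0 by blast
    then show ?case using push_base[OF 0(1)] \<kappa>0_in[OF 0(1)] \<kappa>0\<kappa>[OF 0(1)] by simp
  next
    case (Suc n)
    have yY: "y \<in> Y" using tower_sub Suc.prems by blast
    have "y \<notin> U" using Y.age_eq_0[OF Y.krD(7)[OF tower_kr] yY] Suc.prems(3) by auto
    then have nU: "\<not> \<kappa> x \<subseteq> U" using Suc.prems by blast
    let ?z = "inv_into X \<gamma> x"
    have z: "?z \<in> X" "\<gamma> ?z = x" using X.tfg_inv_in[OF tower_tfg Suc.prems(1)] X.tfg_inv(1)[OF tower_tfg Suc.prems(1)] .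
    have kx: "\<kappa> x = \<beta> ` \<kappa> ?z" and nr: "\<not> \<beta> ` \<kappa> ?z \<subseteq> U" using tower_back[OF Suc.prems(1) nU] .
    obtain w where w: "w \<in> \<kappa> ?z" "y = \<beta> w" using kx Suc.prems(2) by blast
    have "w \<in> Y" using tower_sub[OF z(1)] w by blast
    then have "Y.age U w = n"
      using Y.age_foot_succ(1)[OF Y.krD(7)[OF tower_kr], of w] \<open>y \<notin> U\<close> w(2) Suc.prems(3) by simp
    then have IH: "push U \<kappa> \<gamma> \<kappa>0 ?z \<in> P'" "push U \<kappa> \<gamma> \<kappa>0 ?z \<subseteq> \<kappa> ?z" using Suc.IH[OF z(1) w(1)] by blast+
    have px: "push U \<kappa> \<gamma> \<kappa>0 x = \<beta> ` push U \<kappa> \<gamma> \<kappa>0 ?z" using push_succ[OF z(1) nr \<kappa>0_sub] z(2) by simp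
    have sub: "push U \<kappa> \<gamma> \<kappa>0 x \<subseteq> \<kappa> x" unfolding px kx using IH(2) by blast
    have "\<kappa> x \<inter> U = {}" using tower_succ(2)[OF z(1) nr] z(2) by simp
    moreover have "push U \<kappa> \<gamma> \<kappa>0 x \<noteq> {}" unfolding px using Y.krD(3)[OF kr' IH(1)] by blast
    ultimately have "\<not> \<beta> ` push U \<kappa> \<gamma> \<kappa>0 ?z \<subseteq> U'" using sub U'U unfolding px by blast
    then have "push U \<kappa> \<gamma> \<kappa>0 x \<in> P'" using Y.krD(9)[OF kr' IH(1)] unfolding px by blast
    then show ?case using sub by blast
  qed
  moreover obtain y where "y \<in> \<kappa> x" using Y.krD(3)[OF tower_kr tower_in[OF assms]] by blast
  ultimately show ?thesis using assms by blast
qed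

lemma push_lc: "locally_const X (push U \<kappa> \<gamma> \<kappa>0)"
proof -
  have "locally_const X (\<lambda>x. Y.T (int n) ` \<kappa>0 ((inv_into X \<gamma> ^^ n) x))" for n
    by (rule locally_const_comp[OF X.locally_const_tfg_inv_pow[OF tower_tfg \<kappa>0_lc]])
  then show ?thesis
    unfolding push_def Let_def
    by (rule locally_const_select[OF locally_const_comp[OF tower_lc, where h="\<lambda>C. Y.age U (SOME y. y \<in> C)"],
        where g="\<lambda>n x. Y.T (int n) ` \<kappa>0 ((inv_into X \<gamma> ^^ n) x)"])
qed

text \<open>On the old base the fibre is that of \<kappa>0. One level up, the fibre is moved by
  \<gamma> and the atom by \<beta>, and neither move changes a class.\<close>

lemma push_class:
  assumes "D \<in> P'"
  shows "X.sim (ind {x\<in>X. push U \<kappa> \<gamma> \<kappa>0 x = D}) (r (ind D))"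
proof -
  have "X.sim (ind {x\<in>X. push U \<kappa> \<gamma> \<kappa>0 x = D}) (r (ind D))" if "D \<in> P'" "y \<in> D" "Y.age U y = n" for n D y
    using that
  proof (induction n arbitrary: D y)
    case 0
    have "y \<in> Y" using Y.krD(4)[OF kr' 0(1)] 0(2) by blast
    then have "y \<in> U" using Y.age_eq_0[OF Y.krD(7)[OF tower_kr]] 0 by blast
    have "push U \<kappa> \<gamma> \<kappa>0 x = D \<longleftrightarrow> \<kappa>0 x = D" if x: "x \<in> X" for x
    proof -
      have "\<kappa> x \<subseteq> U" if "D \<subseteq> \<kappa> x" using tower_meets[OF x] that \<open>y \<in> U\<close> 0(2) by blast
      then show ?thesis using push_base[OF x] push_in[OF x] \<kappa>0\<kappa>[OF x] by metis
    qed
    then have "{x\<in>X. push U \<kappa> \<gamma> \<kappa>0 x = D} = {x\<in>X. \<kappa>0 x = D}" by blast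
    then show ?case using \<kappa>0_class[OF 0(1)] by (simp only:)
  next
    case (Suc n)
    have yY: "y \<in> Y" using Y.krD(4)[OF kr' Suc.prems(1)] Suc.prems(2) by blast
    have "y \<notin> U" using Y.age_eq_0[OF Y.krD(7)[OF tower_kr] yY] Suc.prems(3) by auto
    then have "\<not> D \<subseteq> U'" using Suc.prems(2) U'U by blast
    then obtain E where E: "E \<in> P'" "D = \<beta> ` E" using Y.krD(10)[OF kr' Suc.prems(1)] by blast
    obtain w where w: "w \<in> E" "y = \<beta> w" using E(2) Suc.prems(2) by blast
    have EY: "E \<subseteq> Y" using Y.krD(4)[OF kr' E(1)] .
    then have "Y.age U w = n"
      using Y.age_foot_succ(1)[OF Y.krD(7)[OF tower_kr], of w] \<open>y \<notin> U\<close> w Suc.prems(3) by auto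
    then have IH: "X.sim (ind {x\<in>X. push U \<kappa> \<gamma> \<kappa>0 x = E}) (r (ind E))" using Suc.IH[OF E(1) w(1)] by blast
    have eqs: "{x\<in>X. push U \<kappa> \<gamma> \<kappa>0 x = D} = \<gamma> ` {x\<in>X. push U \<kappa> \<gamma> \<kappa>0 x = E}"
    proof (intro equalityI subsetI)
      fix x assume "x \<in> {x\<in>X. push U \<kappa> \<gamma> \<kappa>0 x = D}"
      then have x: "x \<in> X" "push U \<kappa> \<gamma> \<kappa>0 x = D" by auto
      then have "y \<in> \<kappa> x" using push_in[OF x(1)] Suc.prems(2) by blast
      then have nU: "\<not> \<kappa> x \<subseteq> U" using \<open>y \<notin> U\<close> by blast
      let ?z = "inv_into X \<gamma> x"
      have z: "?z \<in> X" "\<gamma> ?z = x" using X.tfg_inv_in[OF tower_tfg x(1)] X.tfg_inv(1)[OF tower_tfg x(1)] .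
      have "\<beta> ` push U \<kappa> \<gamma> \<kappa>0 ?z = \<beta> ` E" using push_succ[OF z(1) tower_back(2)[OF x(1) nU] \<kappa>0_sub] z(2) x(2) E(2) by simp
      moreover have "push U \<kappa> \<gamma> \<kappa>0 ?z \<subseteq> Y" using push_in[OF z(1)] tower_sub[OF z(1)] by blast
      ultimately have "push U \<kappa> \<gamma> \<kappa>0 ?z = E" using inj_on_image_eq_iff[of \<beta> Y "push U \<kappa> \<gamma> \<kappa>0 ?z" E] EY Y.bij by (simp add: bij_betw_def)
      then show "x \<in> \<gamma> ` {x\<in>X. push U \<kappa> \<gamma> \<kappa>0 x = E}" using z by (intro image_eqI[of _ _ ?z]) auto
    next
      fix x assume "x \<in> \<gamma> ` {x\<in>X. push U \<kappa> \<gamma> \<kappa>0 x = E}"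
      then obtain z where z: "z \<in> X" "push U \<kappa> \<gamma> \<kappa>0 z = E" "x = \<gamma> z" by blast
      have "w \<in> \<kappa> z" using push_in[OF z(1)] z(2) w(1) by blast
      then have "\<not> \<beta> ` \<kappa> z \<subseteq> U" using w(2) \<open>y \<notin> U\<close> by blast
      then have "push U \<kappa> \<gamma> \<kappa>0 x = D" using push_succ[OF z(1) _ \<kappa>0_sub] z E(2) by simp
      then show "x \<in> {x\<in>X. push U \<kappa> \<gamma> \<kappa>0 x = D}" using z X.tfg_in[OF tower_tfg z(1)] by simp
    qed
    have "X.sim (ind {x\<in>X. push U \<kappa> \<gamma> \<kappa>0 x = E}) (ind (\<gamma> ` {x\<in>X. push U \<kappa> \<gamma> \<kappa>0 x = E}))"
      by (rule X.tfg_image[OF tower_tfg clopen_on_level[OF push_lc]]) blast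
    then have "X.sim (ind {x\<in>X. push U \<kappa> \<gamma> \<kappa>0 x = D}) (r (ind E))"
      unfolding eqs by (rule X.sim_trans[OF X.sim_sym IH])
    also have "X.sim \<dots> (r (ind D))"
      unfolding E(2) by (rule X.sim_sym[OF ind_succ_image[OF Y.krD(5)[OF kr' E(1)] EY]])
    finally show ?case .
  qed
  moreover obtain y where "y \<in> D" using Y.krD(3)[OF kr' assms] by blast
  ultimately show ?thesis using assms by blast
qed

lemma push_lift: "lift_of (push U \<kappa> \<gamma> \<kappa>0) P'"
  using push_lc push_in push_class by (auto simp: lift_of_def)

text \<open>On the old roof, matching by \<open>lab\<close> of the source with \<open>tgt\<close> of the target is possible since
  equally labelled sets have equal classes; elsewhere \<open>\<gamma>\<close> is kept.\<close>

lemma extend_tfg: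
  "\<exists>\<gamma>'. X.tfg \<gamma>' \<and> (\<forall>x\<in>X. \<not> \<beta> ` \<kappa> x \<subseteq> U \<longrightarrow> \<gamma>' x = \<gamma> x) \<and> (\<forall>x\<in>X. Y.follows U' (push U \<kappa> \<gamma> \<kappa>0 x) (push U \<kappa> \<gamma> \<kappa>0 (\<gamma>' x)))"
proof -
  note part' = Y.krD(11)[OF kr'] and U' = Y.krD(7)[OF kr']
  \<comment> \<open>All admissible targets inside \<open>U'\<close> are merged into one label, since
    from the new roof any atom of the new base will do. The other labels are atoms of
    \<open>P'\<close> inside \<open>U\<close> but not inside \<open>U'\<close>, and there the target
    is forced.\<close>
  define lab where "lab = (\<lambda>x. if \<beta> ` push U \<kappa> \<gamma> \<kappa>0 x \<subseteq> U' then U' else \<beta> ` push U \<kappa> \<gamma> \<kappa>0 x)"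
  define tgt where "tgt = (\<lambda>x. if push U \<kappa> \<gamma> \<kappa>0 x \<subseteq> U' then U' else push U \<kappa> \<gamma> \<kappa>0 x)"
  define A where "A = (\<lambda>l. {x\<in>X. \<beta> ` \<kappa> x \<subseteq> U \<and> lab x = l})"
  define C where "C = (\<lambda>l. {x\<in>X. \<kappa> x \<subseteq> U \<and> tgt x = l})"
  have lc2: "locally_const X (\<lambda>x. (\<kappa> x, push U \<kappa> \<gamma> \<kappa>0 x))" using locally_const_comp2[OF tower_lc push_lc] .
  have clA: "clopen_on X (A l)" for l
    unfolding A_def lab_def using clopen_on_level[OF lc2, of "\<lambda>(a, b). \<beta> ` a \<subseteq> U \<and> (if \<beta> ` b \<subseteq> U' then U' else \<beta> ` b) = l"] by simp
  have clC: "clopen_on X (C l)" for l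
    unfolding C_def tgt_def using clopen_on_level[OF lc2, of "\<lambda>(a, b). a \<subseteq> U \<and> (if b \<subseteq> U' then U' else b) = l"] by simp
  have push_ne: "push U \<kappa> \<gamma> \<kappa>0 x \<noteq> {}" if "x \<in> X" for x using Y.krD(3)[OF kr'] push_in[OF that] by blast
  have push_sub: "push U \<kappa> \<gamma> \<kappa>0 x \<subseteq> Y" if "x \<in> X" for x using push_in[OF that] tower_sub[OF that] by blast
  have roofD: "\<beta> ` \<kappa> x \<subseteq> U" if "x \<in> X" "y \<in> push U \<kappa> \<gamma> \<kappa>0 x" "\<beta> y \<in> U" for x y
    using tower_succ(2)[OF that(1)] tower_succ(1)[OF that(1)] push_in[OF that(1)] that(2,3) by blast
  have baseD: "\<kappa> x \<subseteq> U" if "x \<in> X" "y \<in> push U \<kappa> \<gamma> \<kappa>0 x" "y \<in> U" for x y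
    using tower_meets[OF that(1)] push_in[OF that(1)] that(2,3) by blast
  \<comment> \<open>With a selector \<open>s\<close> from the new labels, one set is where
    \<open>s\<close> lies in \<open>U'\<close>, the other where its \<beta>-image does.
    \<open>sim_of_lift\<close> identifies their classes with those of \<open>U'\<close> and of its
    preimage.\<close>
  have simU': "X.sim (ind (A U')) (ind (C U'))"
  proof -
    have lcU: "locally_const Y (ind U')" using locally_const_ind[OF Y.base_clopen[OF U']] .
    have "\<forall>x\<in>X. \<exists>y. y \<in> push U \<kappa> \<gamma> \<kappa>0 x" using push_ne by blast
    then obtain s where s: "\<forall>x\<in>X. s x \<in> push U \<kappa> \<gamma> \<kappa>0 x" by metis
    have "C U' = {x\<in>X. s x \<in> U'}"
    proof (intro equalityI subsetI)
      fix x assume "x \<in> C U'"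
      then have x: "x \<in> X" "tgt x = U'" by (auto simp: C_def)
      then have "push U \<kappa> \<gamma> \<kappa>0 x \<subseteq> U'" by (auto simp: tgt_def split: if_splits)
      then show "x \<in> {x\<in>X. s x \<in> U'}" using s x(1) by blast
    next
      fix x assume "x \<in> {x\<in>X. s x \<in> U'}"
      then have x: "x \<in> X" "s x \<in> U'" "s x \<in> push U \<kappa> \<gamma> \<kappa>0 x" using s by auto
      then have "push U \<kappa> \<gamma> \<kappa>0 x \<subseteq> U'" using Y.krD(8)[OF kr'] push_in[OF x(1)] by blast
      moreover have "\<kappa> x \<subseteq> U" using baseD[OF x(1,3)] x(2) U'U by blast
      ultimately show "x \<in> C U'" using x(1) by (simp add: C_def tgt_def)
    qed
    then have "X.sim (ind (C U')) (ind U' \<circ> s)" by (intro X.sim_eq) simp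
    also have "X.sim \<dots> (r (ind U'))"
    proof (rule sim_of_lift[OF push_lift part' lcU _ s], intro ballI)
      fix D y z assume D: "D \<in> P'" "y \<in> D" "z \<in> D"
      have "y \<in> U' \<longleftrightarrow> z \<in> U'" using Y.krD(8)[OF kr' D(1,2)] Y.krD(8)[OF kr' D(1,3)] D(2,3) by blast
      then show "ind U' y = ind U' z" by simp
    qed
    finally have 1: "X.sim (ind (C U')) (r (ind U'))" .
    have lcU1: "locally_const Y (\<lambda>y. ind U' (Y.T 1 y))" by (rule Y.locally_const_T[OF lcU])
    have roof': "\<beta> ` D \<subseteq> U'" if "D \<in> P'" "y \<in> D" "\<beta> y \<in> U'" for D y
      using Y.krD(9)[OF kr' that(1)] Y.krD(8)[OF kr', of "\<beta> ` D" "\<beta> y"] that by blast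
    have "A U' = {x\<in>X. \<beta> (s x) \<in> U'}"
    proof (intro equalityI subsetI)
      fix x assume "x \<in> A U'"
      then have x: "x \<in> X" "lab x = U'" by (auto simp: A_def)
      then have "\<beta> ` push U \<kappa> \<gamma> \<kappa>0 x \<subseteq> U'" by (auto simp: lab_def split: if_splits)
      then show "x \<in> {x\<in>X. \<beta> (s x) \<in> U'}" using s x(1) by blast
    next
      fix x assume "x \<in> {x\<in>X. \<beta> (s x) \<in> U'}"
      then have x: "x \<in> X" "\<beta> (s x) \<in> U'" "s x \<in> push U \<kappa> \<gamma> \<kappa>0 x" using s by auto
      then have "\<beta> ` push U \<kappa> \<gamma> \<kappa>0 x \<subseteq> U'" using roof'[of "push U \<kappa> \<gamma> \<kappa>0 x"] push_in[OF x(1)] by blast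
      moreover have "\<beta> ` \<kappa> x \<subseteq> U" using roofD[OF x(1,3)] x(2) U'U by blast
      ultimately show "x \<in> A U'" using x(1) by (simp add: A_def lab_def)
    qed
    moreover have "Y.T 1 (s x) = \<beta> (s x)" if "x \<in> X" for x
      using Y.T_1 push_sub[OF that] s that by blast
    ultimately have "X.sim (ind (A U')) ((\<lambda>y. ind U' (Y.T 1 y)) \<circ> s)" by (intro X.sim_eq) simp
    also have "X.sim \<dots> (r (\<lambda>y. ind U' (Y.T 1 y)))"
    proof (rule sim_of_lift[OF push_lift part' lcU1 _ s], intro ballI)
      fix D y z assume D: "D \<in> P'" "y \<in> D" "z \<in> D"
      then have "y \<in> Y" "z \<in> Y" using Y.krD(4)[OF kr' D(1)] by blast+
      moreover have "\<beta> y \<in> U' \<longleftrightarrow> \<beta> z \<in> U'" using roof'[OF D(1)] D(2,3) by blast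
      ultimately show "ind U' (Y.T 1 y) = ind U' (Y.T 1 z)" by (simp add: Y.T_1)
    qed
    also have "X.sim \<dots> (r (ind U'))" by (rule r_shift[OF lcU])
    finally show ?thesis using 1 X.sim_sym X.sim_trans by blast
  qed
  have sim_lab: "X.sim (ind (A l)) (ind (C l))" for l
  proof (cases "l = U'")
    case True
    then show ?thesis using simU' by simp
  next
    case False
    note lU = False
    show ?thesis
    \<comment> \<open>A label of any other kind is never taken, so both sets are empty.\<close>
    proof (cases "l \<in> P' \<and> l \<subseteq> U \<and> \<not> l \<subseteq> U'")
      case True
      then have l: "l \<in> P'" "l \<subseteq> U" "\<not> l \<subseteq> U'" by auto
      then obtain E where E: "E \<in> P'" "l = \<beta> ` E" using Y.krD(10)[OF kr' l(1)] by blast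
      have EY: "E \<subseteq> Y" using Y.krD(4)[OF kr' E(1)] .
      have lne: "l \<noteq> {}" "E \<noteq> {}" using Y.krD(3)[OF kr'] l(1) E(1) by blast+
      have "A l = {x\<in>X. push U \<kappa> \<gamma> \<kappa>0 x = E}"
      proof (intro equalityI subsetI)
        fix x assume "x \<in> A l"
        then have x: "x \<in> X" "lab x = l" by (auto simp: A_def)
        then have "\<beta> ` push U \<kappa> \<gamma> \<kappa>0 x = \<beta> ` E" using lU E(2) by (auto simp: lab_def split: if_splits)
        then have "push U \<kappa> \<gamma> \<kappa>0 x = E"
          using inj_on_image_eq_iff[of \<beta> Y "push U \<kappa> \<gamma> \<kappa>0 x" E] push_sub[OF x(1)] EY Y.bij by (simp add: bij_betw_def)
        then show "x \<in> {x\<in>X. push U \<kappa> \<gamma> \<kappa>0 x = E}" using x(1) by simp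
      next
        fix x assume "x \<in> {x\<in>X. push U \<kappa> \<gamma> \<kappa>0 x = E}"
        then have x: "x \<in> X" "push U \<kappa> \<gamma> \<kappa>0 x = E" by auto
        obtain e where "e \<in> E" using lne(2) by blast
        then have "\<beta> ` \<kappa> x \<subseteq> U" using roofD[OF x(1), of e] x(2) l(2) E(2) by blast
        moreover have "lab x = l" unfolding lab_def x(2) using E(2) l(3) by simp
        ultimately show "x \<in> A l" using x(1) by (simp add: A_def)
      qed
      moreover have "C l = {x\<in>X. push U \<kappa> \<gamma> \<kappa>0 x = l}"
      proof (intro equalityI subsetI)
        fix x assume "x \<in> C l"
        then have x: "x \<in> X" "tgt x = l" by (auto simp: C_def)
        then have "push U \<kappa> \<gamma> \<kappa>0 x = l" using lU by (auto simp: tgt_def split: if_splits)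
        then show "x \<in> {x\<in>X. push U \<kappa> \<gamma> \<kappa>0 x = l}" using x(1) by simp
      next
        fix x assume "x \<in> {x\<in>X. push U \<kappa> \<gamma> \<kappa>0 x = l}"
        then have x: "x \<in> X" "push U \<kappa> \<gamma> \<kappa>0 x = l" by auto
        obtain e where "e \<in> l" using lne(1) by blast
        then have "\<kappa> x \<subseteq> U" using baseD[OF x(1), of e] x(2) l(2) by blast
        moreover have "tgt x = l" unfolding tgt_def x(2) using l(3) by simp
        ultimately show "x \<in> C l" using x(1) by (simp add: C_def)
      qed
      moreover have "X.sim (ind {x\<in>X. push U \<kappa> \<gamma> \<kappa>0 x = E}) (r (ind E))" "X.sim (ind {x\<in>X. push U \<kappa> \<gamma> \<kappa>0 x = l}) (r (ind l))"
        using push_class E(1) l(1) by blast+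
      moreover have "X.sim (r (ind l)) (r (ind E))"
        unfolding E(2) by (rule ind_succ_image[OF Y.krD(5)[OF kr' E(1)] EY])
      ultimately show ?thesis using X.sim_trans X.sim_sym by metis
    next
      case False
      have "x \<notin> A l" for x
      proof
        assume "x \<in> A l"
        then have x: "x \<in> X" "\<beta> ` \<kappa> x \<subseteq> U" "lab x = l" by (auto simp: A_def)
        then have l: "\<not> \<beta> ` push U \<kappa> \<gamma> \<kappa>0 x \<subseteq> U'" "l = \<beta> ` push U \<kappa> \<gamma> \<kappa>0 x" using lU by (auto simp: lab_def split: if_splits)
        then have "l \<in> P'" using Y.krD(9)[OF kr'] push_in[OF x(1)] by blast
        moreover have "l \<subseteq> U" using l(2) push_in[OF x(1)] x(2) by blast
        ultimately show False using False l by blast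
      qed
      moreover have "x \<notin> C l" for x
      proof
        assume "x \<in> C l"
        then have x: "x \<in> X" "\<kappa> x \<subseteq> U" "tgt x = l" by (auto simp: C_def)
        then have l: "\<not> push U \<kappa> \<gamma> \<kappa>0 x \<subseteq> U'" "l = push U \<kappa> \<gamma> \<kappa>0 x" using lU by (auto simp: tgt_def split: if_splits)
        then show False using False push_in[OF x(1)] x(2) by blast
      qed
      ultimately show ?thesis by (intro X.sim_eq) simp
    qed
  qed
  have "\<exists>k. locally_const X k \<and> bij_betw (\<lambda>x. X.T (k x) x) (A l) (C l)" for l
    by (rule X.bij_of_equal_classes[OF clA _ clC _ sim_lab, of l]) (auto simp: A_def C_def)
  then obtain k where k: "\<And>l. locally_const X (k l)" "\<And>l. bij_betw (\<lambda>x. X.T (k l x) x) (A l) (C l)" by metis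
  obtain k\<gamma> where k\<gamma>: "locally_const X k\<gamma>" "\<forall>x\<in>X. \<gamma> x = X.T (k\<gamma> x) x" using tower_tfg by (auto simp: X.tfg_def)
  define m where "m = (\<lambda>x. if \<beta> ` \<kappa> x \<subseteq> U then k (lab x) x else k\<gamma> x)"
  define \<gamma>' where "\<gamma>' = (\<lambda>x. X.T (m x) x)"
  have lcm: "locally_const X m"
    unfolding m_def
  proof (rule locally_const_if[OF locally_const_comp[OF tower_lc] _ k\<gamma>(1)])
    have "locally_const X lab" unfolding lab_def
      by (rule locally_const_comp[OF push_lc, where h="\<lambda>D. if \<beta> ` D \<subseteq> U' then U' else \<beta> ` D"])
    then show "locally_const X (\<lambda>x. k (lab x) x)" by (rule locally_const_select) (rule k(1))
  qed
  have roof: "\<gamma>' x \<in> C (lab x)" if "x \<in> X" "\<beta> ` \<kappa> x \<subseteq> U" for x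
  proof -
    have "x \<in> A (lab x)" using that by (simp add: A_def)
    then have "X.T (k (lab x) x) x \<in> C (lab x)" using k(2)[of "lab x"] by (meson bij_betwE)
    then show ?thesis using that by (simp add: \<gamma>'_def m_def)
  qed
  have nonroof: "\<gamma>' x = \<gamma> x" if "x \<in> X" "\<not> \<beta> ` \<kappa> x \<subseteq> U" for x
    using that k\<gamma>(2) by (simp add: \<gamma>'_def m_def)
  have "bij_betw \<gamma>' X X"
  proof (rule bij_betwI')
    fix x z assume xz: "x \<in> X" "z \<in> X"
    \<comment> \<open>Images of the old roof are labelled inside \<open>U\<close>, all other images
      outside, so the two halves of the new map do not collide.\<close>
    have mixed: False if "u \<in> X" "v \<in> X" "\<beta> ` \<kappa> u \<subseteq> U" "\<not> \<beta> ` \<kappa> v \<subseteq> U" "\<gamma>' u = \<gamma>' v" for u v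
    proof -
      have "\<kappa> (\<gamma>' u) \<subseteq> U" using roof[OF that(1,3)] by (simp add: C_def)
      moreover have "\<kappa> (\<gamma>' v) \<inter> U = {}" using tower_succ(2)[OF that(2,4)] nonroof[OF that(2,4)] by simp
      moreover have "\<kappa> (\<gamma>' v) \<noteq> {}" using Y.krD(3)[OF tower_kr tower_in] X.tfg_in[OF tower_tfg that(2)] nonroof[OF that(2,4)] by simp
      ultimately show False using that(5) by auto
    qed
    have "x = z" if eq: "\<gamma>' x = \<gamma>' z"
    proof (cases "\<beta> ` \<kappa> x \<subseteq> U")
      case True
      have zr: "\<beta> ` \<kappa> z \<subseteq> U" using mixed[OF xz True _ eq] by blast
      have "tgt (\<gamma>' x) = lab x" "tgt (\<gamma>' z) = lab z" using roof xz True zr by (auto simp: C_def)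
      then have same: "lab x = lab z" using eq by simp
      have "x \<in> A (lab x)" "z \<in> A (lab x)" using xz True zr same by (auto simp: A_def)
      moreover have "X.T (k (lab x) x) x = X.T (k (lab x) z) z"
        using eq True zr same by (simp add: \<gamma>'_def m_def)
      ultimately show ?thesis using k(2)[of "lab x"] unfolding bij_betw_def by (metis (mono_tags, lifting) inj_onD)
    next
      case False
      have zr: "\<not> \<beta> ` \<kappa> z \<subseteq> U" using mixed[OF xz(2,1) _ False] eq by metis
      have "\<gamma> x = \<gamma> z" using nonroof[OF xz(1) False] nonroof[OF xz(2) zr] eq by simp
      then show ?thesis using X.tfg_bij[OF tower_tfg] xz by (meson bij_betw_def inj_onD)
    qed
    then show "(\<gamma>' x = \<gamma>' z) = (x = z)" by blast
  next
    fix x assume "x \<in> X" then show "\<gamma>' x \<in> X" by (simp add: \<gamma>'_def)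
  next
    fix w assume w: "w \<in> X"
    show "\<exists>x\<in>X. w = \<gamma>' x"
    proof (cases "\<kappa> w \<subseteq> U")
      case True
      then have "w \<in> C (tgt w)" using w by (simp add: C_def)
      then obtain x where x: "x \<in> A (tgt w)" "w = X.T (k (tgt w) x) x"
        using k(2)[of "tgt w"] unfolding bij_betw_def by blast
      then have "x \<in> X" "\<beta> ` \<kappa> x \<subseteq> U" "lab x = tgt w" by (auto simp: A_def)
      then show ?thesis using x(2) by (intro bexI[of _ x]) (simp_all add: \<gamma>'_def m_def)
    next
      case False
      let ?z = "inv_into X \<gamma> w"
      have "?z \<in> X" "\<gamma> ?z = w" using X.tfg_inv_in[OF tower_tfg w] X.tfg_inv(1)[OF tower_tfg w] .
      then show ?thesis using nonroof[of ?z] tower_back(2)[OF w False] by metis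
    qed
  qed
  then have tfg': "X.tfg \<gamma>'" using lcm unfolding X.tfg_def \<gamma>'_def by blast
  moreover have "Y.follows U' (push U \<kappa> \<gamma> \<kappa>0 x) (push U \<kappa> \<gamma> \<kappa>0 (\<gamma>' x))" if x: "x \<in> X" for x
  proof (cases "\<beta> ` \<kappa> x \<subseteq> U")
    case True
    have g: "tgt (\<gamma>' x) = lab x" using roof[OF x True] by (simp add: C_def)
    show ?thesis
    proof (cases "\<beta> ` push U \<kappa> \<gamma> \<kappa>0 x \<subseteq> U'")
      case True
      then have "tgt (\<gamma>' x) = U'" using g by (simp add: lab_def)
      then have "push U \<kappa> \<gamma> \<kappa>0 (\<gamma>' x) \<subseteq> U'" by (auto simp: tgt_def split: if_splits)
      then show ?thesis using True by (simp add: Y.follows_def)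
    next
      case False
      then have e: "tgt (\<gamma>' x) = \<beta> ` push U \<kappa> \<gamma> \<kappa>0 x" using g by (simp add: lab_def)
      have "\<not> push U \<kappa> \<gamma> \<kappa>0 (\<gamma>' x) \<subseteq> U'"
      proof
        assume "push U \<kappa> \<gamma> \<kappa>0 (\<gamma>' x) \<subseteq> U'"
        then have "tgt (\<gamma>' x) = U'" by (simp add: tgt_def)
        then show False using e False by simp
      qed
      then have "push U \<kappa> \<gamma> \<kappa>0 (\<gamma>' x) = \<beta> ` push U \<kappa> \<gamma> \<kappa>0 x" using e by (simp add: tgt_def)
      then show ?thesis using False by (simp add: Y.follows_def)
    qed
  next
    case False
    then have "push U \<kappa> \<gamma> \<kappa>0 (\<gamma>' x) = \<beta> ` push U \<kappa> \<gamma> \<kappa>0 x" using push_succ[OF x False \<kappa>0_sub] nonroof[OF x False] by simp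
    then show ?thesis by (simp add: Y.follows_def)
  qed
  ultimately show ?thesis using nonroof by blast
qed

end

end

end

lemma (in cantor_minimal) locally_const_tfg:
  assumes "tfg \<gamma>" "locally_const X f"
  shows "locally_const X (\<lambda>x. f (\<gamma> x))"
proof -
  obtain k where k: "locally_const X k" "\<forall>x\<in>X. \<gamma> x = T (k x) x" using assms(1) by (auto simp: tfg_def)
  show ?thesis by (rule locally_const_cong[OF locally_const_T_select[OF k(1) assms(2)]]) (simp add: k(2))
qed

lemma (in cantor_minimal) tfg_pow_in: "tfg \<gamma> \<Longrightarrow> x \<in> X \<Longrightarrow> (\<gamma> ^^ n) x \<in> X"
  by (induction n) (auto intro: tfg_in)

lemma (in cantor_minimal) locally_const_tfg_pow:
  "tfg \<gamma> \<Longrightarrow> locally_const X f \<Longrightarrow> locally_const X (\<lambda>x. f ((\<gamma> ^^ n) x))"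
proof (induction n arbitrary: f)
  case (Suc n)
  from Suc.IH[OF Suc.prems(1) locally_const_tfg[OF Suc.prems]] show ?case by simp
qed simp

lemma (in cantor_minimal) tfg_pow_inv:
  assumes "tfg \<gamma>" "x \<in> X"
  shows "(\<gamma> ^^ n) ((inv_into X \<gamma> ^^ n) x) = x"
proof (induction n)
  case (Suc n)
  have "(\<gamma> ^^ Suc n) ((inv_into X \<gamma> ^^ Suc n) x) = (\<gamma> ^^ n) (\<gamma> (inv_into X \<gamma> ((inv_into X \<gamma> ^^ n) x)))"
    unfolding funpow_Suc_right[of n \<gamma>] by simp
  also have "\<dots> = x" using Suc tfg_inv(1)[OF assms(1) tfg_inv_pow_in[OF assms]] by simp
  finally show ?case .
qed simp

lemma (in cantor_minimal) foot_pred: "y \<in> X \<Longrightarrow> foot U (T (-1) y) = T (- int (age U (T (-1) y)) - 1) y"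
  unfolding foot_def using T_add[of y "- int (age U (T (-1) y))" "-1"] by simp

section \<open>Stages of the construction of the factor map\<close>

context k0_map begin

text \<open>In the limit \<open>q\<close> is to be mapped to \<open>y0\<close>, and \<open>p\<close>
  to its predecessor. The last condition keeps the foot below the predecessor out of the label of
  \<open>q\<close>, so that the two labels to be preserved sit over different atoms, as
  \<open>refine_lift\<close> requires.\<close>

definition stage :: "'b \<Rightarrow> 'a \<Rightarrow> 'a \<Rightarrow> 'b set set \<Rightarrow> 'b set \<Rightarrow> ('a \<Rightarrow> 'b set) \<Rightarrow> ('a \<Rightarrow> 'a) \<Rightarrow> bool" where
  "stage y0 q p P U \<kappa> \<gamma> \<longleftrightarrow> tower_lift P U \<kappa> \<gamma> \<and> q \<in> X \<and> p \<in> X \<and> y0 \<in> U \<and> y0 \<in> \<kappa> q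
     \<and> Y.T (-1) y0 \<in> \<kappa> p \<and> Y.foot U (Y.T (-1) y0) \<notin> \<kappa> q"

text \<open>Later stages change \<gamma> only at points of the roof. Hence \<gamma> is settled at a
  point as soon as that point is off the roof.\<close>

definition extends :: "'b set \<Rightarrow> ('a \<Rightarrow> 'b set) \<Rightarrow> ('a \<Rightarrow> 'a) \<Rightarrow> 'b set \<Rightarrow> ('a \<Rightarrow> 'b set) \<Rightarrow> ('a \<Rightarrow> 'a) \<Rightarrow> bool" where
  "extends U \<kappa> \<gamma> U' \<kappa>' \<gamma>' \<longleftrightarrow> U' \<subseteq> U \<and> (\<forall>x\<in>X. \<kappa>' x \<subseteq> \<kappa> x) \<and> (\<forall>x\<in>X. \<not> \<beta> ` \<kappa> x \<subseteq> U \<longrightarrow> \<gamma>' x = \<gamma> x)"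

lemma stageD:
  assumes "stage y0 q p P U \<kappa> \<gamma>"
  shows "tower_lift P U \<kappa> \<gamma>" "q \<in> X" "p \<in> X" "y0 \<in> U" "y0 \<in> \<kappa> q" "Y.T (-1) y0 \<in> \<kappa> p"
    "Y.foot U (Y.T (-1) y0) \<notin> \<kappa> q" "y0 \<in> Y" "\<kappa> q \<subseteq> U"
proof -
  show td: "tower_lift P U \<kappa> \<gamma>" and "q \<in> X" "p \<in> X" and y0: "y0 \<in> U" "y0 \<in> \<kappa> q" and "Y.T (-1) y0 \<in> \<kappa> p"
    "Y.foot U (Y.T (-1) y0) \<notin> \<kappa> q"
    using assms by (auto simp: stage_def)
  show "y0 \<in> Y" using Y.base_in[OF Y.krD(7)[OF tower_kr[OF td]] y0(1)] .
  show "\<kappa> q \<subseteq> U" using tower_meets[OF td \<open>q \<in> X\<close> y0(2,1)] .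
qed

lemma roof_meets:
  assumes td: "tower_lift P U \<kappa> \<gamma>" and x: "x \<in> X" "y \<in> \<kappa> x" "\<beta> y \<in> U"
  shows "\<beta> ` \<kappa> x \<subseteq> U"
proof (rule ccontr)
  assume nr: "\<not> \<beta> ` \<kappa> x \<subseteq> U"
  show False using tower_succ[OF td x(1) nr] x(2,3) by blast
qed

text \<open>The new base is made so small that its translate \<open>W\<close> by \<open>i\<close>
  has class below that of a part of \<open>G\<close>; a subset \<open>H\<close> of \<open>G\<close>
  of that class becomes the fibre over \<open>W\<close>. So labels meeting \<open>W\<close> are
  confined to \<open>G\<close>. \<open>Gq\<close> and \<open>Gp\<close> say that \<open>G\<close>
  contains the point with a prescribed label whenever \<open>T i y0\<close> is one of the points to
  be preserved.\<close>

lemma step: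
  fixes i :: int and e :: real
  assumes st: "stage y0 q p P U \<kappa> \<gamma>" and e: "e > 0"
    and C: "C \<in> P" "C \<subseteq> U" "Y.T i y0 \<in> C"
    and G: "clopen_on X G" "G \<subseteq> {x\<in>X. \<kappa> x = C}" "g0 \<in> G"
    and Gq: "i = 0 \<Longrightarrow> q \<in> G"
    and Gp: "Y.T i y0 = Y.foot U (Y.T (-1) y0) \<Longrightarrow> (inv_into X \<gamma> ^^ Y.age U (Y.T (-1) y0)) p \<in> G"
    and N: "clopen_on Y N" "y0 \<in> N"
  shows "\<exists>P' U' \<kappa>' \<gamma>'. stage y0 q p P' U' \<kappa>' \<gamma>' \<and> extends U \<kappa> \<gamma> U' \<kappa>' \<gamma>' \<and> U' \<subseteq> N
     \<and> (\<forall>D\<in>P'. \<forall>y\<in>D. \<forall>z\<in>D. dist y z < e) \<and> (\<forall>x\<in>X. \<forall>y\<in>U'. Y.T i y \<in> \<kappa>' x \<longrightarrow> x \<in> G)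
     \<and> (\<forall>x\<in>X. \<forall>y\<in>\<kappa>' x. Y.foot U y \<in> \<kappa>' ((inv_into X \<gamma> ^^ Y.age U y) x))"
proof -
  note td = stageD(1)[OF st] and qX = stageD(2)[OF st] and pX = stageD(3)[OF st] and y0U = stageD(4)[OF st]
    and y0q = stageD(5)[OF st] and yp = stageD(6)[OF st] and K5 = stageD(7)[OF st] and y0Y = stageD(8)[OF st]
    and qU = stageD(9)[OF st]
  note kr = tower_kr[OF td] and tfg = tower_tfg[OF td]
  note base = Y.krD(7)[OF kr] and part = Y.krD(11)[OF kr]
  define a where "a = Y.age U (Y.T (-1) y0)"
  \<comment> \<open>Labels are pushed up from the base, so the predecessor of \<open>y0\<close>
    stays in the label of \<open>p\<close> if its foot \<open>y1\<close> stays in the label of the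
    foot \<open>p1\<close> of \<open>p\<close>.\<close>
  define y1 where "y1 = Y.foot U (Y.T (-1) y0)"
  define p1 where "p1 = (inv_into X \<gamma> ^^ a) p"
  have y1U: "y1 \<in> U" unfolding y1_def using Y.foot_in[OF base] y0Y by simp
  have p1X: "p1 \<in> X" unfolding p1_def by (rule X.tfg_inv_pow_in[OF tfg pX])
  have y1p1: "y1 \<in> \<kappa> p1"
    using tower_root[OF td pX yp, of a] unfolding y1_def p1_def Y.foot_def a_def by simp
  have y1q: "y1 \<notin> \<kappa> q" using K5 by (simp add: y1_def)
  have y01: "y0 \<noteq> y1" using y1q y0q by blast
  have qp1: "q \<noteq> p1" using y1p1 y1q by blast
  define v where "v = Y.T i y0"
  have vY: "v \<in> Y" and vC: "v \<in> C" using y0Y C(3) by (auto simp: v_def)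
  have v0: "v = y0 \<Longrightarrow> i = 0" using Y.T_inj[OF y0Y, of i 0] by (simp add: v_def)
  \<comment> \<open>A second point \<open>c\<close> of \<open>C\<close>, to be kept out of
    \<open>W\<close>, makes \<open>W\<close> a proper part of \<open>C\<close>.\<close>
  have "infinite (C \<inter> Y)" using clopen_infinite[OF Y.cantor Y.krD(5)[OF kr C(1)] vC vY] .
  then have "\<exists>c. c \<in> C \<inter> Y - {v}" by (metis finite.emptyI finite_Diff2 finite_insert ex_in_conv)
  then obtain c where c: "c \<in> C" "c \<noteq> v" by blast
  define badY where "badY = {y0, y1, c} - {v}"
  have "open (- badY)" unfolding badY_def by (intro open_Compl finite_imp_closed) simp
  moreover have "v \<in> - badY" by (simp add: badY_def)
  ultimately obtain S where S: "clopen_on Y S" "v \<in> S" "S \<subseteq> Y" "S \<subseteq> - badY"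
    using cantor_set_clopen_nbhd[OF Y.cantor vY] by metis
  have g0X: "g0 \<in> X" using G by blast
  have "infinite (G \<inter> X)" using clopen_infinite[OF X.cantor G(1,3) g0X] .
  then have "infinite (G \<inter> X - {q, p1})" by simp
  then have "\<exists>g. g \<in> G \<inter> X - {q, p1}" by (metis finite.emptyI ex_in_conv)
  then obtain g where g: "g \<in> G" "g \<in> X" "g \<noteq> q" "g \<noteq> p1" by blast
  \<comment> \<open>The point of \<open>G\<close> that will lie in \<open>H\<close>: it has to be
    \<open>q\<close> or \<open>p1\<close> if \<open>W\<close> is to contain \<open>y0\<close> or
    \<open>y1\<close>, and otherwise it differs from both. The set \<open>S\<close> keeps the other
    marked points of \<open>Y\<close> out of \<open>W\<close>, and \<open>S'\<close> those of
    \<open>X\<close> out of \<open>H\<close>.\<close>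
  define x0 where "x0 = (if v = y0 then q else if v = y1 then p1 else g)"
  have x0G: "x0 \<in> G"
    using Gq v0 Gp g by (auto simp: x0_def v_def y1_def p1_def a_def)
  have x0X: "x0 \<in> X" using x0G G by blast
  have "open (- ({q, p1} - {x0}))" by (intro open_Compl finite_imp_closed) simp
  moreover have "x0 \<in> - ({q, p1} - {x0})" by simp
  ultimately obtain S' where S': "clopen_on X S'" "x0 \<in> S'" "S' \<subseteq> X" "S' \<subseteq> - ({q, p1} - {x0})"
    using cantor_set_clopen_nbhd[OF X.cantor x0X] by metis
  define G' where "G' = {x\<in>X. x \<in> G \<and> x \<in> S'}"
  have clG': "clopen_on X G'"
    by (rule locally_const_cong[OF locally_const_comp2[OF G(1) S'(1), where h="(\<and>)"]]) (auto simp: G'_def)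
  have G'G: "G' \<subseteq> G" "G' \<subseteq> X" and x0G': "x0 \<in> G'" using x0G x0X S' by (auto simp: G'_def)
  have qG': "q \<in> G' \<Longrightarrow> v = y0" using S'(4) qp1 g by (auto simp: G'_def x0_def split: if_splits)
  have p1G': "p1 \<in> G' \<Longrightarrow> v = y1" using S'(4) qp1 y01 g by (auto simp: G'_def x0_def split: if_splits)
  obtain W0 where W0: "clopen_on Y W0" "y0 \<in> W0" "W0 \<subseteq> Y"
    "\<And>U. clopen_on Y U \<Longrightarrow> U \<subseteq> W0 \<Longrightarrow> X.posc (\<lambda>x. of_bool (x \<in> G') - r (ind U) x)"
    by (rule small_class[OF clG' x0G' x0X y0Y]) blast
  \<comment> \<open>\<open>W0\<close> makes the class small enough to fit into \<open>G'\<close>;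
    the conditions at time \<open>i\<close> put the translate into \<open>C\<close> and
    \<open>S\<close>.\<close>
  define U' where "U' = {y\<in>Y. y \<in> N \<and> y \<in> U \<and> y \<in> W0 \<and> Y.T i y \<in> C \<and> Y.T i y \<in> S}"
  have "locally_const Y (\<lambda>y. y \<in> N \<and> y \<in> U \<and> y \<in> W0 \<and> Y.T i y \<in> C \<and> Y.T i y \<in> S)"
    by (intro locally_const_comp2[where h="(\<and>)"] N W0 Y.base_clopen[OF base] Y.locally_const_T Y.krD(5)[OF kr C(1)] S)
  then have clU': "clopen_on Y U'" by (rule locally_const_cong) (auto simp: U'_def)
  have y0U': "y0 \<in> U'" using y0Y N y0U W0 vC S by (simp add: U'_def v_def)
  have U'sub: "U' \<subseteq> Y" "U' \<subseteq> N" "U' \<subseteq> U" "U' \<subseteq> W0" by (auto simp: U'_def)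
  have base': "Y.is_base U'" using clU' y0U' U'sub by (auto simp: Y.is_base_def)
  define W where "W = Y.T i ` U'"
  have clW: "clopen_on Y W" and simW: "X.sim (r (ind W)) (r (ind U'))"
    unfolding W_def using ind_T_image[OF clU' U'sub(1)] .
  have WC: "W \<subseteq> C" "W \<subseteq> S" by (auto simp: W_def U'_def)
  have vW: "v \<in> W" using y0U' by (auto simp: W_def v_def)
  have cW: "c \<notin> W" using S(4) WC(2) c(2) by (auto simp: badY_def)
  have WY: "W \<subseteq> Y" using WC S by blast
  have le: "X.posc (\<lambda>x. of_bool (x \<in> G') - r (ind W) x)"
    by (rule X.posc_sim[OF W0(4)[OF clU' U'sub(4)]]) (intro X.sim_diff X.sim_refl X.sim_sym[OF simW])
  have lW: "locally_const Y (ind W)" by (rule locally_const_ind[OF clW])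
  have posW: "X.posc (r (ind W))" by (rule r_pos[OF lW]) simp
  obtain H where H: "clopen_on X H" "H \<subseteq> G'" "X.sim (ind H) (r (ind W))"
    "x0 \<in> G' \<Longrightarrow> \<not> X.sim (r (ind W)) (\<lambda>_. 0) \<Longrightarrow> x0 \<in> H"
    by (rule X.clopen_subset_of_class[OF clG' G'G(2) r_lc[OF lW] posW le x0X]) blast
  have x0H: "x0 \<in> H" using H(4) x0G' r_ind_nonzero[OF clW vW vY] by blast
  define \<kappa>1 where "\<kappa>1 = (\<lambda>x. if \<kappa> x = C then if x \<in> H then W else C - W else \<kappa> x)"
  define P1 where "P1 = {W, C - W} \<union> (P - {C})"
  have WneC: "W \<noteq> C" "W \<noteq> {}" using cW c(1) vW by blast+
  have HC: "H \<subseteq> {x\<in>X. \<kappa> x = C}" using H(2) G'G G(2) by blast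
  have lift1: "lift_of \<kappa>1 P1" and part1: "Y.clopen_partition P1"
    unfolding \<kappa>1_def P1_def
    using split_lift[OF tower_labels[OF td] part C(1) clW WC(1) WneC(2,1) H(1) HC H(3)] .
  have \<kappa>1\<kappa>: "\<kappa>1 x \<subseteq> \<kappa> x" for x using WC(1) by (auto simp: \<kappa>1_def)
  have y0q1: "y0 \<in> \<kappa>1 q"
  proof (cases "\<kappa> q = C")
    case True
    show ?thesis
    proof (cases "v = y0")
      case True
      then have "q \<in> H" using x0H by (simp add: x0_def)
      then show ?thesis using \<open>\<kappa> q = C\<close> vW True by (simp add: \<kappa>1_def)
    next
      case False
      then have "q \<notin> H" using qG' H(2) by blast
      moreover have "y0 \<notin> W" using WC(2) S(4) False by (auto simp: badY_def)
      ultimately show ?thesis using \<open>\<kappa> q = C\<close> y0q by (simp add: \<kappa>1_def)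
    qed
  next
    case False
    then show ?thesis using y0q by (simp add: \<kappa>1_def)
  qed
  have y1p11: "y1 \<in> \<kappa>1 p1"
  proof (cases "\<kappa> p1 = C")
    case True
    show ?thesis
    proof (cases "v = y1")
      case True
      then have "p1 \<in> H" using x0H y01 by (simp add: x0_def)
      then show ?thesis using \<open>\<kappa> p1 = C\<close> vW True by (simp add: \<kappa>1_def)
    next
      case False
      then have "p1 \<notin> H" using p1G' H(2) by blast
      moreover have "y1 \<notin> W" using WC(2) S(4) False by (auto simp: badY_def)
      ultimately show ?thesis using \<open>\<kappa> p1 = C\<close> y1p1 by (simp add: \<kappa>1_def)
    qed
  next
    case False
    then show ?thesis using y1p1 by (simp add: \<kappa>1_def)
  qed
  have ne1: "\<kappa>1 q \<noteq> \<kappa>1 p1" using y1p11 \<kappa>1\<kappa>[of q] y1q by blast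
  \<comment> \<open>The foot of the predecessor for the new base. It lies strictly before
    \<open>y0\<close> on its orbit, so a clopen set \<open>S2\<close> separates the two, which
    renews the last condition of \<open>stage\<close>.\<close>
  define y1' where "y1' = Y.foot U' (Y.T (-1) y0)"
  have "y1' = Y.T (- int (Y.age U' (Y.T (-1) y0)) - 1) y0"
    unfolding y1'_def by (rule Y.foot_pred[OF y0Y])
  then have y1'0: "y1' \<noteq> y0" using Y.T_inj[OF y0Y, of "- int (Y.age U' (Y.T (-1) y0)) - 1" 0] by auto
  obtain S2 where S2: "clopen_on Y S2" "y0 \<in> S2" "S2 \<subseteq> Y" "S2 \<subseteq> - {y1'}"
    using cantor_set_clopen_nbhd[OF Y.cantor y0Y, of "- {y1'}"] y1'0 by blast
  obtain l :: "'b \<Rightarrow> nat" where l: "locally_const Y l" "\<forall>x\<in>Y. \<forall>y\<in>Y. l x = l y \<longrightarrow> dist x y < e"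
    using cantor_set_fine_partition[OF Y.cantor e] by blast
  \<comment> \<open>The new atoms must refine \<open>P1\<close>, be small, and tell
    \<open>y0\<close> from \<open>y1'\<close>.\<close>
  define label where "label = (\<lambda>y. (restrict (\<lambda>A. y \<in> A) P1, l y, y \<in> S2))"
  have "locally_const Y (\<lambda>y. restrict (\<lambda>A. y \<in> A) P1)"
    by (rule locally_const_restrict[OF Y.clopen_partitionD(1)[OF part1]]) (rule Y.clopen_partitionD(5)[OF part1])
  then have lclabel: "locally_const Y label"
    unfolding label_def by (intro locally_const_comp2[where h=Pair] l S2)
  obtain P' where P': "Y.kr P' U'" "\<forall>D\<in>P'. \<forall>y\<in>D. \<forall>z\<in>D. label y = label z"
    using Y.kr_exists[OF base' lclabel] by blast
  have lab1: "restrict (\<lambda>A. y \<in> A) P1 = restrict (\<lambda>A. z \<in> A) P1" "l y = l z" "y \<in> S2 \<longleftrightarrow> z \<in> S2"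
    if "D \<in> P'" "y \<in> D" "z \<in> D" for D y z
  proof -
    have "label y = label z" using P'(2) that by blast
    then show "restrict (\<lambda>A. y \<in> A) P1 = restrict (\<lambda>A. z \<in> A) P1" "l y = l z" "y \<in> S2 \<longleftrightarrow> z \<in> S2"
      by (auto simp: label_def)
  qed
  have ref1: "\<forall>D\<in>P'. \<exists>A\<in>P1. D \<subseteq> A"
  proof
    fix D assume D: "D \<in> P'"
    obtain y where y: "y \<in> D" using Y.krD(3)[OF P'(1) D] by blast
    then have "y \<in> \<Union>P1" using Y.krD(4)[OF P'(1) D] Y.clopen_partitionD(2)[OF part1] by blast
    then obtain A where A: "A \<in> P1" "y \<in> A" by blast
    have "z \<in> A" if z: "z \<in> D" for z
    proof -
      have "restrict (\<lambda>A. y \<in> A) P1 A = restrict (\<lambda>A. z \<in> A) P1 A" using lab1(1)[OF D y z] by (simp only:)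
      then show ?thesis using A by simp
    qed
    then show "\<exists>A\<in>P1. D \<subseteq> A" using A(1) by blast
  qed
  have ref: "\<And>D. D \<in> P' \<Longrightarrow> \<exists>C\<in>P. D \<subseteq> C"
  proof -
    fix D assume "D \<in> P'"
    then obtain A where A: "A \<in> P1" "D \<subseteq> A" using ref1 by blast
    then have "A \<subseteq> C \<or> A \<in> P" using WC(1) by (auto simp: P1_def)
    then show "\<exists>C\<in>P. D \<subseteq> C" using A(2) C(1) by blast
  qed
  obtain \<kappa>0 where \<kappa>0: "lift_of \<kappa>0 P'" "\<forall>x\<in>X. \<kappa>0 x \<subseteq> \<kappa>1 x" "y0 \<in> \<kappa>0 q" "y1 \<in> \<kappa>0 p1"
    using refine_lift[OF lift1 part1 Y.krD(11)[OF P'(1)] ref1 qX p1X y0q1 y1p11 ne1] by blast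
  have \<kappa>0\<kappa>: "\<And>x. x \<in> X \<Longrightarrow> \<kappa>0 x \<subseteq> \<kappa> x" using \<kappa>0(2) \<kappa>1\<kappa> by blast
  define \<kappa>' where "\<kappa>' = push U \<kappa> \<gamma> \<kappa>0"
  have push_facts: "\<kappa>' x \<in> P' \<and> \<kappa>' x \<subseteq> \<kappa> x" if "x \<in> X" for x
    unfolding \<kappa>'_def by (rule push_in[OF td P'(1) U'sub(3) _ \<kappa>0(1) _ that]) (rule ref \<kappa>0\<kappa>, assumption)+
  have lift': "lift_of \<kappa>' P'"
    unfolding \<kappa>'_def by (rule push_lift[OF td P'(1) U'sub(3) _ \<kappa>0(1)]) (rule ref \<kappa>0\<kappa>, assumption)+
  have "\<exists>\<gamma>'. X.tfg \<gamma>' \<and> (\<forall>x\<in>X. \<not> \<beta> ` \<kappa> x \<subseteq> U \<longrightarrow> \<gamma>' x = \<gamma> x) \<and> (\<forall>x\<in>X. Y.follows U' (\<kappa>' x) (\<kappa>' (\<gamma>' x)))"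
    unfolding \<kappa>'_def by (rule extend_tfg[OF td P'(1) U'sub(3) _ \<kappa>0(1)]) (rule ref \<kappa>0\<kappa>, assumption)+
  then obtain \<gamma>' where \<gamma>': "X.tfg \<gamma>'" "\<forall>x\<in>X. \<not> \<beta> ` \<kappa> x \<subseteq> U \<longrightarrow> \<gamma>' x = \<gamma> x"
    "\<forall>x\<in>X. Y.follows U' (\<kappa>' x) (\<kappa>' (\<gamma>' x))"
    by blast
  have pb: "\<kappa>' x = \<kappa>0 x" if "x \<in> X" "\<kappa> x \<subseteq> U" for x unfolding \<kappa>'_def using push_base[OF td that] .
  have "tower_lift P' U' \<kappa>' \<gamma>'"
    unfolding tower_lift_def
    using P'(1) lift' \<gamma>'(1,3) by blast
  moreover have y0q': "y0 \<in> \<kappa>' q" using pb[OF qX qU] \<kappa>0(3) by simp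
  moreover have "Y.T (-1) y0 \<in> \<kappa>' p"
  proof -
    have "\<kappa>' p = Y.T (int a) ` \<kappa>0 p1" unfolding \<kappa>'_def p1_def a_def using push_at[OF td pX yp] .
    moreover have "Y.T (int a) y1 = Y.T (-1) y0"
      unfolding a_def y1_def using Y.T_age_foot[OF base] y0Y by simp
    ultimately show ?thesis using \<kappa>0(4) by (metis imageI)
  qed
  moreover have "y1' \<notin> \<kappa>' q"
  proof
    assume "y1' \<in> \<kappa>' q"
    moreover have "\<kappa>' q \<in> P'" using push_facts[OF qX] by blast
    ultimately have "y0 \<in> S2 \<longleftrightarrow> y1' \<in> S2" using lab1(3) y0q' by blast
    then show False using S2 by blast
  qed
  ultimately have "stage y0 q p P' U' \<kappa>' \<gamma>'"
    unfolding stage_def using qX pX y0U' by (simp add: y1'_def)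
  moreover have "extends U \<kappa> \<gamma> U' \<kappa>' \<gamma>'"
    unfolding extends_def using U'sub(3) push_facts \<gamma>'(2) by blast
  moreover have "dist y z < e" if D: "D \<in> P'" "y \<in> D" "z \<in> D" for D y z
  proof -
    have "y \<in> Y" "z \<in> Y" using Y.krD(4)[OF P'(1) D(1)] D(2,3) by blast+
    then show ?thesis using l(2) lab1(2)[OF D] by blast
  qed
  \<comment> \<open>\<open>W\<close> lies in the old base, where pushing changes nothing. So a label
    meeting \<open>W\<close> refines the label \<open>W\<close> of \<kappa>1, whose fibre is
    \<open>H\<close>.\<close>
  moreover have "x \<in> G" if x: "x \<in> X" "y \<in> U'" "Y.T i y \<in> \<kappa>' x" for x y
  proof -
    have yW: "Y.T i y \<in> W" using x(2) by (auto simp: W_def)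
    then have "Y.T i y \<in> U" using WC(1) C(2) by blast
    moreover have "Y.T i y \<in> \<kappa> x" using push_facts[OF x(1)] x(3) by blast
    ultimately have "\<kappa> x \<subseteq> U" using tower_meets[OF td x(1)] by blast
    then have "Y.T i y \<in> \<kappa>1 x" using pb[OF x(1)] x(3) \<kappa>0(2) x(1) by auto
    moreover have "\<kappa>1 x \<in> P1" "W \<in> P1" using lift1 x(1) by (auto simp: lift_of_def P1_def)
    ultimately have "\<kappa>1 x = W" using Y.clopen_partitionD(6)[OF part1] yW by blast
    have "x \<in> H"
    proof (rule ccontr)
      assume "x \<notin> H"
      then have "\<kappa>1 x = C - W \<or> (\<kappa> x \<noteq> C \<and> \<kappa>1 x = \<kappa> x)" by (simp add: \<kappa>1_def)
      then show False
      proof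
        assume "\<kappa>1 x = C - W" then show False using \<open>\<kappa>1 x = W\<close> vW by blast
      next
        assume "\<kappa> x \<noteq> C \<and> \<kappa>1 x = \<kappa> x"
        then have "\<kappa> x \<noteq> C" "\<kappa> x = W" using \<open>\<kappa>1 x = W\<close> by auto
        then show False using Y.clopen_partitionD(6)[OF part tower_in[OF td x(1)] C(1)] WC(1) vW by blast
      qed
    qed
    then show ?thesis using H(2) G'G by blast
  qed
  moreover have "Y.foot U y \<in> \<kappa>' ((inv_into X \<gamma> ^^ Y.age U y) x)" if x: "x \<in> X" "y \<in> \<kappa>' x" for x y
  proof -
    let ?n = "Y.age U y" and ?x = "(inv_into X \<gamma> ^^ Y.age U y) x"
    have xX: "?x \<in> X" by (rule X.tfg_inv_pow_in[OF tfg x(1)])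
    have yx: "y \<in> \<kappa> x" using push_facts[OF x(1)] x(2) by blast
    have yY: "y \<in> Y" using tower_sub[OF td x(1)] yx by blast
    have "Y.foot U y \<in> \<kappa> ?x" using tower_root[OF td x(1) yx, of ?n] by (simp add: Y.foot_def)
    then have "\<kappa> ?x \<subseteq> U" using tower_meets[OF td xX] Y.foot_in[OF base yY] by blast
    have "y \<in> Y.T (int ?n) ` \<kappa>0 ?x" using x(2) push_at[OF td x(1) yx, of \<kappa>0] unfolding \<kappa>'_def by simp
    then obtain w where w: "w \<in> \<kappa>0 ?x" "y = Y.T (int ?n) w" by blast
    have "w \<in> Y" using w(1) \<kappa>0\<kappa>[OF xX] tower_sub[OF td xX] by blast
    then have "Y.foot U y = w" unfolding Y.foot_def using w(2) Y.T_minus(1)[of w "int ?n"] by metis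
    then show ?thesis using pb[OF xX \<open>\<kappa> ?x \<subseteq> U\<close>] w(1) by simp
  qed
  ultimately show ?thesis using U'sub(2) by blast
qed

section \<open>Shrinking base and roof, and visiting open sets\<close>

lemma nonempty_lift:
  assumes "tower_lift P U \<kappa> \<gamma>" "x \<in> X"
  shows "\<exists>y. y \<in> \<kappa> x"
  using Y.krD(3)[OF tower_kr[OF assms(1)] tower_in[OF assms]] by blast

lemma extends_roof:
  assumes "tower_lift P U \<kappa> \<gamma>" "tower_lift P' U' \<kappa>' \<gamma>'" "extends U \<kappa> \<gamma> U' \<kappa>' \<gamma>'" "x \<in> X" "\<beta> ` \<kappa>' x \<subseteq> U'"
  shows "\<beta> ` \<kappa> x \<subseteq> U"
proof -
  obtain y where y: "y \<in> \<kappa>' x" using nonempty_lift[OF assms(2,4)] by blast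
  then have "y \<in> \<kappa> x" "\<beta> y \<in> U" using assms(3-5) unfolding extends_def by blast+
  then show ?thesis using roof_meets[OF assms(1,4)] by blast
qed

lemma extends_base:
  assumes "tower_lift P U \<kappa> \<gamma>" "tower_lift P' U' \<kappa>' \<gamma>'" "extends U \<kappa> \<gamma> U' \<kappa>' \<gamma>'" "x \<in> X" "\<kappa>' x \<subseteq> U'"
  shows "\<kappa> x \<subseteq> U"
proof -
  obtain y where y: "y \<in> \<kappa>' x" using nonempty_lift[OF assms(2,4)] by blast
  then have "y \<in> \<kappa> x" "y \<in> U" using assms(3-5) unfolding extends_def by blast+
  then show ?thesis using tower_meets[OF assms(1,4)] by blast
qed

lemma extends_trans:
  assumes "tower_lift P U \<kappa> \<gamma>" "tower_lift P' U' \<kappa>' \<gamma>'" "extends U \<kappa> \<gamma> U' \<kappa>' \<gamma>'" "extends U' \<kappa>' \<gamma>' U'' \<kappa>'' \<gamma>''"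
  shows "extends U \<kappa> \<gamma> U'' \<kappa>'' \<gamma>''"
proof -
  have "\<gamma>'' x = \<gamma> x" if x: "x \<in> X" "\<not> \<beta> ` \<kappa> x \<subseteq> U" for x
  proof -
    have "\<not> \<beta> ` \<kappa>' x \<subseteq> U'" using extends_roof[OF assms(1-3) x(1)] x(2) by blast
    then show ?thesis using assms(3,4) x unfolding extends_def by metis
  qed
  moreover have "U'' \<subseteq> U" using assms(3,4) unfolding extends_def by blast
  moreover have "\<kappa>'' x \<subseteq> \<kappa> x" if "x \<in> X" for x using assms(3,4) that unfolding extends_def by blast
  ultimately show ?thesis unfolding extends_def by blast
qed

text \<open>\<open>step\<close> with \<open>i = 0\<close> and \<open>G\<close> the part near
  \<open>q\<close> of the fibre of \<open>q\<close>.\<close>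

lemma shrink_base:
  fixes e :: real
  assumes st: "stage y0 q p P U \<kappa> \<gamma>" and e: "e > 0"
  shows "\<exists>P' U' \<kappa>' \<gamma>'. stage y0 q p P' U' \<kappa>' \<gamma>' \<and> extends U \<kappa> \<gamma> U' \<kappa>' \<gamma>' \<and> (\<forall>x\<in>X. \<kappa>' x \<subseteq> U' \<longrightarrow> dist q x < e)"
proof -
  note td = stageD(1)[OF st] and qX = stageD(2)[OF st]
  obtain S where S: "clopen_on X S" "q \<in> S" "S \<subseteq> X" "S \<subseteq> ball q e"
    using cantor_set_clopen_nbhd[OF X.cantor qX open_ball, of q e] centre_in_ball[of q e] e by blast
  define G where "G = {x\<in>X. \<kappa> x = \<kappa> q \<and> x \<in> S}"
  have clG: "clopen_on X G"
    unfolding G_def using clopen_on_level[OF locally_const_comp2[OF tower_lc[OF td] S(1), where h=Pair],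
        of "\<lambda>(a, b). a = \<kappa> q \<and> b"] by simp
  have GC: "G \<subseteq> {x\<in>X. \<kappa> x = \<kappa> q}" and qG: "q \<in> G" using S qX by (auto simp: G_def)
  \<comment> \<open>The premise is impossible: \<open>y0\<close> lies in the label of
    \<open>q\<close>, and by \<open>stage\<close> the foot does not.\<close>
  have Gp: "Y.T 0 y0 = Y.foot U (Y.T (-1) y0) \<Longrightarrow> (inv_into X \<gamma> ^^ Y.age U (Y.T (-1) y0)) p \<in> G"
    using stageD(5,7)[OF st] by auto
  have clY: "clopen_on Y Y" by (rule locally_const_cong[OF locally_const_const[of _ True]]) simp
  have in0: "Y.T 0 y0 \<in> \<kappa> q" using stageD(5)[OF st] by simp
  obtain P' U' \<kappa>' \<gamma>' where s: "stage y0 q p P' U' \<kappa>' \<gamma>'" "extends U \<kappa> \<gamma> U' \<kappa>' \<gamma>'"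
    "\<forall>x\<in>X. \<forall>y\<in>U'. Y.T 0 y \<in> \<kappa>' x \<longrightarrow> x \<in> G"
    using step[OF st e tower_in[OF td qX] stageD(9)[OF st] in0 clG GC qG qG Gp clY stageD(8)[OF st]] by blast
  have "dist q x < e" if x: "x \<in> X" "\<kappa>' x \<subseteq> U'" for x
  proof -
    obtain y where "y \<in> \<kappa>' x" using nonempty_lift[OF stageD(1)[OF s(1)] x(1)] by blast
    then have "y \<in> U'" "Y.T 0 y \<in> \<kappa>' x" using x(2) by auto
    then have "x \<in> G" using s(3) x(1) by blast
    then show ?thesis using S(4) by (auto simp: G_def)
  qed
  then show ?thesis using s by blast
qed

text \<open>\<open>step\<close> applied at the foot below \<open>p\<close>: one step from
  \<open>y0\<close> to its predecessor and \<open>a\<close> steps down give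
  \<open>i = - a - 1\<close>. \<open>G\<close> consists of the points over the same base atom that
  \<gamma> carries close to \<open>p\<close> in \<open>a\<close> steps.\<close>

lemma shrink_roof:
  fixes e :: real
  assumes st: "stage y0 q p P U \<kappa> \<gamma>" and e: "e > 0"
  shows "\<exists>P' U' \<kappa>' \<gamma>'. stage y0 q p P' U' \<kappa>' \<gamma>' \<and> extends U \<kappa> \<gamma> U' \<kappa>' \<gamma>' \<and> (\<forall>x\<in>X. \<beta> ` \<kappa>' x \<subseteq> U' \<longrightarrow> dist p x < e)"
proof -
  note td = stageD(1)[OF st] and pX = stageD(3)[OF st] and y0Y = stageD(8)[OF st] and yp = stageD(6)[OF st]
  note kr = tower_kr[OF td] and tfg = tower_tfg[OF td]
  note base = Y.krD(7)[OF kr]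
  obtain S where S: "clopen_on X S" "p \<in> S" "S \<subseteq> X" "S \<subseteq> ball p e"
    using cantor_set_clopen_nbhd[OF X.cantor pX open_ball, of p e] centre_in_ball[of p e] e by blast
  define a where "a = Y.age U (Y.T (-1) y0)"
  define p1 where "p1 = (inv_into X \<gamma> ^^ a) p"
  define i where "i = - int a - 1"
  have foot: "Y.foot U (Y.T (-1) y0) = Y.T i y0" unfolding i_def a_def by (rule Y.foot_pred[OF y0Y])
  have p1X: "p1 \<in> X" unfolding p1_def by (rule X.tfg_inv_pow_in[OF tfg pX])
  have in1: "Y.T i y0 \<in> \<kappa> p1"
    using tower_root[OF td pX yp, of a] foot unfolding p1_def Y.foot_def a_def by simp
  have "Y.T i y0 \<in> U" unfolding foot[symmetric] using Y.foot_in[OF base] y0Y by simp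
  then have CU: "\<kappa> p1 \<subseteq> U" using tower_meets[OF td p1X in1] by blast
  define G where "G = {x\<in>X. \<kappa> x = \<kappa> p1 \<and> (\<gamma> ^^ a) x \<in> S}"
  have clG: "clopen_on X G"
    unfolding G_def using clopen_on_level[OF locally_const_comp2[OF tower_lc[OF td]
          X.locally_const_tfg_pow[OF tfg S(1), of a], where h=Pair], of "\<lambda>(a, b). a = \<kappa> p1 \<and> b"] by simp
  have p1G: "p1 \<in> G" using p1X X.tfg_pow_inv[OF tfg pX, of a] S(2) by (simp add: G_def p1_def)
  \<comment> \<open>Forces the predecessors of the new base into the label of \<open>p\<close>, so
    that every point of the new roof is exactly \<open>a\<close> levels above its old foot.\<close>
  define N where "N = {y\<in>Y. Y.T (-1) y \<in> \<kappa> p}"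
  have clN: "clopen_on Y N"
    unfolding N_def by (rule clopen_on_level[OF Y.locally_const_T[OF Y.krD(5)[OF kr tower_in[OF td pX]]], where Q="\<lambda>b. b"])
  have y0N: "y0 \<in> N" using y0Y yp by (simp add: N_def)
  have i0: "i = 0 \<Longrightarrow> q \<in> G" by (simp add: i_def)
  have Gp: "Y.T i y0 = Y.foot U (Y.T (-1) y0) \<Longrightarrow> (inv_into X \<gamma> ^^ Y.age U (Y.T (-1) y0)) p \<in> G"
    using p1G by (simp add: p1_def a_def)
  have GC: "G \<subseteq> {x\<in>X. \<kappa> x = \<kappa> p1}" by (auto simp: G_def)
  obtain P' U' \<kappa>' \<gamma>' where s: "stage y0 q p P' U' \<kappa>' \<gamma>'" "extends U \<kappa> \<gamma> U' \<kappa>' \<gamma>'" "U' \<subseteq> N"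
    "\<forall>x\<in>X. \<forall>y\<in>U'. Y.T i y \<in> \<kappa>' x \<longrightarrow> x \<in> G"
    "\<forall>x\<in>X. \<forall>y\<in>\<kappa>' x. Y.foot U y \<in> \<kappa>' ((inv_into X \<gamma> ^^ Y.age U y) x)"
    using step[OF st e tower_in[OF td p1X] CU in1 clG GC p1G i0 Gp clN y0N] by blast
  have "dist p x < e" if x: "x \<in> X" "\<beta> ` \<kappa>' x \<subseteq> U'" for x
  proof -
    obtain y where y: "y \<in> \<kappa>' x" using nonempty_lift[OF stageD(1)[OF s(1)] x(1)] by blast
    have yx: "y \<in> \<kappa> x" using s(2) y x(1) unfolding extends_def by blast
    have yY: "y \<in> Y" using tower_sub[OF td x(1)] yx by blast
    have bU: "\<beta> y \<in> U'" using x(2) y by blast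
    have back1: "Y.T (-1) (\<beta> y) = y" using Y.T_1[OF yY] Y.T_minus(1)[OF yY, of 1] by simp
    then have "y \<in> \<kappa> p" using s(3) bU by (auto simp: N_def)
    then have age: "Y.age U y = a" unfolding a_def using Y.kr_age_const[OF kr tower_in[OF td pX]] yp by blast
    have "Y.T i (\<beta> y) = Y.T (- int a) (Y.T (-1) (\<beta> y))"
      using Y.T_add[of "\<beta> y" "- int a" "-1"] yY by (simp add: i_def)
    also have "\<dots> = Y.foot U y" unfolding back1 Y.foot_def age ..
    finally have "Y.T i (\<beta> y) \<in> \<kappa>' ((inv_into X \<gamma> ^^ a) x)" using s(5) x(1) y age by force
    then have "(inv_into X \<gamma> ^^ a) x \<in> G" using s(4) bU X.tfg_inv_pow_in[OF tfg x(1)] by blast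
    then have "x \<in> S" using X.tfg_pow_inv[OF tfg x(1), of a] by (simp add: G_def)
    then show ?thesis using S(4) by auto
  qed
  then show ?thesis using s by blast
qed

text \<open>Phrased through labels, so that it applies to the \<open>i\<close>-th image of
  \<open>q\<close> under the limit map, whose label contains \<open>T i y0\<close>. The
  \<open>j\<close> further steps avoid the roof, so they are steps of the limit map too.\<close>

definition visits :: "'b \<Rightarrow> 'b set \<Rightarrow> ('a \<Rightarrow> 'b set) \<Rightarrow> ('a \<Rightarrow> 'a) \<Rightarrow> 'a \<Rightarrow> real \<Rightarrow> bool" where
  "visits y0 U \<kappa> \<gamma> z e \<longleftrightarrow> (\<exists>i j. \<forall>x\<in>X. Y.T (int i) y0 \<in> \<kappa> x \<longrightarrow>
     dist z ((\<gamma> ^^ j) x) < e \<and> (\<forall>t<j. \<not> \<beta> ` \<kappa> ((\<gamma> ^^ t) x) \<subseteq> U))"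

text \<open>\<open>z\<close> is reached from its foot \<open>z1\<close> in \<open>a\<close> steps,
  and \<open>G\<close> collects the points over the same base atom that arrive close to
  \<open>z\<close>. The time \<open>i\<close> is positive, which makes \<open>Gq\<close> and
  \<open>Gp\<close> void.\<close>

lemma visit:
  fixes e :: real
  assumes st: "stage y0 q p P U \<kappa> \<gamma>" and e: "e > 0" and z: "z \<in> X"
  shows "\<exists>P' U' \<kappa>' \<gamma>'. stage y0 q p P' U' \<kappa>' \<gamma>' \<and> extends U \<kappa> \<gamma> U' \<kappa>' \<gamma>'
    \<and> (\<forall>D\<in>P'. \<forall>y\<in>D. \<forall>z\<in>D. dist y z < e) \<and> visits y0 U' \<kappa>' \<gamma>' z e"
proof -
  note td = stageD(1)[OF st] and y0Y = stageD(8)[OF st]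
  note kr = tower_kr[OF td] and tfg = tower_tfg[OF td]
  note base = Y.krD(7)[OF kr]
  obtain S where S: "clopen_on X S" "z \<in> S" "S \<subseteq> X" "S \<subseteq> ball z e"
    using cantor_set_clopen_nbhd[OF X.cantor z open_ball, of z e] centre_in_ball[of z e] e by blast
  obtain y where y: "y \<in> \<kappa> z" using nonempty_lift[OF td z] by blast
  have yY: "y \<in> Y" using tower_sub[OF td z] y by blast
  define a where "a = Y.age U y"
  define w where "w = Y.foot U y"
  define z1 where "z1 = (inv_into X \<gamma> ^^ a) z"
  have z1X: "z1 \<in> X" unfolding z1_def by (rule X.tfg_inv_pow_in[OF tfg z])
  have w1: "w \<in> \<kappa> z1" using tower_root[OF td z y, of a] unfolding z1_def w_def Y.foot_def a_def by simp
  have wU: "w \<in> U" unfolding w_def by (rule Y.foot_in[OF base yY])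
  have CU: "\<kappa> z1 \<subseteq> U" using tower_meets[OF td z1X w1 wU] .
  have wY: "w \<in> Y" using Y.base_in[OF base wU] .
  \<comment> \<open>Searching from the successor of \<open>y0\<close> makes the hitting time from
    \<open>y0\<close> at least 1.\<close>
  obtain n where "Y.T (int n) (\<beta> y0) \<in> \<kappa> z1"
    using Y.hits_forward[OF Y.krD(5)[OF kr tower_in[OF td z1X]] w1 wY, of "\<beta> y0"] y0Y by auto
  then have in1: "Y.T (int (Suc n)) y0 \<in> \<kappa> z1" using Y.T_\<alpha>[OF y0Y] by (simp add: add.commute)
  define i where "i = int (Suc n)"
  define G where "G = {x\<in>X. \<kappa> x = \<kappa> z1 \<and> (\<gamma> ^^ a) x \<in> S}"
  have clG: "clopen_on X G"
    unfolding G_def using clopen_on_level[OF locally_const_comp2[OF tower_lc[OF td]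
          X.locally_const_tfg_pow[OF tfg S(1), of a], where h=Pair], of "\<lambda>(a, b). a = \<kappa> z1 \<and> b"] by simp
  have z1G: "z1 \<in> G" using z1X X.tfg_pow_inv[OF tfg z, of a] S(2) by (simp add: G_def z1_def)
  have GC: "G \<subseteq> {x\<in>X. \<kappa> x = \<kappa> z1}" by (auto simp: G_def)
  have i0: "i = 0 \<Longrightarrow> q \<in> G" by (simp add: i_def)
  have Gp: "Y.T i y0 = Y.foot U (Y.T (-1) y0) \<Longrightarrow> (inv_into X \<gamma> ^^ Y.age U (Y.T (-1) y0)) p \<in> G"
  proof -
    assume "Y.T i y0 = Y.foot U (Y.T (-1) y0)"
    then have "i = - int (Y.age U (Y.T (-1) y0)) - 1"
      unfolding Y.foot_pred[OF y0Y] by (rule Y.T_inj[OF y0Y])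
    then show ?thesis by (simp add: i_def)
  qed
  have "clopen_on Y Y" by (rule locally_const_cong[OF locally_const_const[of _ True]]) simp
  then obtain P' U' \<kappa>' \<gamma>' where s: "stage y0 q p P' U' \<kappa>' \<gamma>'" "extends U \<kappa> \<gamma> U' \<kappa>' \<gamma>'"
    "\<forall>D\<in>P'. \<forall>y\<in>D. \<forall>z\<in>D. dist y z < e" "\<forall>x\<in>X. \<forall>y\<in>U'. Y.T i y \<in> \<kappa>' x \<longrightarrow> x \<in> G"
    using step[OF st e tower_in[OF td z1X] CU in1[folded i_def] clG GC z1G i0 Gp _ y0Y] by blast
  have "dist z ((\<gamma>' ^^ a) x) < e \<and> (\<forall>t<a. \<not> \<beta> ` \<kappa>' ((\<gamma>' ^^ t) x) \<subseteq> U')" if x: "x \<in> X" "Y.T i y0 \<in> \<kappa>' x" for x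
  proof -
    have xG: "x \<in> G" using s(4) x stageD(4)[OF s(1)] by blast
    then have "w \<in> \<kappa> x" using w1 by (simp add: G_def)
    \<comment> \<open>The age \<open>a\<close> is less than the return time of \<open>w\<close>, so
      none of the first \<open>a\<close> steps starts at the roof.\<close>
    have lev: "Y.T (int t) w \<in> \<kappa> ((\<gamma> ^^ t) x) \<and> (t < a \<longrightarrow> \<not> \<beta> ` \<kappa> ((\<gamma> ^^ t) x) \<subseteq> U)" if "t \<le> a" for t
      using that
    proof (induction t)
      case 0
      have "\<not> \<beta> ` \<kappa> x \<subseteq> U" if "0 < a"
      proof -
        have "Suc 0 < Y.ret U w" using Y.age_less_ret[OF base yY] that unfolding a_def w_def by simp
        then have "Y.T (int (Suc 0)) w \<notin> U" using Y.not_in_before_ret[OF base, of "Suc 0"] by blast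
        then show ?thesis using \<open>w \<in> \<kappa> x\<close> Y.T_1[OF wY] by auto
      qed
      then show ?case using \<open>w \<in> \<kappa> x\<close> by simp
    next
      case (Suc t)
      then have IH: "Y.T (int t) w \<in> \<kappa> ((\<gamma> ^^ t) x)" "\<not> \<beta> ` \<kappa> ((\<gamma> ^^ t) x) \<subseteq> U" by auto
      have tX: "(\<gamma> ^^ t) x \<in> X" by (rule X.tfg_pow_in[OF tfg x(1)])
      have suc: "Y.T (int (Suc u)) w = \<beta> (Y.T (int u) w)" for u
        using Y.T_succ[OF wY, of "int u"] by (simp add: add.commute)
      have now: "Y.T (int (Suc t)) w \<in> \<kappa> ((\<gamma> ^^ Suc t) x)"
        using tower_succ(1)[OF td tX IH(2)] IH(1) unfolding suc by simp
      have "\<not> \<beta> ` \<kappa> ((\<gamma> ^^ Suc t) x) \<subseteq> U" if "Suc t < a"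
      proof -
        have "Suc (Suc t) < Y.ret U w" using Y.age_less_ret[OF base yY] that unfolding a_def w_def by simp
        then have "Y.T (int (Suc (Suc t))) w \<notin> U" using Y.not_in_before_ret[OF base, of "Suc (Suc t)"] by blast
        then show ?thesis using now unfolding suc[of "Suc t"] by blast
      qed
      then show ?case using now by blast
    qed
    have same: "(\<gamma>' ^^ t) x = (\<gamma> ^^ t) x" if "t \<le> a" for t
      using that
    proof (induction t)
      case (Suc t)
      then have "(\<gamma>' ^^ Suc t) x = \<gamma>' ((\<gamma> ^^ t) x)" by simp
      also have "\<dots> = \<gamma> ((\<gamma> ^^ t) x)"
        using s(2) lev[of t] Suc.prems X.tfg_pow_in[OF tfg x(1), of t] unfolding extends_def by auto
      finally show ?case by simp
    qed simp
    have "\<not> \<beta> ` \<kappa>' ((\<gamma>' ^^ t) x) \<subseteq> U'" if t: "t < a" for t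
    proof
      have tX: "(\<gamma> ^^ t) x \<in> X" by (rule X.tfg_pow_in[OF tfg x(1)])
      assume "\<beta> ` \<kappa>' ((\<gamma>' ^^ t) x) \<subseteq> U'"
      then have "\<beta> ` \<kappa> ((\<gamma> ^^ t) x) \<subseteq> U"
        using extends_roof[OF td stageD(1)[OF s(1)] s(2) tX] same[of t] t by simp
      then show False using lev[of t] t by simp
    qed
    moreover have "(\<gamma>' ^^ a) x \<in> S" using xG same[of a] by (simp add: G_def)
    ultimately show ?thesis using S(4) by auto
  qed
  then have "visits y0 U' \<kappa>' \<gamma>' z e" unfolding visits_def i_def by blast
  then show ?thesis using s by blast
qed

text \<open>The bounds for base and roof are inherited by extensions, through
  \<open>extends_base\<close> and \<open>extends_roof\<close>, so they may be arranged before the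
  visit.\<close>

lemma big_step:
  fixes e :: real
  assumes st: "stage y0 q p P U \<kappa> \<gamma>" and e: "e > 0" and z: "z \<in> X"
  shows "\<exists>P' U' \<kappa>' \<gamma>'. stage y0 q p P' U' \<kappa>' \<gamma>' \<and> extends U \<kappa> \<gamma> U' \<kappa>' \<gamma>'
    \<and> (\<forall>D\<in>P'. \<forall>y\<in>D. \<forall>z\<in>D. dist y z < e) \<and> visits y0 U' \<kappa>' \<gamma>' z e
    \<and> (\<forall>x\<in>X. \<kappa>' x \<subseteq> U' \<longrightarrow> dist q x < e) \<and> (\<forall>x\<in>X. \<beta> ` \<kappa>' x \<subseteq> U' \<longrightarrow> dist p x < e)"
proof -
  obtain P1 U1 \<kappa>1 \<gamma>1 where 1: "stage y0 q p P1 U1 \<kappa>1 \<gamma>1" "extends U \<kappa> \<gamma> U1 \<kappa>1 \<gamma>1" "\<forall>x\<in>X. \<kappa>1 x \<subseteq> U1 \<longrightarrow> dist q x < e"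
    using shrink_base[OF st e] by blast
  obtain P2 U2 \<kappa>2 \<gamma>2 where 2: "stage y0 q p P2 U2 \<kappa>2 \<gamma>2" "extends U1 \<kappa>1 \<gamma>1 U2 \<kappa>2 \<gamma>2"
    "\<forall>x\<in>X. \<beta> ` \<kappa>2 x \<subseteq> U2 \<longrightarrow> dist p x < e"
    using shrink_roof[OF 1(1) e] by blast
  obtain P3 U3 \<kappa>3 \<gamma>3 where 3: "stage y0 q p P3 U3 \<kappa>3 \<gamma>3" "extends U2 \<kappa>2 \<gamma>2 U3 \<kappa>3 \<gamma>3"
    "\<forall>D\<in>P3. \<forall>y\<in>D. \<forall>z\<in>D. dist y z < e" "visits y0 U3 \<kappa>3 \<gamma>3 z e"
    using visit[OF 2(1) e z] by blast
  note t0 = stageD(1)[OF st] and t1 = stageD(1)[OF 1(1)] and t2 = stageD(1)[OF 2(1)] and t3 = stageD(1)[OF 3(1)]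
  have "extends U1 \<kappa>1 \<gamma>1 U3 \<kappa>3 \<gamma>3" by (rule extends_trans[OF t1 t2 2(2) 3(2)])
  then have "extends U \<kappa> \<gamma> U3 \<kappa>3 \<gamma>3" and e13: "extends U1 \<kappa>1 \<gamma>1 U3 \<kappa>3 \<gamma>3"
    using extends_trans[OF t0 t1 1(2)] by blast+
  moreover have "dist q x < e" if "x \<in> X" "\<kappa>3 x \<subseteq> U3" for x
    using extends_base[OF t1 t3 e13 that] 1(3) that(1) by blast
  moreover have "dist p x < e" if "x \<in> X" "\<beta> ` \<kappa>3 x \<subseteq> U3" for x
    using extends_roof[OF t2 t3 3(2) that] 2(3) that(1) by blast
  ultimately show ?thesis using 3(1,3,4) by (intro exI[of _ P3] exI[of _ U3] exI[of _ \<kappa>3] exI[of _ \<gamma>3]) simp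
qed

text \<open>With base \<open>Y\<close> every atom is both base and roof, so the identity may serve
  as \<gamma>. The pair \<open>p\<close>, \<open>q\<close> is found where an orbit enters the fibre
  over \<open>C\<close>; \<open>q = \<alpha> p\<close> will keep the limit in the full
  group.\<close>

lemma initial_stage: "\<exists>y0 q p P U \<kappa> \<gamma>. stage y0 q p P U \<kappa> \<gamma> \<and> q = \<alpha> p"
proof -
  obtain y0 where y0: "y0 \<in> Y" using Y.nonempty by blast
  have "Y.T (-1) y0 \<noteq> y0" using Y.T_inj[OF y0, of "-1" 0] by auto
  then have "open (- {Y.T (-1) y0})" "y0 \<in> - {Y.T (-1) y0}" by auto
  then obtain C where C: "clopen_on Y C" "y0 \<in> C" "C \<subseteq> Y" "C \<subseteq> - {Y.T (-1) y0}"
    using cantor_set_clopen_nbhd[OF Y.cantor y0] by metis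
  have clX: "clopen_on X X" by (rule locally_const_cong[OF locally_const_const[of _ True]]) simp
  have clY: "clopen_on Y Y" by (rule locally_const_cong[OF locally_const_const[of _ True]]) simp
  obtain x1 where x1: "x1 \<in> X" using X.nonempty by blast
  have "X.sim (ind X) (\<lambda>_. 1)" by (rule X.sim_eq) simp
  also have "X.sim \<dots> (r (\<lambda>_. 1))" by (rule X.sim_sym[OF r_one])
  also have "X.sim \<dots> (r (ind Y))" by (rule r_eq) auto
  finally have XY: "X.sim (ind X) (r (ind Y))" .
  obtain E where E: "clopen_on X E" "E \<subseteq> X" "X.sim (ind E) (r (ind C))" "X.sim (ind (X - E)) (r (ind (Y - C)))"
    by (rule split_off[OF clX subset_refl clY subset_refl C(1,3) XY x1]) blast
  define P where "P = {C, Y - C}"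
  define \<kappa> where "\<kappa> = (\<lambda>x. if x \<in> E then C else Y - C)"
  have y1: "Y.T (-1) y0 \<in> Y - C" using C y0 by auto
  have CneD: "C \<noteq> Y - C" using C by blast
  have part: "Y.clopen_partition P"
    unfolding Y.clopen_partition_def P_def
    using C y1 clopen_on_Diff[OF clY C(1)] by auto
  have base: "Y.is_base Y" using clY y0 by (auto simp: Y.is_base_def)
  have "\<beta> ` D \<subseteq> Y" if "D \<in> P" for D using that C(3) by (auto simp: P_def)
  then have kr: "Y.kr P Y" unfolding Y.kr_def using part base C(3) by (auto simp: P_def)
  have "{x\<in>X. \<kappa> x = C} = E" "{x\<in>X. \<kappa> x = Y - C} = X - E" using E(2) CneD by (auto simp: \<kappa>_def)
  then have cls: "X.sim (ind {x\<in>X. \<kappa> x = C}) (r (ind C))" "X.sim (ind {x\<in>X. \<kappa> x = Y - C}) (r (ind (Y - C)))"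
    using E(3,4) by (simp_all only:)
  have "locally_const X \<kappa>" unfolding \<kappa>_def by (rule locally_const_if[OF E(1)]) auto
  moreover have "\<kappa> ` X \<subseteq> P" by (auto simp: \<kappa>_def P_def)
  ultimately have lift: "lift_of \<kappa> P" unfolding lift_of_def using cls unfolding P_def by blast
  have "X.tfg (\<lambda>x. x)"
    unfolding X.tfg_def by (auto simp: bij_betw_def intro!: exI[of _ "\<lambda>_. 0"])
  then have td: "tower_lift P Y \<kappa> (\<lambda>x. x)"
    unfolding tower_lift_def using kr lift C(3) by (auto simp: Y.follows_def \<kappa>_def)
  obtain x where x: "x \<in> X" "\<kappa> x = C" using lift_of_onto[OF lift part, of C] by (auto simp: P_def)
  obtain z where z: "z \<in> X" "\<kappa> z = Y - C" using lift_of_onto[OF lift part, of "Y - C"] by (auto simp: P_def)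
  have xE: "x \<in> E" "z \<notin> E" using x z CneD by (auto simp: \<kappa>_def split: if_splits)
  \<comment> \<open>The first time, going back from \<open>x\<close>, that the orbit is outside
    \<open>E\<close>: there lies \<open>p\<close>, and its successor \<open>q\<close> is still in
    \<open>E\<close>.\<close>
  define n where "n = (LEAST n. X.T (- int n) x \<in> X - E)"
  have ex: "\<exists>n. X.T (- int n) x \<in> X - E"
    using X.hits_backward[OF clopen_on_Diff[OF clX E(1)], of z x] x z xE by blast
  have nE: "X.T (- int n) x \<in> X - E" unfolding n_def using LeastI_ex[OF ex] .
  have "n \<noteq> 0" using nE xE by (metis DiffE hpow_0 of_nat_0 minus_zero)
  then obtain m where m: "n = Suc m" using not0_implies_Suc by blast
  have mE: "X.T (- int m) x \<in> E"
  proof (rule ccontr)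
    assume "X.T (- int m) x \<notin> E"
    then have "X.T (- int m) x \<in> X - E" using x by simp
    then have "n \<le> m" unfolding n_def by (rule Least_le)
    then show False using m by simp
  qed
  define p where "p = X.T (- int n) x"
  define q where "q = \<alpha> p"
  have "q = X.T (- int m) x"
    unfolding q_def p_def m using X.T_succ[OF x(1), of "- int (Suc m)"] by simp
  then have qE: "q \<in> E" "q \<in> X" using mE E(2) by auto
  have pE: "p \<in> X" "p \<notin> E" using nE by (auto simp: p_def)
  have foot: "Y.foot Y (Y.T (-1) y0) = Y.T (-1) y0" using Y.age_base(2)[OF base] y0 by simp
  have "stage y0 q p P Y \<kappa> (\<lambda>x. x)"
    unfolding stage_def using td qE pE y0 C(2) y1 by (simp add: \<kappa>_def foot)
  then show ?thesis using q_def by blast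
qed

end

text \<open>Pairs of an index and a net number are coded into one number that is at least the net
  number. So a point of the \<open>m\<close>-th net occurs at an index where the tolerance is as
  small as for \<open>m\<close>.\<close>

lemma compact_dense_sequence:
  fixes X :: "'a::metric_space set"
  assumes "compact X" "X \<noteq> {}"
  shows "\<exists>z :: nat \<Rightarrow> 'a. (\<forall>n. z n \<in> X)
    \<and> (\<forall>x\<in>X. \<forall>e>0. \<exists>n. dist (z n) x < e \<and> inverse (real (Suc n)) < e)"
proof -
  have "\<exists>K. finite K \<and> K \<subseteq> X \<and> X \<subseteq> (\<Union>k\<in>K. ball k (inverse (real (Suc m))))" for m
  proof -
    have "X \<subseteq> (\<Union>k\<in>X. ball k (inverse (real (Suc m))))" by force
    then show ?thesis using compactE_image[OF assms(1), of X "\<lambda>k. ball k (inverse (real (Suc m)))"] by (metis open_ball)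
  qed
  then obtain K where K: "\<And>m. finite (K m)" "\<And>m. K m \<subseteq> X" "\<And>m. X \<subseteq> (\<Union>k\<in>K m. ball k (inverse (real (Suc m))))"
    by metis
  define D where "D = (\<Union>m. K m)"
  have cD: "countable D" unfolding D_def using K(1) by (intro countable_UN) (auto intro: countable_finite)
  have neD: "D \<noteq> {}" using K(3)[of 0] assms(2) by (auto simp: D_def)
  define z where "z = (\<lambda>n. from_nat_into D (fst (prod_decode n)))"
  have "z n \<in> X" for n
    using from_nat_into[OF neD] K(2) unfolding z_def D_def by blast
  moreover have "\<exists>n. dist (z n) x < e \<and> inverse (real (Suc n)) < e" if x: "x \<in> X" and e: "e > 0" for x e
  proof -
    obtain m where m: "inverse (real (Suc m)) < e" using reals_Archimedean[OF e] by blast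
    obtain k where k: "k \<in> K m" "dist k x < inverse (real (Suc m))" using K(3)[of m] x by auto
    then have "k \<in> D" by (auto simp: D_def)
    then obtain j where j: "from_nat_into D j = k" using from_nat_into_surj[OF cD] by blast
    let ?n = "prod_encode (j, m)"
    have "m \<le> ?n" by (rule le_prod_encode_2)
    then have "inverse (real (Suc ?n)) \<le> inverse (real (Suc m))" by (intro le_imp_inverse_le) auto
    then have "inverse (real (Suc ?n)) < e" using m by linarith
    moreover have "dist (z ?n) x < e" using k(2) m j by (simp add: z_def)
    ultimately show ?thesis by blast
  qed
  ultimately show ?thesis by blast
qed

section \<open>Passage to the limit\<close>

context k0_map begin

lemma extends_refl: "extends U \<kappa> \<gamma> U \<kappa> \<gamma>"
  by (simp add: extends_def)

lemma factor_exists: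
  "\<exists>F \<gamma>. continuous_on X F \<and> F ` X \<subseteq> Y \<and> \<gamma> \<in> full_group X \<alpha> \<and> minimal_on X \<gamma>
     \<and> (\<exists>p. \<forall>x\<in>X. x \<noteq> p \<longrightarrow> continuous (at x within X) (\<lambda>y. real_of_int (orbit_cocycle X \<alpha> \<gamma> y)))
     \<and> (\<forall>x\<in>X. \<beta> (F x) = F (\<gamma> x))"
proof -
  obtain y0 q p P0 U0 \<kappa>0 \<gamma>0 where init: "stage y0 q p P0 U0 \<kappa>0 \<gamma>0" and qp: "q = \<alpha> p"
    using initial_stage by blast
  obtain z :: "nat \<Rightarrow> 'a" where z: "\<And>n. z n \<in> X"
    "\<And>x e. x \<in> X \<Longrightarrow> e > 0 \<Longrightarrow> \<exists>n. dist (z n) x < e \<and> inverse (real (Suc n)) < e"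
    using compact_dense_sequence[OF X.compact_X X.nonempty] by blast
  define ee where "ee = (\<lambda>n. inverse (real (Suc n)))"
  have ee: "ee n > 0" for n by (simp add: ee_def)
  define St where "St = (\<lambda>(P, U, \<kappa>, \<gamma>). stage y0 q p P U \<kappa> \<gamma>)"
  define R where "R = (\<lambda>(n::nat) (P :: 'b set set, U, \<kappa>, \<gamma>) (P' :: 'b set set, U', \<kappa>', \<gamma>'). extends U \<kappa> \<gamma> U' \<kappa>' \<gamma>'
    \<and> (\<forall>D\<in>P'. \<forall>y\<in>D. \<forall>z\<in>D. dist y z < ee n) \<and> visits y0 U' \<kappa>' \<gamma>' (z n) (ee n)
    \<and> (\<forall>x\<in>X. \<kappa>' x \<subseteq> U' \<longrightarrow> dist q x < ee n) \<and> (\<forall>x\<in>X. \<beta> ` \<kappa>' x \<subseteq> U' \<longrightarrow> dist p x < ee n))"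
  have "\<exists>f. \<forall>n. St (f n) \<and> R n (f n) (f (Suc n))"
  proof (rule dependent_nat_choice)
    show "\<exists>s. St s" using init by (intro exI[of _ "(P0, U0, \<kappa>0, \<gamma>0)"]) (simp add: St_def)
    fix s n assume "St s"
    then show "\<exists>s'. St s' \<and> R n s s'"
    proof (cases s)
      case (fields P U \<kappa> \<gamma>)
      then have "stage y0 q p P U \<kappa> \<gamma>" using \<open>St s\<close> by (simp add: St_def)
      from big_step[OF this ee z(1), of n n] obtain P' U' \<kappa>' \<gamma>' where
        "stage y0 q p P' U' \<kappa>' \<gamma>'" "extends U \<kappa> \<gamma> U' \<kappa>' \<gamma>'"
        "\<forall>D\<in>P'. \<forall>y\<in>D. \<forall>z\<in>D. dist y z < ee n" "visits y0 U' \<kappa>' \<gamma>' (z n) (ee n)"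
        "\<forall>x\<in>X. \<kappa>' x \<subseteq> U' \<longrightarrow> dist q x < ee n" "\<forall>x\<in>X. \<beta> ` \<kappa>' x \<subseteq> U' \<longrightarrow> dist p x < ee n" by blast
      then show ?thesis using fields by (intro exI[of _ "(P', U', \<kappa>', \<gamma>')"]) (simp add: St_def R_def)
    qed
  qed
  then obtain f where f: "\<And>n. St (f n)" "\<And>n. R n (f n) (f (Suc n))" by blast
  define P where "P = (\<lambda>n. fst (f n))"
  define U where "U = (\<lambda>n. fst (snd (f n)))"
  define \<kappa> where "\<kappa> = (\<lambda>n. fst (snd (snd (f n))))"
  define \<gamma> where "\<gamma> = (\<lambda>n. snd (snd (snd (f n))))"
  have fn: "f n = (P n, U n, \<kappa> n, \<gamma> n)" for n by (simp add: P_def U_def \<kappa>_def \<gamma>_def)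
  have st: "stage y0 q p (P n) (U n) (\<kappa> n) (\<gamma> n)" for n using f(1)[of n] by (simp add: fn St_def)
  have ex: "extends (U n) (\<kappa> n) (\<gamma> n) (U (Suc n)) (\<kappa> (Suc n)) (\<gamma> (Suc n))"
    and smallP: "\<And>D y w. D \<in> P (Suc n) \<Longrightarrow> y \<in> D \<Longrightarrow> w \<in> D \<Longrightarrow> dist y w < ee n"
    and vis: "visits y0 (U (Suc n)) (\<kappa> (Suc n)) (\<gamma> (Suc n)) (z n) (ee n)"
    and smallB: "\<And>x. x \<in> X \<Longrightarrow> \<kappa> (Suc n) x \<subseteq> U (Suc n) \<Longrightarrow> dist q x < ee n"
    and smallR: "\<And>x. x \<in> X \<Longrightarrow> \<beta> ` \<kappa> (Suc n) x \<subseteq> U (Suc n) \<Longrightarrow> dist p x < ee n" for n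
    using f(2)[of n] unfolding fn R_def by auto
  note td = stageD(1)[OF st]
  note qX = stageD(2)[OF st[of 0]] and pX = stageD(3)[OF st[of 0]] and y0Y = stageD(8)[OF st[of 0]]
  have exm: "extends (U m) (\<kappa> m) (\<gamma> m) (U n) (\<kappa> n) (\<gamma> n)" if "m \<le> n" for m n
    using that
  proof (induction rule: dec_induct)
    case base
    show ?case by (rule extends_refl)
  next
    case (step n)
    show ?case by (rule extends_trans[OF td td step.IH ex])
  qed
  have kmono: "\<kappa> n x \<subseteq> \<kappa> m x" if "m \<le> n" "x \<in> X" for m n x using exm[OF that(1)] that(2) unfolding extends_def by blast
  have Umono: "U n \<subseteq> U m" if "m \<le> n" for m n using exm[OF that] unfolding extends_def by blast
  have gmono: "\<gamma> n x = \<gamma> m x" if "m \<le> n" "x \<in> X" "\<not> \<beta> ` \<kappa> m x \<subseteq> U m" for m n x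
    using exm[OF that(1)] that(2,3) unfolding extends_def by blast
  have nr_mono: "\<not> \<beta> ` \<kappa> n x \<subseteq> U n" if "m \<le> n" "x \<in> X" "\<not> \<beta> ` \<kappa> m x \<subseteq> U m" for m n x
    using extends_roof[OF td td exm[OF that(1)] that(2)] that(3) by blast
  have eesmall: "\<exists>n. ee n < e" if "e > 0" for e using reals_Archimedean[OF that] unfolding ee_def by blast
  have roof_p: "\<beta> ` \<kappa> n p \<subseteq> U n" for n
  proof -
    have "\<beta> (Y.T (-1) y0) = y0"
      using Y.T_1[OF Y.T_in[OF y0Y, of "-1"]] Y.T_minus(2)[OF y0Y, of 1] by simp
    then show ?thesis using roof_meets[OF td pX stageD(6)[OF st]] stageD(4)[OF st] by simp
  qed
  have ex_nr: "\<exists>n. \<not> \<beta> ` \<kappa> n x \<subseteq> U n" if x: "x \<in> X" "x \<noteq> p" for x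
  proof -
    obtain n where n: "ee n < dist p x" using eesmall[of "dist p x"] x(2) by auto
    then have "\<not> \<beta> ` \<kappa> (Suc n) x \<subseteq> U (Suc n)" using smallR[OF x(1), of n] by auto
    then show ?thesis by blast
  qed
  \<comment> \<open>The stage is the first one with \<open>x\<close> off the roof;
    \<open>g_eq\<close> shows that any later such stage gives the same value. Only \<open>p\<close>
    stays at the roof forever.\<close>
  define g where "g = (\<lambda>x. if x = p then q else \<gamma> (LEAST n. \<not> \<beta> ` \<kappa> n x \<subseteq> U n) x)"
  have g_p: "g p = q" by (simp add: g_def)
  have g_eq: "g x = \<gamma> n x" if x: "x \<in> X" "\<not> \<beta> ` \<kappa> n x \<subseteq> U n" for x n
  proof -
    have "x \<noteq> p" using roof_p x(2) by blast
    moreover have "\<not> \<beta> ` \<kappa> (LEAST n. \<not> \<beta> ` \<kappa> n x \<subseteq> U n) x \<subseteq> U (LEAST n. \<not> \<beta> ` \<kappa> n x \<subseteq> U n)"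
      using x(2) by (rule LeastI[where P="\<lambda>n. \<not> \<beta> ` \<kappa> n x \<subseteq> U n"])
    moreover have "(LEAST n. \<not> \<beta> ` \<kappa> n x \<subseteq> U n) \<le> n" using x(2) by (rule Least_le[where P="\<lambda>n. \<not> \<beta> ` \<kappa> n x \<subseteq> U n"])
    ultimately show ?thesis using gmono[OF _ x(1)] by (simp add: g_def)
  qed
  have g_in: "g x \<in> X" if x: "x \<in> X" for x
  proof (cases "x = p")
    case True
    then show ?thesis using g_p qX by simp
  next
    case False
    then obtain n where "\<not> \<beta> ` \<kappa> n x \<subseteq> U n" using ex_nr[OF x] by blast
    then show ?thesis using g_eq[OF x] X.tfg_in[OF tower_tfg[OF td] x] by simp
  qed
  \<comment> \<open>At stage \<open>n\<close> the value at \<open>x\<close> may not be settled yet,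
    so the claim is read off at a later stage \<open>m\<close> where \<open>x\<close> is off the
    roof and the label of \<open>g x\<close> is the \<beta>-image of that of
    \<open>x\<close>.\<close>
  have g_base: "\<kappa> n (g x) \<subseteq> U n" if x: "x \<in> X" "\<beta> ` \<kappa> n x \<subseteq> U n" for n x
  proof (cases "x = p")
    case True
    then show ?thesis using g_p stageD(9)[OF st] by simp
  next
    case False
    then obtain m0 where m0: "\<not> \<beta> ` \<kappa> m0 x \<subseteq> U m0" using ex_nr[OF x(1)] by blast
    define m where "m = max m0 n"
    have nr: "\<not> \<beta> ` \<kappa> m x \<subseteq> U m" using nr_mono[OF _ x(1) m0, of m] by (simp add: m_def)
    have gx: "g x = \<gamma> m x" using g_eq[OF x(1) nr] .
    have eq: "\<kappa> m (g x) = \<beta> ` \<kappa> m x" unfolding gx by (rule tower_succ(1)[OF td x(1) nr])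
    obtain y where y: "y \<in> \<kappa> m x" using nonempty_lift[OF td x(1)] by blast
    have "n \<le> m" by (simp add: m_def)
    then have "\<beta> y \<in> U n" "\<beta> y \<in> \<kappa> n (g x)"
      using kmono[OF \<open>n \<le> m\<close> x(1)] kmono[OF \<open>n \<le> m\<close> g_in[OF x(1)]] y x(2) eq by blast+
    then show ?thesis using tower_meets[OF td g_in[OF x(1)]] by blast
  qed
  have inj: "inj_on g X"
  proof (rule inj_onI)
    \<comment> \<open>From off the roof only labels disjoint from the base are reached, while
      \<open>y0\<close> lies in both the base and the label of \<open>q\<close>.\<close>
    have not_p: False if x: "x \<in> X" "x \<noteq> p" "g x = q" for x
    proof -
      obtain n where n: "\<not> \<beta> ` \<kappa> n x \<subseteq> U n" using ex_nr[OF x(1,2)] by blast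
      have "\<kappa> n q \<inter> U n = {}" using tower_succ(2)[OF td x(1) n] g_eq[OF x(1) n] x(3) by simp
      then show False using stageD(4,5)[OF st[of n]] by blast
    qed
    fix x w assume xw: "x \<in> X" "w \<in> X" "g x = g w"
    show "x = w"
    proof (cases "x = p \<or> w = p")
      case True
      then show ?thesis using not_p[OF xw(1)] not_p[OF xw(2)] xw(3) g_p by metis
    next
      case False
      then obtain n m where nm: "\<not> \<beta> ` \<kappa> n x \<subseteq> U n" "\<not> \<beta> ` \<kappa> m w \<subseteq> U m" using ex_nr xw by metis
      define l where "l = max n m"
      have "\<not> \<beta> ` \<kappa> l x \<subseteq> U l" "\<not> \<beta> ` \<kappa> l w \<subseteq> U l"
        using nr_mono[OF _ xw(1) nm(1), of l] nr_mono[OF _ xw(2) nm(2), of l] by (simp_all add: l_def)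
      then have "\<gamma> l x = \<gamma> l w" using g_eq xw by metis
      then show ?thesis using X.tfg_bij[OF tower_tfg[OF td]] xw by (meson bij_betw_def inj_onD)
    qed
  qed
  have surj: "g ` X = X"
  proof (intro equalityI subsetI)
    fix w assume "w \<in> g ` X" then show "w \<in> X" using g_in by blast
  next
    fix w assume w: "w \<in> X"
    show "w \<in> g ` X"
    proof (cases "w = q")
      case True
      then show ?thesis using g_p pX by (metis imageI)
    next
      case False
      then obtain n where "ee n < dist q w" using eesmall[of "dist q w"] by auto
      then have nU: "\<not> \<kappa> (Suc n) w \<subseteq> U (Suc n)" using smallB[OF w, of n] by auto
      let ?x = "inv_into X (\<gamma> (Suc n)) w"
      have x: "?x \<in> X" "\<gamma> (Suc n) ?x = w"
        using X.tfg_inv_in[OF tower_tfg[OF td] w] X.tfg_inv(1)[OF tower_tfg[OF td] w] .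
      have "g ?x = w" using g_eq[OF x(1) tower_back(2)[OF td w nU]] x(2) by simp
      then show ?thesis using x(1) by (metis imageI)
    qed
  qed
  have local_power: "\<exists>k. \<forall>\<^sub>F y in inf (nhds x) (principal X). g y = X.T k y" if x: "x \<in> X" "x \<noteq> p" for x
  proof -
    obtain n where n: "\<not> \<beta> ` \<kappa> n x \<subseteq> U n" using ex_nr[OF x] by blast
    obtain k where k: "locally_const X k" "\<forall>x\<in>X. \<gamma> n x = X.T (k x) x"
      using tower_tfg[OF td, of n] by (auto simp: X.tfg_def)
    have "\<forall>\<^sub>F y in inf (nhds x) (principal X). \<kappa> n y = \<kappa> n x" using locally_constD[OF tower_lc[OF td] x(1)] .
    moreover have "\<forall>\<^sub>F y in inf (nhds x) (principal X). k y = k x" using locally_constD[OF k(1) x(1)] .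
    moreover have "\<forall>\<^sub>F y in inf (nhds x) (principal X). y \<in> X" by (rule eventually_in_principal)
    ultimately have "\<forall>\<^sub>F y in inf (nhds x) (principal X). g y = X.T (k x) y"
    proof eventually_elim
      case (elim y)
      then show ?case using g_eq[OF elim(3), of n] n k(2) by simp
    qed
    then show ?thesis by blast
  qed
  have cont: "continuous_on X g"
    unfolding continuous_on_topological
  proof (intro ballI allI impI)
    fix x B assume x: "x \<in> X" "open B" "g x \<in> B"
    show "\<exists>A. open A \<and> x \<in> A \<and> (\<forall>y\<in>X. y \<in> A \<longrightarrow> g y \<in> B)"
    proof (cases "x = p")
      case True
      \<comment> \<open>Points near \<open>p\<close> are still at the roof of stage
        \<open>Suc n\<close>, so \<open>g\<close> sends them over the base, hence close to
        \<open>q\<close>.\<close>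
      then obtain e where e: "e > 0" "ball q e \<subseteq> B" using x g_p by (metis open_contains_ball)
      obtain n where n: "ee n < e" using eesmall[OF e(1)] by blast
      obtain A where A: "open A" "x \<in> A" "\<forall>y\<in>A \<inter> X. \<kappa> (Suc n) y = \<kappa> (Suc n) x"
        using locally_constD[OF tower_lc[OF td] x(1)] unfolding eventually_nhds_principal by blast
      have "g y \<in> B" if y: "y \<in> X" "y \<in> A" for y
      proof -
        have "\<kappa> (Suc n) y = \<kappa> (Suc n) p" using A(3) y True by blast
        then have "\<beta> ` \<kappa> (Suc n) y \<subseteq> U (Suc n)" using roof_p by simp
        then have "dist q (g y) < ee n" using smallB[OF g_in[OF y(1)] g_base[OF y(1)]] by blast
        then show ?thesis using e(2) n by auto
      qed
      then show ?thesis using A by blast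
    next
      case False
      then obtain k where "\<forall>\<^sub>F y in inf (nhds x) (principal X). g y = X.T k y" using local_power[OF x(1)] by blast
      then obtain A where A: "open A" "x \<in> A" "\<forall>y\<in>A \<inter> X. g y = X.T k y" unfolding eventually_nhds_principal by blast
      have "X.T k x \<in> B" using A x by auto
      then obtain A' where A': "open A'" "x \<in> A'" "\<forall>y\<in>X. y \<in> A' \<longrightarrow> X.T k y \<in> B"
        using X.continuous_T[of k] x(1,2) unfolding continuous_on_topological by meson
      have "\<forall>y\<in>X. y \<in> A \<inter> A' \<longrightarrow> g y \<in> B" using A(3) A'(3) by auto
      then show ?thesis using A A' by (meson IntI open_Int)
    qed
  qed
  have homeo: "is_homeo X g"
    unfolding is_homeo_def using homeomorphism_compact[OF X.compact_X cont surj inj] .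
  have "\<exists>n. g x = X.T n x" if x: "x \<in> X" for x
  proof (cases "x = p")
    case True
    then show ?thesis using g_p qp X.T_1[OF pX] by metis
  next
    case False
    then obtain n where n: "\<not> \<beta> ` \<kappa> n x \<subseteq> U n" using ex_nr[OF x] by blast
    then show ?thesis using g_eq[OF x n] tower_tfg[OF td, of n] x unfolding X.tfg_def by metis
  qed
  then have full: "g \<in> full_group X \<alpha>" using homeo by (simp add: full_group_def)
  have cocycle: "continuous (at x within X) (\<lambda>y. real_of_int (orbit_cocycle X \<alpha> g y))" if x: "x \<in> X" "x \<noteq> p" for x
  proof -
    obtain k where k: "\<forall>\<^sub>F y in inf (nhds x) (principal X). g y = X.T k y" using local_power[OF x] by blast
    have ev: "\<forall>\<^sub>F y in inf (nhds x) (principal X). orbit_cocycle X \<alpha> g y = k"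
      using k eventually_in_principal by eventually_elim (rule X.orbit_cocycle_eq)
    then have "orbit_cocycle X \<alpha> g x = k"
      unfolding eventually_nhds_principal using x(1) by blast
    moreover have "\<forall>\<^sub>F y in at x within X. orbit_cocycle X \<alpha> g y = k"
      using ev unfolding eventually_inf_principal eventually_at_filter by eventually_elim blast
    ultimately have "\<forall>\<^sub>F y in at x within X.
        real_of_int (orbit_cocycle X \<alpha> g y) = real_of_int (orbit_cocycle X \<alpha> g x)"
      by (simp add: eventually_mono)
    then show ?thesis unfolding continuous_within by (rule tendsto_eventually)
  qed
  have "\<exists>F. continuous_on X F \<and> (\<forall>x\<in>X. \<forall>n. F x \<in> \<kappa> n x)"
  proof (rule limit_map)
    show "locally_const X (\<kappa> n)" for n by (rule tower_lc[OF td])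
    show "\<kappa> n x \<noteq> {}" if "x \<in> X" for n x using nonempty_lift[OF td that, of n] by blast
    show "compact (\<kappa> n x)" if x: "x \<in> X" for n x
    proof -
      have "{y\<in>Y. y \<in> \<kappa> n x} = \<kappa> n x" using tower_sub[OF td x, of n] by blast
      moreover have "clopen_on Y (\<kappa> n x)" using Y.krD(5)[OF tower_kr[OF td] tower_in[OF td x]] .
      ultimately show ?thesis using locally_const_compact[OF Y.compact_X, of "\<lambda>y. y \<in> \<kappa> n x" "\<lambda>b. b"] by simp
    qed
    show "\<kappa> (Suc n) x \<subseteq> \<kappa> n x" if "x \<in> X" for n x using kmono[OF _ that] by simp
    fix e :: real assume "e > 0"
    then obtain n where n: "ee n < e" using eesmall by blast
    have "dist y w < e" if "x \<in> X" "y \<in> \<kappa> (Suc n) x" "w \<in> \<kappa> (Suc n) x" for x y w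
      using smallP[OF tower_in[OF td that(1)] that(2,3)] n by linarith
    then show "\<exists>n. \<forall>x\<in>X. \<forall>y\<in>\<kappa> n x. \<forall>z\<in>\<kappa> n x. dist y z < e" by blast
  qed
  then obtain F where F: "continuous_on X F" "\<And>x n. x \<in> X \<Longrightarrow> F x \<in> \<kappa> n x" by blast
  have FY: "F x \<in> Y" if "x \<in> X" for x using F(2)[OF that] tower_sub[OF td that] by blast
  \<comment> \<open>Atoms shrink to points, so it is enough that \<open>y\<close> lies in the labels
    of \<open>x\<close> from some stage on.\<close>
  have Funique: "F x = y" if x: "x \<in> X" and y: "\<And>n. m \<le> n \<Longrightarrow> y \<in> \<kappa> n x" for x y m
  proof (rule ccontr)
    assume "F x \<noteq> y"
    then obtain n where n: "ee n < dist (F x) y" using eesmall[of "dist (F x) y"] by auto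
    define l where "l = max n m"
    have "ee l \<le> ee n" unfolding ee_def l_def by (intro le_imp_inverse_le) auto
    moreover have "y \<in> \<kappa> (Suc l) x" using y[of "Suc l"] by (simp add: l_def)
    then have "dist (F x) y < ee l" using smallP[OF tower_in[OF td x] F(2)[OF x]] by blast
    ultimately show False using n by linarith
  qed
  have Fq: "F q = y0" by (rule Funique[OF qX, of 0]) (rule stageD(5)[OF st])
  have Fp: "F p = Y.T (-1) y0" by (rule Funique[OF pX, of 0]) (rule stageD(6)[OF st])
  have equi: "\<beta> (F x) = F (g x)" if x: "x \<in> X" for x
  proof (cases "x = p")
    case True
    then show ?thesis
      using Fp Fq g_p Y.T_1[OF Y.T_in[OF y0Y, of "-1"]] Y.T_minus(2)[OF y0Y, of 1] by simp
  next
    case False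
    then obtain m where m: "\<not> \<beta> ` \<kappa> m x \<subseteq> U m" using ex_nr[OF x] by blast
    have "\<beta> (F x) \<in> \<kappa> n (g x)" if "m \<le> n" for n
    proof -
      have nr: "\<not> \<beta> ` \<kappa> n x \<subseteq> U n" using nr_mono[OF that x m] .
      have "\<kappa> n (g x) = \<beta> ` \<kappa> n x" using tower_succ(1)[OF td x nr] g_eq[OF x nr] by simp
      then show ?thesis using F(2)[OF x, of n] by blast
    qed
    then show ?thesis using Funique[OF g_in[OF x], of m "\<beta> (F x)"] by simp
  qed
  have pow_in: "(g ^^ j) x \<in> X" if "x \<in> X" for j x using that by (induction j) (auto intro: g_in)
  have Fpow: "F ((g ^^ j) x) = Y.T (int j) (F x)" if x: "x \<in> X" for j x
  proof (induction j)
    case (Suc j)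
    have "F ((g ^^ Suc j) x) = \<beta> (F ((g ^^ j) x))" using equi[OF pow_in[OF x]] by simp
    also have "\<dots> = Y.T (int (Suc j)) (F x)" using Suc Y.T_succ[OF FY[OF x], of "int j"] by (simp add: add.commute)
    finally show ?case .
  qed simp
  have minimal: "minimal_on X g"
    unfolding minimal_on_def
  proof (intro allI impI)
    fix A assume A: "A \<subseteq> X" "closedin (top_of_set X) A" "g ` A = A"
    have clA: "closed A" using A(2) X.compact_X by (metis closedin_closed_eq compact_imp_closed)
    have Apow: "(g ^^ j) x \<in> A" if "x \<in> A" for j x
    proof (induction j)
      case (Suc j)
      then have "g ((g ^^ j) x) \<in> g ` A" by blast
      then show ?case using A(3) by simp
    qed (simp add: that)
    show "A = {} \<or> A = X"
    proof (cases "A = {}")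
      case False
      then obtain x where x: "x \<in> A" "x \<in> X" using A(1) by blast
      \<comment> \<open>Under \<open>F\<close> the orbit of \<open>x\<close> becomes a
        \<beta>-orbit, which enters every base, and points labelled inside the base are close to
        \<open>q\<close>.\<close>
      have "q \<in> closure A"
        unfolding closure_approachable
      proof (intro allI impI)
        fix e :: real assume "e > 0"
        then obtain n where n: "ee n < e" using eesmall by blast
        have U: "Y.is_base (U (Suc n))" using Y.krD(7)[OF tower_kr[OF td]] .
        obtain j where j: "Y.T (int j) (F x) \<in> U (Suc n)"
          using Y.hits_forward[OF Y.base_clopen[OF U] stageD(4)[OF st] y0Y FY[OF x(2)]] by blast
        let ?w = "(g ^^ j) x"
        have w: "?w \<in> X" "?w \<in> A" using pow_in[OF x(2)] Apow[OF x(1)] by blast+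
        have "\<kappa> (Suc n) ?w \<subseteq> U (Suc n)"
          using tower_meets[OF td w(1) F(2)[OF w(1)]] Fpow[OF x(2)] j by simp
        then have "dist ?w q < e" using smallB[OF w(1)] n by (metis dist_commute less_trans)
        then show "\<exists>y\<in>A. dist y q < e" using w(2) by blast
      qed
      then have qA: "q \<in> A" using clA by simp
      have "X \<subseteq> A"
      proof
        fix x0 assume x0: "x0 \<in> X"
        have "x0 \<in> closure A"
          unfolding closure_approachable
        proof (intro allI impI)
          fix e :: real assume "e > 0"
          then obtain n where n: "dist (z n) x0 < e / 2" "ee n < e / 2"
            using z(2)[OF x0, of "e / 2"] unfolding ee_def by auto
          obtain i j where ij: "\<forall>x\<in>X. Y.T (int i) y0 \<in> \<kappa> (Suc n) x \<longrightarrow> dist (z n) ((\<gamma> (Suc n) ^^ j) x) < ee n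
              \<and> (\<forall>t<j. \<not> \<beta> ` \<kappa> (Suc n) ((\<gamma> (Suc n) ^^ t) x) \<subseteq> U (Suc n))"
            using vis[of n] unfolding visits_def by blast
          \<comment> \<open>\<open>F\<close> sends this point of \<open>A\<close> to
            \<open>T i y0\<close>, so the visit arranged at stage \<open>n\<close> applies to it and
            brings its orbit under \<open>g\<close> close to \<open>z n\<close>.\<close>
          define w where "w = (g ^^ i) q"
          have w: "w \<in> X" "w \<in> A" unfolding w_def using pow_in[OF qX] Apow[OF qA] by blast+
          have "Y.T (int i) y0 \<in> \<kappa> (Suc n) w" using F(2)[OF w(1), of "Suc n"] Fpow[OF qX, of i] Fq by (simp add: w_def)
          then have d: "dist (z n) ((\<gamma> (Suc n) ^^ j) w) < ee n"
            and nr: "\<And>t. t < j \<Longrightarrow> \<not> \<beta> ` \<kappa> (Suc n) ((\<gamma> (Suc n) ^^ t) w) \<subseteq> U (Suc n)" using ij w(1) by blast+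
          have same: "(g ^^ t) w = (\<gamma> (Suc n) ^^ t) w" if "t \<le> j" for t
            using that
          proof (induction t)
            case (Suc t)
            have tX: "(\<gamma> (Suc n) ^^ t) w \<in> X" by (rule X.tfg_pow_in[OF tower_tfg[OF td] w(1)])
            have "(g ^^ Suc t) w = g ((\<gamma> (Suc n) ^^ t) w)" using Suc by simp
            also have "\<dots> = \<gamma> (Suc n) ((\<gamma> (Suc n) ^^ t) w)" using g_eq[OF tX nr] Suc.prems by simp
            finally show ?case by simp
          qed simp
          have "dist ((g ^^ j) w) x0 < e"
          proof -
            have "dist ((g ^^ j) w) x0 \<le> dist (z n) ((g ^^ j) w) + dist (z n) x0" by (rule dist_triangle3)
            also have "\<dots> < e" using d n same[of j] by simp
            finally show ?thesis .
          qed
          then show "\<exists>y\<in>A. dist y x0 < e" using Apow[OF w(2)] by blast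
        qed
        then show "x0 \<in> A" using clA by simp
      qed
      then show ?thesis using A(1) by blast
    qed simp
  qed
  have "F ` X \<subseteq> Y" using FY by blast
  then show ?thesis using F(1) full minimal cocycle equi by blast
qed

end

theorem theorem3p5:
  fixes X :: "'a::metric_space set" and \<alpha> :: "'a \<Rightarrow> 'a"
    and Y :: "'b::metric_space set" and \<beta> :: "'b \<Rightarrow> 'b"
  assumes "cantor_minimal_system X \<alpha>" and "cantor_minimal_system Y \<beta>"
  defines "P1 \<equiv> (\<exists>\<rho>. unital_order_hom Y \<beta> X \<alpha> \<rho>)"
    and "P2 \<equiv> (\<exists>F \<gamma>. continuous_on X F \<and> F ` X \<subseteq> Y \<and> \<gamma> \<in> full_group X \<alpha>
               \<and> minimal_on X \<gamma>
               \<and> (\<exists>p. \<forall>x\<in>X. x \<noteq> p \<longrightarrow>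
                      continuous (at x within X) (\<lambda>y. real_of_int (orbit_cocycle X \<alpha> \<gamma> y)))
               \<and> (\<forall>x\<in>X. \<beta> (F x) = F (\<gamma> x)))"
    and "P3 \<equiv> (\<exists>F. continuous_on X F \<and> F ` X \<subseteq> Y \<and>
               (\<forall>g. cob Y \<beta> g \<longrightarrow> cob X \<alpha> (g \<circ> F)))"
    and "P4 \<equiv> (\<exists>\<sigma> :: nat \<Rightarrow> 'a \<Rightarrow> 'b.
               (\<forall>n. \<exists>\<tau>. homeomorphism X Y (\<sigma> n) \<tau>)
               \<and> uniform_limit Y (\<lambda>n y. \<sigma> n (\<alpha> (inv_into X (\<sigma> n) y))) \<beta> sequentially
               \<and> (\<forall>f. cont_int Y f \<longrightarrow>
                     (\<exists>c N. \<forall>n\<ge>N. k0_class X \<alpha> (f \<circ> \<sigma> n) = c)))"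
  shows "(P1 \<longleftrightarrow> P2) \<and> (P1 \<longleftrightarrow> P3) \<and> (P1 \<longleftrightarrow> P4)"
proof -
  have X: "cantor_minimal X \<alpha>" and Y: "cantor_minimal Y \<beta>"
    using assms(1,2) by (simp_all add: cantor_minimal_def)
  have P1: "P1 \<longleftrightarrow> (\<exists>r. k0_map X \<alpha> Y \<beta> r)"
    unfolding P1_def using k0_map_of_order_hom[OF X Y] k0_map.order_hom_exists by blast
  have "P1 \<Longrightarrow> P2" unfolding P1 P2_def using k0_map.factor_exists by blast
  moreover have "P2 \<Longrightarrow> P3"
  proof -
    assume P2
    then obtain F \<gamma> p where F: "continuous_on X F" "F ` X \<subseteq> Y" "\<gamma> \<in> full_group X \<alpha>"
      "\<forall>x\<in>X. x \<noteq> p \<longrightarrow> continuous (at x within X) (\<lambda>y. real_of_int (orbit_cocycle X \<alpha> \<gamma> y))"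
      "\<forall>x\<in>X. \<beta> (F x) = F (\<gamma> x)" unfolding P2_def by blast
    then show P3 unfolding P3_def using cob_of_factor[OF X Y F] by blast
  qed
  moreover have "P3 \<Longrightarrow> P1" unfolding P1 P3_def using k0_map_of_continuous_map[OF X Y] by blast
  moreover have "P1 \<Longrightarrow> P4" unfolding P1 P4_def using k0_map.approximate_conjugacies by blast
  moreover have "P4 \<Longrightarrow> P1" unfolding P1 P4_def using k0_map_of_approximate_conjugacies[OF X Y] by blast
  ultimately show ?thesis by blast
qed

end
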